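(* Let $A$ be a te-set such that no subset of $A$ is a thick te-interlace with more than six vectors. Then $\operatorname{cone}(A)$ has a regular unimodular Hilbert triangulation.
   Context: A linearly independent set of $\{0,\pm1\}$-vectors (identified with the matrix of its rows) is a tu-set if its matrix is totally unimodular, a te-set if its matrix is totally equimodular (every linearly independent set of rows has full row rank and all nonzero maximal minors of equal absolute value, the equideterminant), a te-lace if it is a te-set, not a tu-set, with all proper subsets tu-sets, and a te-interlace if it is a te-set, not a tu-set, with every pair of its vectors a te-lace; a te-interlace of size $\ell$ is thick if its equideterminant is $2^\ell$. A triangulation of a cone $C$ is a finite collection of simplicial cones covering $C$ that pairwise intersect in common faces; it is Hilbert if all generators of its cones belong to the Hilbert basis of $C$ (the unique minimal set of integer vectors of $C$ generating all integer points of $C$ by nonnegative integer combinations), unimodular if each of its cones is generated by vectors whose maximal minors have gcd $1$, and regular if there is a convex piecewise-linear function on $C$ whose maximal domains of linearity are exactly its maximal cones. *)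

theory Defs
  imports "HOL-Analysis.Analysis"
begin

(* Vectors live in R^n, represented as real^'n.  A finite set of vectors is
   identified with the matrix whose rows are its elements. *)

definition pm1_vec :: "real^'n \<Rightarrow> bool" where
  "pm1_vec x \<longleftrightarrow> (\<forall>i. x $ i \<in> {-1, 0, 1})"

definition int_vec :: "real^'n \<Rightarrow> bool" where
  "int_vec x \<longleftrightarrow> (\<forall>i. x $ i \<in> \<int>)"

definition minor :: "(real^'n) list \<Rightarrow> 'n list \<Rightarrow> real" where
  "minor rs cs = (\<Sum>p\<in>{p. p permutes {..<length rs}}.
       of_int (sign p) * (\<Prod>i<length rs. (rs ! i) $ (cs ! (p i))))"

definition max_minors :: "(real^'n) set \<Rightarrow> real set" where
  "max_minors S = {\<bar>minor rs cs\<bar> | rs cs. distinct rs \<and> set rs = S \<and> distinct cs \<and> length cs = card S}"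

definition pm1_indep :: "(real^'n) set \<Rightarrow> bool" where
  "pm1_indep A \<longleftrightarrow> finite A \<and> (\<forall>a\<in>A. pm1_vec a) \<and> independent A"

definition tu_set :: "(real^'n) set \<Rightarrow> bool" where
  "tu_set A \<longleftrightarrow> pm1_indep A \<and>
     (\<forall>rs cs. distinct rs \<and> set rs \<subseteq> A \<and> distinct cs \<and> length cs = length rs
        \<longrightarrow> minor rs cs \<in> {-1, 0, 1})"

(* totally equimodular: for every linearly independent set of rows (here: every
   subset, as A is independent), all nonzero maximal minors have equal absolute value *)
definition te_set :: "(real^'n) set \<Rightarrow> bool" where
  "te_set A \<longleftrightarrow> pm1_indep A \<and>
     (\<forall>S\<subseteq>A. \<forall>d\<in>max_minors S. \<forall>e\<in>max_minors S. d \<noteq> 0 \<longrightarrow> e \<noteq> 0 \<longrightarrow> d = e)"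

definition equideterminant :: "(real^'n) set \<Rightarrow> real" where
  "equideterminant A = (THE d. d \<in> max_minors A \<and> d \<noteq> 0)"

definition te_lace :: "(real^'n) set \<Rightarrow> bool" where
  "te_lace A \<longleftrightarrow> te_set A \<and> \<not> tu_set A \<and> (\<forall>B. B \<subset> A \<longrightarrow> tu_set B)"

definition te_interlace :: "(real^'n) set \<Rightarrow> bool" where
  "te_interlace A \<longleftrightarrow> te_set A \<and> \<not> tu_set A \<and>
     (\<forall>a\<in>A. \<forall>b\<in>A. a \<noteq> b \<longrightarrow> te_lace {a, b})"

definition thick_te_interlace :: "(real^'n) set \<Rightarrow> bool" where
  "thick_te_interlace A \<longleftrightarrow> te_interlace A \<and> equideterminant A = 2 ^ card A"

definition gen_cone :: "(real^'n) set \<Rightarrow> (real^'n) set" where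
  "gen_cone G = {x. \<exists>c. (\<forall>g\<in>G. c g \<ge> 0) \<and> x = (\<Sum>g\<in>G. c g *\<^sub>R g)}"

definition int_generating :: "(real^'n) set \<Rightarrow> (real^'n) set \<Rightarrow> bool" where
  "int_generating C H \<longleftrightarrow> H \<subseteq> C \<inter> {x. int_vec x} \<and>
     (\<forall>x\<in>C. int_vec x \<longrightarrow>
        (\<exists>F c. finite F \<and> F \<subseteq> H \<and> x = (\<Sum>h\<in>F. real (c h :: nat) *\<^sub>R h)))"

definition hilbert_basis :: "(real^'n) set \<Rightarrow> (real^'n) set \<Rightarrow> bool" where
  "hilbert_basis C H \<longleftrightarrow> int_generating C H \<and> (\<forall>H'. H' \<subset> H \<longrightarrow> \<not> int_generating C H')"

(* A triangulation is given by the (finite) family T of generator sets of its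
   simplicial cones: each generator set is finite and linearly independent, the
   cones cover C, and any two cones intersect in a common face of both. *)
definition cone_triangulation :: "(real^'n) set \<Rightarrow> (real^'n) set set \<Rightarrow> bool" where
  "cone_triangulation C T \<longleftrightarrow> finite T \<and>
     (\<forall>G\<in>T. finite G \<and> independent G) \<and>
     (\<Union>G\<in>T. gen_cone G) = C \<and>
     (\<forall>G\<in>T. \<forall>G'\<in>T. (gen_cone G \<inter> gen_cone G') face_of gen_cone G \<and>
                       (gen_cone G \<inter> gen_cone G') face_of gen_cone G')"

definition hilbert_triangulation :: "(real^'n) set \<Rightarrow> (real^'n) set set \<Rightarrow> bool" where
  "hilbert_triangulation C T \<longleftrightarrow> cone_triangulation C T \<and>
     (\<exists>H. hilbert_basis C H \<and> (\<forall>G\<in>T. G \<subseteq> H))"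

definition unimodular_triangulation :: "(real^'n) set \<Rightarrow> (real^'n) set set \<Rightarrow> bool" where
  "unimodular_triangulation C T \<longleftrightarrow> cone_triangulation C T \<and>
     (\<forall>G\<in>T. (\<forall>g\<in>G. int_vec g) \<and> Gcd ((\<lambda>m. \<lfloor>m\<rfloor>) ` max_minors G) = 1)"

definition maximal_cones :: "(real^'n) set set \<Rightarrow> (real^'n) set set" where
  "maximal_cones T = {gen_cone G | G. G \<in> T \<and> \<not> (\<exists>G'\<in>T. gen_cone G \<subset> gen_cone G')}"

(* regular: a convex piecewise-linear function on C whose maximal domains of
   linearity are exactly the maximal cones: f is linear on each maximal cone and
   not linear on the union of any two distinct maximal cones *)
definition regular_triangulation :: "(real^'n) set \<Rightarrow> (real^'n) set set \<Rightarrow> bool" where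
  "regular_triangulation C T \<longleftrightarrow> cone_triangulation C T \<and>
     (\<exists>f :: real^'n \<Rightarrow> real. convex_on C f \<and>
        (\<forall>\<sigma>\<in>maximal_cones T. \<exists>l. linear l \<and> (\<forall>x\<in>\<sigma>. f x = l x)) \<and>
        (\<forall>\<sigma>\<in>maximal_cones T. \<forall>\<tau>\<in>maximal_cones T. \<sigma> \<noteq> \<tau> \<longrightarrow>
            \<not> (\<exists>l. linear l \<and> (\<forall>x\<in>\<sigma> \<union> \<tau>. f x = l x))))"

end

(* Let L be the lattice of integer points in the span of A. Contracting a vector of a totally equimodular
   set leaves such a set, and calling two vectors equivalent if they have the same support, the coordinates
   over A of a point of L are half-integral outside the nontrivial classes and in (1/4)Z inside. The vectors
   whose coordinate is in 1/4 + (1/2)Z split into minimal sets that are pairwise disjoint and even, because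
   distinct laces with at least three vectors are disjoint. Hence they can be matched in pairs {a, b}
   with (a + b)/2 in L.

   Subdivide cone(A) stellarly at these half sums, then at all other half-integral elements of the Hilbert
   basis, then at its remaining elements; lowering the height of each new vector slightly keeps the
   triangulation regular. Each cell generates a sublattice of index 2^k with elementary abelian quotient. If
   k > 0, a minimal subset of generators whose half sum q is in L gives q = chi_K/4 + chi_P/2, where K
   is a union of matched pairs, whose half sums were still available, and P is contained in A. By minimality q is
   irreducible, so it was a subdivision vector, a contradiction. *)
theory Submission
  imports Defs "Jordan_Normal_Form.Determinant"
begin

text \<open>The obstacle is the denominator four. A stellar step at a point whose cell coordinates
  are 0 or 1/2 keeps the lattice half-integral over the cell and can be repeated; coordinates 1/4
  and 3/4 allow no such step. They arise inside a support class: pivoting makes the other members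
  even, halving them separates their supports, and what is half-integral after the contraction is
  quarter-integral before it. On a minimal set K of such coordinates no lattice point separates two
  elements by parity, so any pairing of K serves, and chi_K/4 is again a half sum, namely of the
  half sums of the pairs. The pairs are treated while their vectors still generate every cell; being
  disjoint, they do not disturb each other. The later half-integral steps remove only vectors of
  \<open>A\<close>, so the half sums of the pairs stay in all cells. The structural part uses
  vectors of minimal support instead of minors, because contraction cuts the span with a coordinate
  hyperplane, and minimal supports there are minimal in the whole span.\<close>

no_notation Matrix.vec_index (infixl "$" 100)

lemmas vec_eq_iff = Finite_Cartesian_Product.vec_eq_iff

section \<open>Minors and determinants\<close>

lemma minor_eq_det:
  assumes "length rs = n"
  shows "minor rs cs = Determinant.det (mat n n (\<lambda>(i, j). vec_nth (rs ! i) (cs ! j)))"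
proof -
  have "(\<Prod>i<n. vec_nth (rs ! i) (cs ! p i)) = (\<Prod>i = 0..<n. mat n n (\<lambda>(i, j). vec_nth (rs ! i) (cs ! j)) $$ (i, p i))"
    if "p permutes {0..<n}" for p
  proof (rule prod.cong)
    show "{..<n} = {0..<n}" by auto
    fix i assume "i \<in> {0..<n}"
    then show "vec_nth (rs ! i) (cs ! p i) = mat n n (\<lambda>(i, j). vec_nth (rs ! i) (cs ! j)) $$ (i, p i)"
      using permutes_in_image[OF that, of i] by simp
  qed
  then show ?thesis
    unfolding minor_def assms det_def'[OF mat_carrier[of n n]] lessThan_atLeast0
    by (intro sum.cong) (auto simp: sign_def lessThan_atLeast0)
qed

text \<open>A zero determinant of the transpose has a nonzero kernel vector, which is a dependency
  of the rows restricted to \<open>cs\<close>.\<close>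

lemma minor_nonzero:
  assumes "length rs = n"
    and "\<And>x. (\<And>j. j < n \<Longrightarrow> (\<Sum>i<n. x i * vec_nth (rs ! i) (cs ! j)) = 0) \<Longrightarrow> (\<forall>i<n. x i = 0)"
  shows "minor rs cs \<noteq> 0"
proof
  let ?A = "mat n n (\<lambda>(i, j). vec_nth (rs ! i) (cs ! j))"
  assume "minor rs cs = 0"
  then have "Determinant.det (transpose_mat ?A) = 0"
    by (subst det_transpose[of _ n]) (simp_all add: minor_eq_det[OF assms(1)])
  then obtain v where v: "v \<in> carrier_vec n" "v \<noteq> 0\<^sub>v n" "transpose_mat ?A *\<^sub>v v = 0\<^sub>v n"
    using det_0_iff_vec_prod_zero_field[of "transpose_mat ?A" n] by auto
  have "(\<Sum>i<n. vec_index v i * vec_nth (rs ! i) (cs ! j)) = 0" if j: "j < n" for j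
  proof -
    have "vec_index (transpose_mat ?A *\<^sub>v v) j = 0" using v(3) j by simp
    then show ?thesis using j v(1) by (simp add: scalar_prod_def lessThan_atLeast0 mult.commute)
  qed
  from assms(2)[OF this] have "\<forall>i<n. vec_index v i = 0" .
  then have "v = 0\<^sub>v n" using v(1) by (intro eq_vecI) auto
  then show False using v(2) by simp
qed

lemma smult_one_mult_vec:
  assumes b: "(b :: real Matrix.vec) \<in> carrier_vec n"
  shows "(d \<cdot>\<^sub>m 1\<^sub>m n) *\<^sub>v b = d \<cdot>\<^sub>v b"
proof (rule eq_vecI)
  fix i assume "i < dim_vec (d \<cdot>\<^sub>v b)"
  then have i: "i < n" using b by simp
  have "vec_index ((d \<cdot>\<^sub>m 1\<^sub>m n) *\<^sub>v b) i = (d \<cdot>\<^sub>v unit_vec n i) \<bullet> b" using i by simp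
  also have "\<dots> = d * (unit_vec n i \<bullet> b)" using i b by (intro smult_scalar_prod_distrib) auto
  finally show "vec_index ((d \<cdot>\<^sub>m 1\<^sub>m n) *\<^sub>v b) i = vec_index (d \<cdot>\<^sub>v b) i" using i b by simp
qed (use b in simp)

text \<open>By Cramer's rule, exchanging the last column changes the minor by the ratio of the entries of
  any row combination that vanishes in the common columns.\<close>

lemma minor_exchange:
  assumes n: "length rs = Suc k" "length cs = k"
    and w: "\<And>c. w c = (\<Sum>i<Suc k. x i * vec_nth (rs ! i) c)" "\<And>c. c \<in> set cs \<Longrightarrow> w c = 0"
    and nz: "minor rs (cs @ [a]) \<noteq> 0"
  shows "w a * minor rs (cs @ [b]) = w b * minor rs (cs @ [a])"
proof -
  let ?n = "Suc k"
  let ?M = "\<lambda>c. mat ?n ?n (\<lambda>(i, j). vec_nth (rs ! i) ((cs @ [c]) ! j))"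
  let ?b = "Matrix.vec ?n (\<lambda>i. vec_nth (rs ! i) b)"
  let ?d = "Determinant.det (?M a)"
  have d: "?d \<noteq> 0" using nz minor_eq_det[OF n(1)] by simp
  have car: "?M a \<in> carrier_mat ?n ?n" by simp
  \<comment> \<open>\<open>v\<close> is the inverse of \<open>?M a\<close> applied to column
    \<open>b\<close>, written with the adjugate.\<close>
  define v where "v = (1 / ?d) \<cdot>\<^sub>v (adj_mat (?M a) *\<^sub>v ?b)"
  have adj: "adj_mat (?M a) \<in> carrier_mat ?n ?n" by (rule adj_mat(1)[OF car])
  have vc: "v \<in> carrier_vec ?n" unfolding v_def using adj by simp
  have "?M a *\<^sub>v v = (1 / ?d) \<cdot>\<^sub>v (?M a *\<^sub>v (adj_mat (?M a) *\<^sub>v ?b))"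
    unfolding v_def using adj by (intro mult_mat_vec[OF car]) simp
  also have "?M a *\<^sub>v (adj_mat (?M a) *\<^sub>v ?b) = (?M a * adj_mat (?M a)) *\<^sub>v ?b"
    using adj by (intro assoc_mult_mat_vec[symmetric, OF car]) auto
  also have "\<dots> = ?d \<cdot>\<^sub>v ?b" unfolding adj_mat(2)[OF car] by (rule smult_one_mult_vec) simp
  finally have Mv: "?M a *\<^sub>v v = ?b" using d by (simp add: smult_smult_assoc)
  \<comment> \<open>Replacing the last column turns the matrix for \<open>a\<close> into that for
    \<open>b\<close>, so Cramer's rule makes the last entry of \<open>v\<close> the ratio of the
    minors.\<close>
  have "replace_col (?M a) ?b k = ?M b"
  proof (rule eq_matI)
    fix i j assume "i < dim_row (?M b)" "j < dim_col (?M b)"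
    then show "replace_col (?M a) ?b k $$ (i, j) = ?M b $$ (i, j)"
      using n(2) by (auto simp: replace_col_def nth_append less_Suc_eq)
  qed (auto simp: replace_col_def)
  then have minors: "minor rs (cs @ [b]) = vec_index v k * minor rs (cs @ [a])"
    using cramer_lemma_mat[OF car vc, of k] Mv by (simp add: minor_eq_det[OF n(1)])
  \<comment> \<open>Applying the row combination \<open>x\<close> to both sides leaves only the last
    column, since \<open>w\<close> vanishes on the others.\<close>
  have "w b = (\<Sum>i<?n. x i * vec_index (?M a *\<^sub>v v) i)"
    unfolding Mv w(1) by simp
  also have "\<dots> = (\<Sum>i<?n. \<Sum>j<?n. x i * (vec_nth (rs ! i) ((cs @ [a]) ! j) * vec_index v j))"
    using vc by (intro sum.cong) (auto simp: scalar_prod_def sum_distrib_left lessThan_atLeast0 distrib_left)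
  also have "\<dots> = (\<Sum>j<?n. w ((cs @ [a]) ! j) * vec_index v j)"
    unfolding w(1) by (subst sum.swap) (simp add: sum_distrib_right distrib_right mult.assoc)
  also have "\<dots> = w a * vec_index v k"
    using w(2) n(2) by (simp add: nth_append)
  finally show ?thesis using minors by simp
qed

text \<open>\<open>X\<close> is an integral left inverse, so two integer determinants have product
  1.\<close>

lemma minor_integral_inverse:
  assumes n: "length rs = n"
    and int: "\<And>i j. i < n \<Longrightarrow> j < n \<Longrightarrow> vec_nth (rs ! i) (cs ! j) \<in> \<int>"
    and X: "\<And>l i. l < n \<Longrightarrow> i < n \<Longrightarrow> X l i \<in> \<int>"
    and inv: "\<And>l j. l < n \<Longrightarrow> j < n \<Longrightarrow> (\<Sum>i<n. X l i * vec_nth (rs ! i) (cs ! j)) = (if j = l then 1 else 0)"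
  shows "\<bar>minor rs cs\<bar> = 1"
proof -
  let ?M = "mat n n (\<lambda>(i, j). vec_nth (rs ! i) (cs ! j))" and ?X = "mat n n (\<lambda>(l, i). X l i)"
  have "?X * ?M = 1\<^sub>m n"
    by (rule eq_matI) (auto simp: scalar_prod_def inv[unfolded lessThan_atLeast0])
  then have "Determinant.det ?X * Determinant.det ?M = 1"
    using det_mult[of ?X n ?M] by simp
  moreover have di: "Determinant.det (mat n n f) \<in> \<int>" if "\<And>i j. i < n \<Longrightarrow> j < n \<Longrightarrow> f (i, j) \<in> \<int>" for f :: "nat \<times> nat \<Rightarrow> real"
    unfolding det_def'[OF mat_carrier[of n n]]
  proof (intro Ints_sum Ints_mult Ints_prod)
    fix p i assume "p \<in> {p. p permutes {0..<n}}" "i \<in> {0..<n}"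
    then show "mat n n f $$ (i, p i) \<in> \<int>" using that permutes_in_image[of p "{0..<n}" i] by auto
  qed (simp add: sign_def)
  moreover have "Determinant.det ?X \<in> \<int>" "Determinant.det ?M \<in> \<int>"
    by (rule di; simp add: int X)+
  ultimately obtain k l :: int where kl: "Determinant.det ?X = of_int k" "Determinant.det ?M = of_int l"
    and "of_int k * of_int l = (1::real)"
    by (auto elim!: Ints_cases)
  then have "k * l = 1" by (simp flip: of_int_mult)
  then have "\<bar>l\<bar> = 1" using abs_zmult_eq_1[of l k] by (simp add: mult.commute)
  then show ?thesis using kl(2) by (simp add: minor_eq_det[OF n] flip: of_int_abs)
qed

section \<open>Regular spaces\<close>

definition supp :: "real^'n \<Rightarrow> 'n set" where
  "supp v = {j. v $ j \<noteq> 0}"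

text \<open>Families are indexed because contraction changes the vectors while the indices, and with
  them the coefficients, persist.\<close>

definition lc :: "'i set \<Rightarrow> ('i \<Rightarrow> real) \<Rightarrow> ('i \<Rightarrow> real^'n) \<Rightarrow> real^'n" where
  "lc S x p = (\<Sum>i\<in>S. x i *\<^sub>R p i)"

text \<open>The inner condition says that \<open>w\<close> is an elementary vector, one of minimal
  nonempty support; these are the regular chain groups of Tutte.\<close>

definition regular_space :: "(real^'n) set \<Rightarrow> bool" where
  "regular_space W \<longleftrightarrow> (\<forall>w\<in>W. w \<noteq> 0 \<longrightarrow>
     (\<forall>w'\<in>W. w' \<noteq> 0 \<longrightarrow> supp w' \<subseteq> supp w \<longrightarrow> supp w' = supp w) \<longrightarrow>
     (\<exists>r. \<forall>j. w $ j \<in> {0, r, -r}))"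

text \<open>Determinant-free form of total equimodularity: by Cramer's rule, the nonzero maximal minors of a set of
  rows agree up to sign iff the vectors of minimal support in its span have entries \<open>0, r, -r\<close>.\<close>

definition TE :: "'i set \<Rightarrow> ('i \<Rightarrow> real^'n) \<Rightarrow> bool" where
  "TE E p \<longleftrightarrow> finite E \<and> (\<forall>i\<in>E. pm1_vec (p i)) \<and>
     (\<forall>x. lc E x p = 0 \<longrightarrow> (\<forall>i\<in>E. x i = 0)) \<and>
     (\<forall>S\<subseteq>E. regular_space (range (\<lambda>x. lc S x p)))"

lemma supp_eq_empty: "supp v = {} \<longleftrightarrow> v = 0"
  by (auto simp: supp_def vec_eq_iff)

lemma int_vec_add: "int_vec v \<Longrightarrow> int_vec w \<Longrightarrow> int_vec (v + w)"
  and int_vec_diff: "int_vec v \<Longrightarrow> int_vec w \<Longrightarrow> int_vec (v - w)"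
  and int_vec_scaleR: "a \<in> \<int> \<Longrightarrow> int_vec v \<Longrightarrow> int_vec (a *\<^sub>R v)"
  and int_vec_0: "int_vec 0"
  by (auto simp: int_vec_def)

lemma int_vec_sum: "(\<And>i. i \<in> S \<Longrightarrow> int_vec (f i)) \<Longrightarrow> int_vec (sum f S)"
  by (induction S rule: infinite_finite_induct) (auto intro: int_vec_add int_vec_0)

lemma pm1_int_vec: "pm1_vec v \<Longrightarrow> int_vec v"
  by (auto simp: pm1_vec_def int_vec_def) (metis Ints_0 Ints_1 Ints_minus)

lemma pm1_cases: "pm1_vec v \<Longrightarrow> v $ j = -1 \<or> v $ j = 0 \<or> v $ j = 1"
  by (auto simp: pm1_vec_def)

lemma lc_nth: "lc S x p $ j = (\<Sum>i\<in>S. x i * p i $ j)"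
  by (simp add: lc_def)

lemma lc_cong: "(\<And>i. i \<in> S \<Longrightarrow> x i = y i) \<Longrightarrow> (\<And>i. i \<in> S \<Longrightarrow> p i = q i) \<Longrightarrow> lc S x p = lc S y q"
  unfolding lc_def by (rule sum.cong) auto

lemma lc_add: "lc S (\<lambda>i. x i + y i) p = lc S x p + lc S y p"
  by (simp add: lc_def scaleR_left_distrib sum.distrib)

lemma lc_diff: "lc S (\<lambda>i. x i - y i) p = lc S x p - lc S y p"
  by (simp add: lc_def scaleR_left_diff_distrib sum_subtractf)

lemma lc_scale: "lc S (\<lambda>i. c * x i) p = c *\<^sub>R lc S x p"
  by (simp add: lc_def scaleR_sum_right)

lemma subspace_lc: "subspace (range (\<lambda>x. lc S x p))"
  unfolding subspace_def
proof (intro conjI ballI allI)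
  show "0 \<in> range (\<lambda>x. lc S x p)" by (rule image_eqI[of _ _ "\<lambda>_. 0"]) (auto simp: lc_def)
next
  fix v w assume "v \<in> range (\<lambda>x. lc S x p)" "w \<in> range (\<lambda>x. lc S x p)"
  then show "v + w \<in> range (\<lambda>x. lc S x p)" by (auto simp flip: lc_add)
next
  fix c v assume "v \<in> range (\<lambda>x. lc S x p)"
  then show "c *\<^sub>R v \<in> range (\<lambda>x. lc S x p)" by (auto simp flip: lc_scale)
qed

lemma lc_mono_zero:
  assumes "finite E" "S \<subseteq> E"
  shows "lc S x p = lc E (\<lambda>i. if i \<in> S then x i else 0) p"
proof -
  have "lc E (\<lambda>i. if i \<in> S then x i else 0) p = (\<Sum>i\<in>S. (if i \<in> S then x i else 0) *\<^sub>R p i)"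
    unfolding lc_def by (rule sum.mono_neutral_right) (use assms in auto)
  then show ?thesis by (simp add: lc_def)
qed

lemma lc_split: "finite E \<Longrightarrow> S \<subseteq> E \<Longrightarrow> lc E x p = lc S x p + lc (E - S) x p"
  unfolding lc_def by (subst sum.subset_diff[of S E]) (auto simp: add.commute)

lemma lc_insert: "finite S \<Longrightarrow> c \<notin> S \<Longrightarrow> lc (insert c S) x p = x c *\<^sub>R p c + lc S x p"
  by (simp add: lc_def)

lemma TE_subset:
  assumes "TE E p" "S \<subseteq> E" shows "TE S p"
proof -
  have fE: "finite E" using assms by (simp add: TE_def)
  have "x i = 0" if z: "lc S x p = 0" and i: "i \<in> S" for x i
  proof -
    have "lc E (\<lambda>i. if i \<in> S then x i else 0) p = 0" using lc_mono_zero[OF fE assms(2), of x p] z by simp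
    then have "(if i \<in> S then x i else 0) = 0" using assms i unfolding TE_def by blast
    then show ?thesis using i by simp
  qed
  moreover have "finite S" using fE assms(2) finite_subset by blast
  moreover have "\<forall>T\<subseteq>S. regular_space (range (\<lambda>x. lc T x p))" "\<forall>i\<in>S. pm1_vec (p i)"
    using assms unfolding TE_def by blast+
  ultimately show ?thesis unfolding TE_def by blast
qed

lemma TE_finite: "TE E p \<Longrightarrow> finite E"
  and TE_pm1: "TE E p \<Longrightarrow> i \<in> E \<Longrightarrow> pm1_vec (p i)"
  and TE_indep: "TE E p \<Longrightarrow> lc E x p = 0 \<Longrightarrow> i \<in> E \<Longrightarrow> x i = 0"
  and TE_regular: "TE E p \<Longrightarrow> S \<subseteq> E \<Longrightarrow> regular_space (range (\<lambda>x. lc S x p))"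
  by (auto simp: TE_def)

lemma TE_nonzero: assumes "TE E p" "i \<in> E" shows "p i \<noteq> 0"
proof
  assume "p i = 0"
  have fE: "finite E" by (rule TE_finite[OF assms(1)])
  have "lc {i} (\<lambda>_. 1) p = 0" using \<open>p i = 0\<close> by (simp add: lc_def)
  then show False using TE_indep[OF TE_subset[OF assms(1), of "{i}"], of "\<lambda>_. 1" i] assms(2) by auto
qed

lemma TE_pair_indep:
  assumes "TE E p" "i \<in> E" "k \<in> E" "i \<noteq> k" "a *\<^sub>R p i + b *\<^sub>R p k = 0"
  shows "a = 0 \<and> b = 0"
proof -
  have t: "TE {i,k} p" by (rule TE_subset[OF assms(1)]) (use assms in auto)
  have "lc {i,k} (\<lambda>j. if j = i then a else b) p = 0"
    using assms by (simp add: lc_def)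
  from TE_indep[OF t this, of i] TE_indep[OF t this, of k] show ?thesis using assms by auto
qed

lemma TE_triple_indep:
  assumes "TE E p" "i \<in> E" "k \<in> E" "l \<in> E" "i \<noteq> k" "i \<noteq> l" "k \<noteq> l"
    and "a *\<^sub>R p i + b *\<^sub>R p k + c *\<^sub>R p l = 0"
  shows "a = 0 \<and> b = 0 \<and> c = 0"
proof -
  have t: "TE {i,k,l} p" by (rule TE_subset[OF assms(1)]) (use assms in auto)
  have z: "lc {i,k,l} (\<lambda>j. if j = i then a else if j = k then b else c) p = 0"
    using assms by (simp add: lc_def add.assoc)
  from TE_indep[OF t z, of i] TE_indep[OF t z, of k] TE_indep[OF t z, of l] show ?thesis
    using assms by auto
qed

lemma TE_not_pm: assumes "TE E p" "i \<in> E" "k \<in> E" "i \<noteq> k" shows "p i \<noteq> p k" "p i \<noteq> - p k"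
  using TE_pair_indep[OF assms, of 1 "-1"] TE_pair_indep[OF assms, of 1 1] by auto

lemma regular_spaceD:
  assumes "regular_space W" "w \<in> W" "w \<noteq> 0"
    and "\<And>w'. w' \<in> W \<Longrightarrow> w' \<noteq> 0 \<Longrightarrow> supp w' \<subseteq> supp w \<Longrightarrow> supp w' = supp w"
  shows "\<exists>r. \<forall>j. w $ j \<in> {0, r, -r}"
  using assms unfolding regular_space_def by simp

text \<open>A nonzero vector of least support below \<open>w\<close> is elementary, and division by
  the common size \<open>r\<close> of its entries makes it a 0, 1, -1 vector.\<close>

lemma elementary_below:
  fixes w :: "real^'n"
  assumes W: "regular_space W" "subspace W" "w \<in> W" "w \<noteq> 0"
  obtains e where "e \<in> W" "e \<noteq> 0" "supp e \<subseteq> supp w" "pm1_vec e"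
proof -
  let ?P = "\<lambda>v. v \<in> W \<and> v \<noteq> 0 \<and> supp v \<subseteq> supp w"
  obtain e where e: "?P e" and min: "\<And>v. ?P v \<Longrightarrow> card (supp e) \<le> card (supp v)"
  proof -
    have "?P w" using assms by simp
    from ex_has_least_nat[of ?P, OF this, of "\<lambda>v. card (supp v)"] that show ?thesis by blast
  qed
  have "supp v = supp e" if "v \<in> W" "v \<noteq> 0" "supp v \<subseteq> supp e" for v
  proof -
    have "?P v" using that e by blast
    then have "card (supp e) \<le> card (supp v)" by (rule min)
    then show ?thesis using that(3) by (intro card_seteq) auto
  qed
  then have "\<exists>r. \<forall>j. e $ j \<in> {0, r, -r}" using e by (intro regular_spaceD[OF W(1)]) auto
  then obtain r where r: "\<forall>j. e $ j \<in> {0, r, -r}" by auto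
  have "r \<noteq> 0" using r e by (auto simp: vec_eq_iff)
  let ?e = "(1/r) *\<^sub>R e"
  have "supp ?e = supp e" using \<open>r \<noteq> 0\<close> by (auto simp: supp_def)
  moreover have "pm1_vec ?e" unfolding pm1_vec_def
  proof
    fix j show "?e $ j \<in> {-1,0,1}" using spec[OF r, of j] \<open>r \<noteq> 0\<close> by (auto simp: field_simps)
  qed
  moreover have "?e \<in> W" using e W(2) by (simp add: subspace_def)
  ultimately show ?thesis using that[of ?e] e \<open>r \<noteq> 0\<close> by auto
qed

text \<open>Subtracting integral multiples of elementary vectors shrinks the support.\<close>

lemma regular_integral:
  fixes w :: "real^'n"
  assumes W: "regular_space W" "subspace W"
    and sep: "\<And>w. w \<in> W \<Longrightarrow> (\<forall>j\<in>N. w $ j = 0) \<Longrightarrow> w = 0"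
    and w: "w \<in> W" "\<forall>j\<in>N. w $ j \<in> \<int>"
  shows "int_vec w"
  using w
proof (induction "card (supp w)" arbitrary: w rule: less_induct)
  case less
  show ?case
  proof (cases "w = 0")
    case True then show ?thesis by (simp add: int_vec_0)
  next
    case False
    obtain e where e: "e \<in> W" "e \<noteq> 0" "supp e \<subseteq> supp w" "pm1_vec e"
      using elementary_below[OF W less.prems(1) False] by blast
    obtain k where k: "k \<in> N" "e $ k \<noteq> 0" using sep e by blast
    have ek: "e $ k * e $ k = 1" using pm1_cases[OF e(4), of k] k(2) by auto
    \<comment> \<open>The multiplier is integral because \<open>k\<close> lies in \<open>N\<close>,
      and it cancels entry \<open>k\<close> because \<open>e $ k\<close> is its own inverse.\<close>
    let ?t = "w $ k * e $ k"
    let ?w = "w - ?t *\<^sub>R e"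
    have ti: "?t \<in> \<int>" using less.prems(2) k(1) pm1_int_vec[OF e(4)] by (auto simp: int_vec_def)
    have wW: "?w \<in> W" using less.prems(1) e(1) W(2) by (simp add: subspace_diff subspace_scale)
    have sub: "supp ?w \<subseteq> supp w - {k}"
      using e(3) ek by (auto simp: supp_def)
    have "k \<in> supp w" using k e(3) by (auto simp: supp_def)
    then have "card (supp ?w) < card (supp w)" using sub by (metis Diff_subset finite psubset_card_mono psubsetI subset_Diff_insert subset_trans)
    moreover have "\<forall>j\<in>N. ?w $ j \<in> \<int>"
      using less.prems(2) ti pm1_int_vec[OF e(4)] by (auto simp: int_vec_def)
    ultimately have "int_vec ?w" using less.hyps wW by blast
    then have "int_vec (?w + ?t *\<^sub>R e)" using ti pm1_int_vec[OF e(4)] by (intro int_vec_add int_vec_scaleR)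
    then show ?thesis by simp
  qed
qed

text \<open>If the two vectors agreed in one common column and disagreed in another up to the same
  sign, their combination vanishing in the first column would be elementary in their plane. It would
  have an entry of size 2 where they disagree and one of size 1 where the supports differ.\<close>

lemma TE_sign:
  assumes te: "TE E p" and i: "i \<in> E" and k: "k \<in> E" and ne: "supp (p i) \<noteq> supp (p k)"
  obtains s where "s = 1 \<or> s = (-1::real)" "\<And>j. p i $ j \<noteq> 0 \<Longrightarrow> p k $ j \<noteq> 0 \<Longrightarrow> p i $ j = s * p k $ j"
proof (cases "\<exists>j1. p i $ j1 \<noteq> 0 \<and> p k $ j1 \<noteq> 0")
  case False then show ?thesis using that[of 1] by auto
next
  case True
  then obtain j1 where j1: "p i $ j1 \<noteq> 0" "p k $ j1 \<noteq> 0" by blast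
  have pm: "pm1_vec (p i)" "pm1_vec (p k)" by (rule TE_pm1[OF te i], rule TE_pm1[OF te k])
  have ik: "i \<noteq> k" "k \<noteq> i" using ne by auto
  define s where "s = p i $ j1 * p k $ j1"
  have s: "s = 1 \<or> s = -1" using pm1_cases[OF pm(1), of j1] pm1_cases[OF pm(2), of j1] j1 by (auto simp: s_def)
  have ps: "p i $ j1 = s * p k $ j1" using pm1_cases[OF pm(1), of j1] pm1_cases[OF pm(2), of j1] j1 by (auto simp: s_def)
  have "p i $ j = s * p k $ j" if j: "p i $ j \<noteq> 0" "p k $ j \<noteq> 0" for j
  proof (rule ccontr)
    assume neq: "p i $ j \<noteq> s * p k $ j"
    define w where "w = p i - s *\<^sub>R p k"
    let ?W = "range (\<lambda>x. lc {i,k} x p)"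
    have wW: "w \<in> ?W"
      by (rule image_eqI[of _ _ "\<lambda>l. if l = i then 1 else -s"]) (auto simp: lc_def w_def ik)
    have w0: "w \<noteq> 0" using TE_pair_indep[OF te i k ik(1), of 1 "-s"] by (auto simp: w_def)
    have el: "supp w' = supp w" if w': "w' \<in> ?W" "w' \<noteq> 0" "supp w' \<subseteq> supp w" for w'
    proof -
      obtain x where x: "w' = x i *\<^sub>R p i + x k *\<^sub>R p k" using w'(1) ik by (auto simp: lc_def)
      have "w $ j1 = 0" by (simp add: w_def ps)
      then have "w' $ j1 = 0" using w'(3) by (auto simp: supp_def)
      then have "x i * (s * p k $ j1) + x k * p k $ j1 = 0" by (simp add: x ps)
      then have "(x i * s + x k) * p k $ j1 = 0" by (simp add: algebra_simps)
      then have "x k = - (x i * s)" using j1 by auto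
      then have w'e: "w' = x i *\<^sub>R w" by (simp add: x w_def algebra_simps)
      then have "x i \<noteq> 0" using w'(2) by auto
      then show ?thesis by (auto simp: w'e supp_def)
    qed
    have "regular_space ?W" by (rule TE_regular[OF te]) (use i k in auto)
    from regular_spaceD[OF this wW w0 el] obtain r where r: "\<forall>j. w $ j \<in> {0, r, -r}" by auto
    have wj: "\<bar>w $ j\<bar> = 2"
      using neq j s pm1_cases[OF pm(1), of j] pm1_cases[OF pm(2), of j] by (auto simp: w_def)
    obtain l where "p i $ l = 0 \<longleftrightarrow> p k $ l \<noteq> 0" using ne by (auto simp: supp_def)
    then have wl: "\<bar>w $ l\<bar> = 1"
      using s pm1_cases[OF pm(1), of l] pm1_cases[OF pm(2), of l] by (auto simp: w_def)
    show False using spec[OF r, of j] spec[OF r, of l] wj wl by auto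
  qed
  then show ?thesis by (rule that[OF s])
qed

section \<open>Contraction\<close>

text \<open>Vectors with the support of the contracted one become even after pivoting and are halved.\<close>

definition pivot_scale :: "('i \<Rightarrow> real^'n) \<Rightarrow> 'i \<Rightarrow> 'i \<Rightarrow> real" where
  "pivot_scale p c i = (if supp (p i) = supp (p c) then 2 else 1)"

text \<open>The product \<open>p i $ j0 * p c $ j0\<close> is the quotient of the two entries when
  the pivot is 1 or -1, so entry \<open>j0\<close> becomes 0.\<close>

definition contr :: "('i \<Rightarrow> real^'n) \<Rightarrow> 'i \<Rightarrow> 'n \<Rightarrow> 'i \<Rightarrow> real^'n" where
  "contr p c j0 i = (1 / pivot_scale p c i) *\<^sub>R (p i - (p i $ j0 * p c $ j0) *\<^sub>R p c)"

lemma pivot_scale_pos [simp]: "pivot_scale p c i \<noteq> 0" "pivot_scale p c i > 0"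
  by (auto simp: pivot_scale_def)

text \<open>Any vector supported inside a vector with zero entry at \<open>j0\<close> also vanishes
  there, so elementary vectors of \<open>W0\<close> are elementary in \<open>W\<close>.\<close>

lemma regular_subspace:
  assumes "regular_space W" "W0 \<subseteq> W" "\<And>w. w \<in> W \<Longrightarrow> w $ j0 = 0 \<Longrightarrow> w \<in> W0" "\<And>w. w \<in> W0 \<Longrightarrow> w $ j0 = 0"
  shows "regular_space W0"
  unfolding regular_space_def
proof (intro ballI impI)
  fix w assume w: "w \<in> W0" "w \<noteq> 0"
    and el: "\<forall>w'\<in>W0. w' \<noteq> 0 \<longrightarrow> supp w' \<subseteq> supp w \<longrightarrow> supp w' = supp w"
  show "\<exists>r. \<forall>j. w $ j \<in> {0, r, -r}"
  proof (rule regular_spaceD[OF assms(1)])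
    show "w \<in> W" "w \<noteq> 0" using w assms(2) by auto
    fix w' assume w': "w' \<in> W" "w' \<noteq> 0" "supp w' \<subseteq> supp w"
    have "w' $ j0 = 0" using w'(3) assms(4)[OF w(1)] by (auto simp: supp_def)
    then have "w' \<in> W0" using assms(3) w'(1) by simp
    then show "supp w' = supp w" using el w' by simp
  qed
qed

locale contraction =
  fixes E :: "'i set" and p :: "'i \<Rightarrow> real^'n" and c :: 'i and j0 :: 'n
  assumes te: "TE E p" and c: "c \<in> E" and j0: "p c $ j0 \<noteq> 0"
begin

abbreviation "q \<equiv> contr p c j0"

lemma finE: "finite E" by (rule TE_finite[OF te])

lemma pmE: "i \<in> E \<Longrightarrow> pm1_vec (p i)" by (rule TE_pm1[OF te])

lemma pmc: "pm1_vec (p c)" by (rule pmE[OF c])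

lemma cc: "p c $ j0 * p c $ j0 = 1"
  using pm1_cases[OF pmc, of j0] j0 by auto

lemma lc_q: "lc S x q = lc S (\<lambda>i. x i / pivot_scale p c i) p
    - (\<Sum>i\<in>S. x i / pivot_scale p c i * (p i $ j0 * p c $ j0)) *\<^sub>R p c"
proof -
  have "lc S x q = (\<Sum>i\<in>S. (x i / pivot_scale p c i) *\<^sub>R p i - (x i / pivot_scale p c i * (p i $ j0 * p c $ j0)) *\<^sub>R p c)"
    unfolding lc_def contr_def by (rule sum.cong) (auto simp: scaleR_diff_right)
  then show ?thesis by (simp add: sum_subtractf lc_def scaleR_sum_left)
qed

lemma q_j0: "q i $ j0 = 0"
  using cc by (simp add: contr_def algebra_simps)

lemma lc_q_j0: "lc S x q $ j0 = 0"
  by (simp add: lc_nth q_j0)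

lemma lc_up:
  assumes "S \<subseteq> E - {c}"
  shows "\<exists>t. lc S x q = lc (insert c S) (\<lambda>i. if i = c then t else x i / pivot_scale p c i) p"
proof -
  have fS: "finite S" "c \<notin> S" using assms finE finite_subset by auto
  have "lc S (\<lambda>i. x i / pivot_scale p c i) p = lc S (\<lambda>i. if i = c then t else x i / pivot_scale p c i) p" for t
    by (rule lc_cong) (use fS in auto)
  then show ?thesis
    by (intro exI[of _ "- (\<Sum>i\<in>S. x i / pivot_scale p c i * (p i $ j0 * p c $ j0))"])
       (simp add: lc_q lc_insert fS)
qed

text \<open>Contraction is the projection along \<open>p c\<close> onto the vectors vanishing at
  \<open>j0\<close>: the coordinate of \<open>c\<close> is dropped and the others are
  rescaled.\<close>

lemma lc_down:
  assumes S: "S \<subseteq> E - {c}"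
  shows "lc S (\<lambda>i. pivot_scale p c i * x i) q
    = lc (insert c S) x p - (lc (insert c S) x p $ j0 * p c $ j0) *\<^sub>R p c"
proof -
  have fS: "finite S" "c \<notin> S" using assms finE finite_subset by auto
  have "lc (insert c S) x p $ j0 * p c $ j0 = x c + (\<Sum>i\<in>S. x i * (p i $ j0 * p c $ j0))"
    using cc fS by (simp add: lc_nth algebra_simps sum_distrib_left sum_distrib_right)
  then show ?thesis by (simp add: lc_q lc_insert fS algebra_simps)
qed

lemma int_down:
  assumes "int_vec (lc E x p)"
  shows "int_vec (lc (E - {c}) (\<lambda>i. pivot_scale p c i * x i) q)"
proof -
  have i: "insert c (E - {c}) = E" using c by auto
  have "lc E x p $ j0 * p c $ j0 \<in> \<int>"
    using assms pm1_int_vec[OF pmc] by (auto simp: int_vec_def)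
  then show ?thesis
    unfolding lc_down[OF subset_refl] i using assms pm1_int_vec[OF pmc]
    by (intro int_vec_diff int_vec_scaleR)
qed

text \<open>The lift is the same vector read over the old family, so integrality is kept and
  \<open>t\<close> is whatever coefficient the vector forces.\<close>

lemma int_up:
  assumes "int_vec (lc (E - {c}) x q)"
  obtains t where "int_vec (lc E (\<lambda>i. if i = c then t else x i / pivot_scale p c i) p)"
proof -
  have i: "insert c (E - {c}) = E" using c by auto
  from lc_up[of "E - {c}" x] assms that show ?thesis unfolding i by auto
qed

text \<open>By \<open>TE_sign\<close> the entries cancel on the whole intersection of the supports,
  which leaves the symmetric difference.\<close>

lemma q_other:
  assumes i: "i \<in> E" and ne: "supp (p i) \<noteq> supp (p c)"
  obtains (zero) "p i $ j0 = 0" "q i = p i"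
    | (nz) s where "s = 1 \<or> s = (-1::real)" "p i $ j0 \<noteq> 0"
        "\<And>j. p i $ j \<noteq> 0 \<Longrightarrow> p c $ j \<noteq> 0 \<Longrightarrow> p i $ j = s * p c $ j"
        "q i = p i - s *\<^sub>R p c" "supp (q i) = sym_diff (supp (p i)) (supp (p c))"
proof (cases "p i $ j0 = 0")
  case True
  then show ?thesis using ne by (intro zero) (auto simp: contr_def pivot_scale_def)
next
  case False
  obtain s where s: "s = 1 \<or> s = (-1::real)"
    "\<And>j. p i $ j \<noteq> 0 \<Longrightarrow> p c $ j \<noteq> 0 \<Longrightarrow> p i $ j = s * p c $ j"
    by (rule TE_sign[OF te i c ne]) (rule that)
  have "p i $ j0 * p c $ j0 = s" using s(2)[OF False j0] cc by simp
  then have q: "q i = p i - s *\<^sub>R p c" using ne by (simp add: contr_def pivot_scale_def)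
  have "supp (q i) = sym_diff (supp (p i)) (supp (p c))"
  proof -
    have "q i $ j \<noteq> 0 \<longleftrightarrow> (p i $ j \<noteq> 0) \<noteq> (p c $ j \<noteq> 0)" for j
      using s(1) s(2)[of j] by (cases "p i $ j = 0"; cases "p c $ j = 0") (auto simp: q)
    then show ?thesis by (auto simp: supp_def)
  qed
  then show ?thesis using nz[OF s(1) False s(2) q] by simp
qed

text \<open>On a common support the pivoted entries are 0 or twice those of \<open>p i\<close>; this
  is why halving keeps them integral.\<close>

lemma q_same:
  assumes i: "i \<in> E" and eq: "supp (p i) = supp (p c)"
  obtains s where "s = 1 \<or> s = (-1::real)" "\<And>j. q i $ j = (if p i $ j = s * p c $ j then 0 else p i $ j)"
    "q i = (1/2) *\<^sub>R (p i - s *\<^sub>R p c)"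
proof -
  have iff: "p i $ j \<noteq> 0 \<longleftrightarrow> p c $ j \<noteq> 0" for j using eq by (auto simp: supp_def)
  define s where "s = p i $ j0 * p c $ j0"
  have s: "s = 1 \<or> s = -1"
    using pm1_cases[OF pmE[OF i], of j0] pm1_cases[OF pmc, of j0] iff[of j0] j0 by (auto simp: s_def)
  have q: "q i = (1/2) *\<^sub>R (p i - s *\<^sub>R p c)" using eq by (simp add: contr_def pivot_scale_def s_def)
  have "q i $ j = (if p i $ j = s * p c $ j then 0 else p i $ j)" for j
    using s pm1_cases[OF pmE[OF i], of j] pm1_cases[OF pmc, of j] iff[of j] by (auto simp: q)
  then show ?thesis using that[OF s _ q] by simp
qed

lemma q_pm1: assumes i: "i \<in> E" shows "pm1_vec (q i)"
proof (cases "supp (p i) = supp (p c)")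
  case True
  show ?thesis
    by (rule q_same[OF i True]) (use pmE[OF i] in \<open>auto simp: pm1_vec_def\<close>)
next
  case False
  show ?thesis
  proof (rule q_other[OF i False])
    assume "q i = p i" then show ?thesis using pmE[OF i] by simp
  next
    fix s assume s: "s = 1 \<or> s = (-1::real)"
      "\<And>j. p i $ j \<noteq> 0 \<Longrightarrow> p c $ j \<noteq> 0 \<Longrightarrow> p i $ j = s * p c $ j" "q i = p i - s *\<^sub>R p c"
    show ?thesis unfolding pm1_vec_def
    proof
      fix j show "q i $ j \<in> {-1,0,1}"
        using s(1) s(2)[of j] pm1_cases[OF pmE[OF i], of j] pm1_cases[OF pmc, of j]
        by (cases "p i $ j = 0"; cases "p c $ j = 0") (auto simp: s(3))
    qed
  qed
qed

text \<open>The span of contracted vectors is the part of the old span that vanishes at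
  \<open>j0\<close>, so \<open>regular_subspace\<close> applies.\<close>

lemma te_q: "TE (E - {c}) q"
  unfolding TE_def
proof (intro conjI ballI allI impI)
  show "finite (E - {c})" using finE by simp
  show "pm1_vec (q i)" if "i \<in> E - {c}" for i using that by (intro q_pm1) simp
next
  fix x i assume z: "lc (E - {c}) x q = 0" and i: "i \<in> E - {c}"
  obtain t where "lc (E - {c}) x q = lc (insert c (E - {c})) (\<lambda>i. if i = c then t else x i / pivot_scale p c i) p"
    using lc_up[of "E - {c}" x] by auto
  then have "lc E (\<lambda>i. if i = c then t else x i / pivot_scale p c i) p = 0"
    using z c by (simp add: insert_absorb)
  from TE_indep[OF te this, of i] i show "x i = 0" by simp
next
  fix S assume S: "S \<subseteq> E - {c}"
  show "regular_space (range (\<lambda>x. lc S x q))"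
  proof (rule regular_subspace)
    show "regular_space (range (\<lambda>x. lc (insert c S) x p))"
      by (rule TE_regular[OF te]) (use S c in auto)
    show "range (\<lambda>x. lc S x q) \<subseteq> range (\<lambda>x. lc (insert c S) x p)"
      using lc_up[OF S] by auto
    show "w $ j0 = 0" if "w \<in> range (\<lambda>x. lc S x q)" for w using that lc_q_j0 by auto
    fix w assume w: "w \<in> range (\<lambda>x. lc (insert c S) x p)" "w $ j0 = 0"
    then obtain x where x: "w = lc (insert c S) x p" by auto
    have "w = lc S (\<lambda>i. pivot_scale p c i * x i) q"
      using lc_down[OF S, of x] w(2) by (simp add: x)
    then show "w \<in> range (\<lambda>x. lc S x q)" by simp
  qed
qed

text \<open>Outside the class of \<open>c\<close>, contraction can merge a support only with its
  symmetric difference with the support of \<open>c\<close>.\<close>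

lemma supp_q_eq:
  assumes i: "i \<in> E" "supp (p i) \<noteq> supp (p c)" and k: "k \<in> E" "supp (p k) \<noteq> supp (p c)"
    and eq: "supp (q i) = supp (q k)"
  shows "supp (p k) = supp (p i) \<or> supp (p k) = sym_diff (supp (p i)) (supp (p c))"
  by (rule q_other[OF i]; rule q_other[OF k]) (use eq in auto)

lemma supp_q_cong:
  assumes i: "i \<in> E" "supp (p i) \<noteq> supp (p c)" and k: "k \<in> E" "supp (p k) = supp (p i)"
  shows "supp (q i) = supp (q k)"
proof -
  have k': "supp (p k) \<noteq> supp (p c)" using i k by simp
  have "p i $ j0 \<noteq> 0 \<longleftrightarrow> p k $ j0 \<noteq> 0" using k(2) by (auto simp: supp_def)
  then show ?thesis
    by (rule_tac q_other[OF i]; rule_tac q_other[OF k(1) k']) (use k in auto)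
qed

text \<open>On the support of \<open>q d\<close> both \<open>q i\<close> and \<open>q d\<close> are,
  up to sign, equal to \<open>p c\<close>. Equal supports would make them equal up to sign, against
  independence.\<close>

lemma supp_q_mixed:
  assumes i: "i \<in> E" "supp (p i) \<noteq> supp (p c)" and d: "d \<in> E" "d \<noteq> c" "supp (p d) = supp (p c)"
  shows "supp (q i) \<noteq> supp (q d)"
proof
  assume eq: "supp (q i) = supp (q d)"
  have ne: "i \<noteq> c" "i \<noteq> d" using i d by auto
  have npm: "q i \<noteq> q d" "q i \<noteq> - q d"
    by (rule TE_not_pm[OF te_q, of i d]; use i d ne in auto)+
  obtain s where s: "s = 1 \<or> s = (-1::real)"
    and qd: "\<And>j. q d $ j = (if p d $ j = s * p c $ j then 0 else p d $ j)"
    using q_same[OF d(1,3)] by metis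
  have iffd: "p d $ j \<noteq> 0 \<longleftrightarrow> p c $ j \<noteq> 0" for j using d(3) by (auto simp: supp_def)
  have qd': "q d $ j = - s * p c $ j" if "q d $ j \<noteq> 0" for j
    using that qd[of j] s iffd[of j] pm1_cases[OF pmE[OF d(1)], of j] pm1_cases[OF pmc, of j]
    by (auto split: if_splits)
  have sub: "q d $ j \<noteq> 0 \<Longrightarrow> p c $ j \<noteq> 0" for j using qd[of j] iffd[of j] by (auto split: if_splits)
  have iff: "q i $ j \<noteq> 0 \<longleftrightarrow> q d $ j \<noteq> 0" for j using eq by (auto simp: supp_def)
  obtain u where u: "u = 1 \<or> u = (-1::real)" "\<And>j. q i $ j \<noteq> 0 \<Longrightarrow> q i $ j = u * p c $ j"
  proof (rule q_other[OF i])
    assume a: "q i = p i"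
    obtain u where "u = 1 \<or> u = (-1::real)"
      "\<And>j. p i $ j \<noteq> 0 \<Longrightarrow> p c $ j \<noteq> 0 \<Longrightarrow> p i $ j = u * p c $ j"
      by (rule TE_sign[OF te i(1) c i(2)]) (rule that)
    then show thesis using that[of u] sub iff by (auto simp: a)
  next
    fix u assume u: "u = 1 \<or> u = (-1::real)" "\<And>j. p i $ j \<noteq> 0 \<Longrightarrow> p c $ j \<noteq> 0 \<Longrightarrow> p i $ j = u * p c $ j"
      "q i = p i - u *\<^sub>R p c"
    have "q i $ j = - u * p c $ j" if "q i $ j \<noteq> 0" for j
    proof -
      have "p c $ j \<noteq> 0" using that iff sub by blast
      then show ?thesis using that u(2)[of j] by (auto simp: u(3))
    qed
    then show thesis using that[of "-u"] u(1) by auto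
  qed
  have "q i $ j = (- u * s) * q d $ j" for j
  proof (cases "q i $ j = 0")
    case True then show ?thesis using iff[of j] by auto
  next
    case False
    then have "q i $ j = u * p c $ j" "q d $ j = - s * p c $ j" using u(2) qd' iff by blast+
    then show ?thesis using s by auto
  qed
  then have "q i = (- u * s) *\<^sub>R q d" by (simp add: vec_eq_iff)
  then show False using npm u(1) s by auto
qed

end

text \<open>The signs of a vector relative to \<open>p k\<close> and to \<open>p c\<close> determine
  each other, so a vector with the support of \<open>p i\<close> is fixed up to one global sign.
  Hence \<open>p i\<close> and \<open>p i2\<close> would be dependent. This prevents contraction
  from enlarging a nontrivial support class.\<close>

lemma TE_triple:
  assumes te: "TE E p" and E: "i \<in> E" "k \<in> E" "c \<in> E" "i2 \<in> E"
    and ne: "supp (p i) \<noteq> supp (p k)" "i2 \<noteq> i" "supp (p i2) = supp (p i)"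
    and sc: "supp (p c) = sym_diff (supp (p i)) (supp (p k))"
  shows False
proof -
  have ci: "supp (p i) \<noteq> supp (p c)"
    using sc TE_nonzero[OF te E(2)] supp_eq_empty[of "p k"] by auto
  have kc: "supp (p k) \<noteq> supp (p c)"
    using sc TE_nonzero[OF te E(1)] supp_eq_empty[of "p i"] by auto
  obtain g where g: "g = 1 \<or> g = (-1::real)" "\<And>j. p k $ j \<noteq> 0 \<Longrightarrow> p c $ j \<noteq> 0 \<Longrightarrow> p k $ j = g * p c $ j"
    by (rule TE_sign[OF te E(2,3) kc]) (rule that)
  have key: "\<exists>a. (a = 1 \<or> a = (-1::real)) \<and> (\<forall>j. p l $ j \<noteq> 0 \<longrightarrow> p k $ j \<noteq> 0 \<longrightarrow> p l $ j = a * p k $ j)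
      \<and> (\<forall>j. p l $ j \<noteq> 0 \<longrightarrow> p k $ j = 0 \<longrightarrow> p l $ j = a * g * p c $ j)"
    if l: "l \<in> E" "supp (p l) = supp (p i)" for l
  proof -
    have lk: "supp (p l) \<noteq> supp (p k)" and lc: "supp (p l) \<noteq> supp (p c)" using ne ci l by auto
    have dist: "l \<noteq> k" "l \<noteq> c" "k \<noteq> c" using lk lc kc by auto
    obtain a where a: "a = 1 \<or> a = (-1::real)" "\<And>j. p l $ j \<noteq> 0 \<Longrightarrow> p k $ j \<noteq> 0 \<Longrightarrow> p l $ j = a * p k $ j"
      by (rule TE_sign[OF te l(1) E(2) lk]) (rule that)
    obtain b where b: "b = 1 \<or> b = (-1::real)" "\<And>j. p l $ j \<noteq> 0 \<Longrightarrow> p c $ j \<noteq> 0 \<Longrightarrow> p l $ j = b * p c $ j"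
      by (rule TE_sign[OF te l(1) E(3) lc]) (rule that)
    have sj: "p c $ j \<noteq> 0 \<longleftrightarrow> (p l $ j \<noteq> 0) \<noteq> (p k $ j \<noteq> 0)" for j
      using sc l(2) by (auto simp: supp_def set_eq_iff)
    \<comment> \<open>With the opposite sign, \<open>p l\<close> would equal \<open>a\<close> times
      \<open>p k\<close> plus \<open>b\<close> times \<open>p c\<close>, against
      independence.\<close>
    have bag: "b = a * g"
    proof (rule ccontr)
      assume "b \<noteq> a * g"
      then have bn: "b = - a * g" using a(1) b(1) g(1) by auto
      have "p l $ j - a * p k $ j - b * p c $ j = 0" for j
      proof (cases "p l $ j = 0")
        case True
        then show ?thesis using g(2)[of j] sj[of j] by (cases "p k $ j = 0") (simp_all add: bn)
      next
        case False
        then show ?thesis using a(2)[of j] b(2)[of j] sj[of j] by (cases "p k $ j = 0") simp_all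
      qed
      then have "1 *\<^sub>R p l + (-a) *\<^sub>R p k + (-b) *\<^sub>R p c = 0" by (simp add: vec_eq_iff)
      from TE_triple_indep[OF te l(1) E(2,3) dist this] show False by simp
    qed
    have "p l $ j = a * g * p c $ j" if "p l $ j \<noteq> 0" "p k $ j = 0" for j
      using b(2)[OF that(1)] sj[of j] that bag by blast
    then show ?thesis using a by blast
  qed
  obtain a where a: "a = 1 \<or> a = (-1::real)"
    and a1: "\<And>j. p i $ j \<noteq> 0 \<Longrightarrow> p k $ j \<noteq> 0 \<Longrightarrow> p i $ j = a * p k $ j"
    and a2: "\<And>j. p i $ j \<noteq> 0 \<Longrightarrow> p k $ j = 0 \<Longrightarrow> p i $ j = a * g * p c $ j"
    using key[OF E(1) refl] by blast
  obtain b where b: "b = 1 \<or> b = (-1::real)"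
    and b1: "\<And>j. p i2 $ j \<noteq> 0 \<Longrightarrow> p k $ j \<noteq> 0 \<Longrightarrow> p i2 $ j = b * p k $ j"
    and b2: "\<And>j. p i2 $ j \<noteq> 0 \<Longrightarrow> p k $ j = 0 \<Longrightarrow> p i2 $ j = b * g * p c $ j"
    using key[OF E(4) ne(3)] by blast
  have "p i2 $ j = a * b * p i $ j" for j
  proof (cases "p i $ j = 0")
    case True
    then show ?thesis using ne(3) by (auto simp: supp_def)
  next
    case False
    then have i2: "p i2 $ j \<noteq> 0" using ne(3) by (auto simp: supp_def)
    show ?thesis
    proof (cases "p k $ j = 0")
      case True
      show ?thesis unfolding a2[OF False True] b2[OF i2 True] using a by auto
    next
      case kn: False
      show ?thesis unfolding a1[OF False kn] b1[OF i2 kn] using a by auto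
    qed
  qed
  then have "p i2 = (a * b) *\<^sub>R p i" by (simp add: vec_eq_iff)
  then show False using TE_not_pm[OF te E(4,1) ne(2)] a b by auto
qed

section \<open>Support classes\<close>

lemma pm1_scale_Ints:
  assumes "pm1_vec v" "v $ j \<noteq> 0" "t * v $ j \<in> \<int>" shows "t \<in> \<int>"
  using pm1_cases[OF assms(1), of j] assms by auto

text \<open>On the support of \<open>p c\<close> all members of the class are proportional to \<open>p c\<close>, so independence makes the
  remaining columns separating for their span.\<close>

lemma class_plus_one_integral:
  assumes te: "TE E p" and I: "I \<subseteq> E" "\<And>i. i \<in> I \<Longrightarrow> supp (p i) = J"
    and c: "c \<in> E" "supp (p c) \<noteq> J" and int: "int_vec (lc I x p + t *\<^sub>R p c)"
  shows "int_vec (lc I x p)"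
proof -
  have cI: "c \<notin> I" using I c by auto
  have fI: "finite I" using I(1) TE_finite[OF te] finite_subset by auto
  have pmc: "pm1_vec (p c)" by (rule TE_pm1[OF te c(1)])
  have "t \<in> \<int> \<or> int_vec (lc I x p)"
  proof (cases "supp (p c) \<subseteq> J")
    case False
    then obtain j where j: "j \<in> supp (p c)" "j \<notin> J" by auto
    have "p i $ j = 0" if "i \<in> I" for i using I(2)[OF that] j(2) by (auto simp: supp_def)
    then have "lc I x p $ j = 0" by (simp add: lc_nth)
    moreover have "(lc I x p + t *\<^sub>R p c) $ j \<in> \<int>" using int unfolding int_vec_def by blast
    ultimately have "t * p c $ j \<in> \<int>" by simp
    then have "t \<in> \<int>" by (rule pm1_scale_Ints[OF pmc, rotated]) (use j(1) in \<open>simp add: supp_def\<close>)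
    then show ?thesis ..
  next
    case True
    have "\<exists>s. \<forall>j. p c $ j \<noteq> 0 \<longrightarrow> p i $ j = s * p c $ j" if i: "i \<in> I" for i
    proof -
      have ie: "i \<in> E" "supp (p i) \<noteq> supp (p c)" using i I c by auto
      obtain s where "s = 1 \<or> s = (-1::real)"
        "\<And>j. p i $ j \<noteq> 0 \<Longrightarrow> p c $ j \<noteq> 0 \<Longrightarrow> p i $ j = s * p c $ j"
        by (rule TE_sign[OF te ie(1) c(1) ie(2)]) (rule that)
      then show ?thesis using True I(2)[OF i] by (auto simp: supp_def)
    qed
    then obtain s where s: "\<And>i j. i \<in> I \<Longrightarrow> p c $ j \<noteq> 0 \<Longrightarrow> p i $ j = s i * p c $ j" by metis
    have "int_vec (lc I x p)"
    proof (rule regular_integral[of "range (\<lambda>x. lc I x p)" "- supp (p c)"])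
      show "regular_space (range (\<lambda>x. lc I x p))" by (rule TE_regular[OF te I(1)])
      show "subspace (range (\<lambda>x. lc I x p))" by (rule subspace_lc)
      show "lc I x p \<in> range (\<lambda>x. lc I x p)" by simp
      show "\<forall>j\<in>- supp (p c). lc I x p $ j \<in> \<int>"
      proof
        fix j assume "j \<in> - supp (p c)"
        moreover have "(lc I x p + t *\<^sub>R p c) $ j \<in> \<int>" using int unfolding int_vec_def by blast
        ultimately show "lc I x p $ j \<in> \<int>" by (simp add: supp_def)
      qed
      fix w assume w: "w \<in> range (\<lambda>x. lc I x p)" "\<forall>j\<in>- supp (p c). w $ j = 0"
      then obtain y where y: "w = lc I y p" by auto
      define u where "u = (\<Sum>i\<in>I. y i * s i)"
      have "w $ j = u * p c $ j" for j
      proof (cases "p c $ j = 0")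
        case True then show ?thesis using w(2) by (simp add: supp_def)
      next
        case False
        then show ?thesis using s by (simp add: y lc_nth u_def sum_distrib_right mult.assoc)
      qed
      then have wu: "w = u *\<^sub>R p c" by (simp add: vec_eq_iff)
      \<comment> \<open>The multiple \<open>u\<close> of \<open>p c\<close> lies in the span of the
        class, which independence forbids unless \<open>u\<close> is 0.\<close>
      have "lc (insert c I) (\<lambda>i. if i = c then - u else y i) p = - u *\<^sub>R p c + lc I (\<lambda>i. if i = c then - u else y i) p"
        by (simp add: lc_insert fI cI)
      also have "lc I (\<lambda>i. if i = c then - u else y i) p = lc I y p" by (rule lc_cong) (use cI in auto)
      finally have z: "lc (insert c I) (\<lambda>i. if i = c then - u else y i) p = 0" using wu y by simp
      have "TE (insert c I) p" by (rule TE_subset[OF te]) (use I c in auto)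
      from TE_indep[OF this z, of c] have "u = 0" by simp
      then show "w = 0" using wu by simp
    qed
    then show ?thesis by simp
  qed
  then show ?thesis
  proof
    assume "t \<in> \<int>"
    from int_vec_diff[OF int int_vec_scaleR[OF this pm1_int_vec[OF pmc]]] show ?thesis by simp
  qed
qed

lemma TE_nth_nonzero: assumes "TE E p" "i \<in> E" obtains j where "p i $ j \<noteq> 0"
  using TE_nonzero[OF assms] by (auto simp: vec_eq_iff)

text \<open>Induction by contracting vectors outside the class. The class neither grows nor is
  rescaled, so the induction hypothesis yields its part modulo \<open>p c\<close>;
  \<open>class_plus_one_integral\<close> then removes the multiple of \<open>p c\<close>.\<close>

lemma class_integral:
  assumes "TE E p" "i0 \<in> E" "i1 \<in> E" "i1 \<noteq> i0" "supp (p i1) = supp (p i0)" "int_vec (lc E x p)"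
  shows "int_vec (lc {k \<in> E. supp (p k) = supp (p i0)} x p)"
  using assms
proof (induction "card E" arbitrary: E p x rule: less_induct)
  case less
  note te = less.prems(1)
  let ?I = "{k \<in> E. supp (p k) = supp (p i0)}"
  show ?case
  proof (cases "?I = E")
    case True then show ?thesis using less.prems(6) by simp
  next
    case False
    then obtain c where hc: "c \<in> E" "supp (p c) \<noteq> supp (p i0)" by auto
    obtain j0 where j0: "p c $ j0 \<noteq> 0" by (rule TE_nth_nonzero[OF te hc(1)])
    interpret contraction E p c j0 by unfold_locales (fact te hc(1) j0)+
    have ic: "supp (p i0) \<noteq> supp (p c)" using hc(2) by metis
    have cls: "{k \<in> E - {c}. supp (q k) = supp (q i0)} = ?I"
    proof (intro Set.set_eqI iffI)
      fix k assume "k \<in> ?I"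
      then show "k \<in> {k \<in> E - {c}. supp (q k) = supp (q i0)}"
        using supp_q_cong[OF less.prems(2) ic, of k] hc by auto
    next
      fix k assume k: "k \<in> {k \<in> E - {c}. supp (q k) = supp (q i0)}"
      have kc: "supp (p k) \<noteq> supp (p c)" using supp_q_mixed[OF less.prems(2) ic, of k] k by auto
      have "supp (p k) = supp (p i0) \<or> supp (p k) = sym_diff (supp (p i0)) (supp (p c))"
        by (rule supp_q_eq[OF less.prems(2) ic]) (use k kc in auto)
      \<comment> \<open>A new member of the class would have the symmetric difference as support,
        and \<open>i1\<close> is the second class member that \<open>TE_triple\<close>
        needs.\<close>
      moreover have False if "supp (p k) = sym_diff (supp (p i0)) (supp (p c))"
      proof (rule TE_triple[OF te less.prems(2) _ hc(1) less.prems(3) _ less.prems(4,5)])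
        show "k \<in> E" using k by simp
        show "supp (p i0) \<noteq> supp (p k)"
          using that j0 supp_eq_empty[of "p c"] by (auto simp: supp_def)
        show "supp (p c) = sym_diff (supp (p i0)) (supp (p k))" using that by auto
      qed
      ultimately show "k \<in> ?I" using k by auto
    qed
    have s1: "pivot_scale p c k = 1" if "k \<in> ?I" for k using that hc by (auto simp: pivot_scale_def)
    have "int_vec (lc {k \<in> E - {c}. supp (q k) = supp (q i0)} (\<lambda>i. pivot_scale p c i * x i) q)"
    proof (rule less.hyps)
      show "card (E - {c}) < card E" using finE hc(1) by (rule card_Diff1_less)
      show "TE (E - {c}) q" by (rule te_q)
      show "i0 \<in> E - {c}" "i1 \<in> E - {c}" using less.prems hc by auto
      show "i1 \<noteq> i0" by fact
      show "supp (q i1) = supp (q i0)" using supp_q_cong[OF less.prems(2) ic less.prems(3,5)] by simp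
      show "int_vec (lc (E - {c}) (\<lambda>i. pivot_scale p c i * x i) q)" by (rule int_down[OF less.prems(6)])
    qed
    moreover have "?I \<subseteq> E - {c}" "c \<notin> ?I" "finite ?I" using hc finE by auto
    \<comment> \<open>The contracted class part, read over the old vectors, is the class part plus a
      multiple of \<open>p c\<close>.\<close>
    ultimately have "int_vec (lc ?I x p + (x c - lc (insert c ?I) x p $ j0 * p c $ j0) *\<^sub>R p c)"
      unfolding cls lc_down[OF \<open>?I \<subseteq> E - {c}\<close>] by (simp add: lc_insert algebra_simps)
    then show ?thesis
      by (rule class_plus_one_integral[OF te, of _ "supp (p i0)", rotated 4]) (use hc in auto)
  qed
qed

text \<open>As neither vector is plus or minus the other, some column shows equal signs and some
  column opposite signs; these give the sum and the difference.\<close>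

lemma same_supp_pair:
  assumes te: "TE E p" and ik: "i \<in> E" "k \<in> E" "i \<noteq> k" and eq: "supp (p i) = supp (p k)"
    and int: "int_vec (a *\<^sub>R p i + b *\<^sub>R p k)"
  shows "a + b \<in> \<int>" "a - b \<in> \<int>"
proof -
  note pi = pm1_cases[OF TE_pm1[OF te ik(1)]] and pk = pm1_cases[OF TE_pm1[OF te ik(2)]]
  have iff: "p i $ j \<noteq> 0 \<longleftrightarrow> p k $ j \<noteq> 0" for j using eq by (auto simp: supp_def)
  have ints: "a * p i $ j + b * p k $ j \<in> \<int>" for j using int by (simp add: int_vec_def)
  obtain j1 where j1: "p i $ j1 \<noteq> p k $ j1" using TE_not_pm(1)[OF te ik] by (auto simp: vec_eq_iff)
  then have "p i $ j1 = 1 \<and> p k $ j1 = -1 \<or> p i $ j1 = -1 \<and> p k $ j1 = 1"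
    using pi[of j1] pk[of j1] iff[of j1] by auto
  then show "a - b \<in> \<int>"
  proof
    assume h: "p i $ j1 = 1 \<and> p k $ j1 = -1"
    then show ?thesis using ints[of j1] by simp
  next
    assume h: "p i $ j1 = -1 \<and> p k $ j1 = 1"
    then have "- (a - b) \<in> \<int>" using ints[of j1] by simp
    from Ints_minus[OF this] show ?thesis by simp
  qed
  obtain j2 where j2: "p i $ j2 \<noteq> - p k $ j2" using TE_not_pm(2)[OF te ik] by (auto simp: vec_eq_iff)
  then have "p i $ j2 = 1 \<and> p k $ j2 = 1 \<or> p i $ j2 = -1 \<and> p k $ j2 = -1"
    using pi[of j2] pk[of j2] iff[of j2] by auto
  then show "a + b \<in> \<int>"
  proof
    assume h: "p i $ j2 = 1 \<and> p k $ j2 = 1"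
    then show ?thesis using ints[of j2] by simp
  next
    assume h: "p i $ j2 = -1 \<and> p k $ j2 = -1"
    then have "- (a + b) \<in> \<int>" using ints[of j2] by (simp add: algebra_simps)
    from Ints_minus[OF this] show ?thesis by (simp add: add.commute)
  qed
qed

lemma same_supp_half_sum:
  assumes "pm1_vec v" "pm1_vec w" "supp v = supp w"
  shows "int_vec ((1/2) *\<^sub>R v + (1/2) *\<^sub>R w)"
  unfolding int_vec_def
proof
  fix j
  have "v $ j \<noteq> 0 \<longleftrightarrow> w $ j \<noteq> 0" using assms(3) by (auto simp: supp_def)
  then show "((1/2) *\<^sub>R v + (1/2) *\<^sub>R w) $ j \<in> \<int>"
    using pm1_cases[OF assms(1), of j] pm1_cases[OF assms(2), of j] by auto
qed

lemma half_sum_same_supp: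
  assumes "pm1_vec v" "pm1_vec w" "int_vec ((1/2) *\<^sub>R v + (1/2) *\<^sub>R w)"
  shows "supp v = supp w"
proof -
  have "v $ j \<noteq> 0 \<longleftrightarrow> w $ j \<noteq> 0" for j
  proof -
    have "(1/2) * v $ j + (1/2) * w $ j \<in> \<int>" using assms(3) by (simp add: int_vec_def)
    then obtain n where "(1/2) * v $ j + (1/2) * w $ j = of_int n" by (auto elim: Ints_cases)
    then have "v $ j + w $ j = of_int (2 * n)" by simp
    moreover have "v $ j + w $ j \<noteq> of_int (2 * n)" if "v $ j + w $ j = 1 \<or> v $ j + w $ j = -1"
    proof
      assume "v $ j + w $ j = of_int (2 * n)"
      with that have "(of_int (2 * n) :: real) = of_int 1 \<or> (of_int (2 * n) :: real) = of_int (-1)" by simp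
      then show False by (simp only: of_int_eq_iff) presburger
    qed
    ultimately show ?thesis
      using pm1_cases[OF assms(1), of j] pm1_cases[OF assms(2), of j] by auto
  qed
  then show ?thesis by (auto simp: supp_def)
qed

lemma pm1_integral_multiple:
  assumes "TE E p" "i \<in> E" "int_vec (a *\<^sub>R p i)" shows "a \<in> \<int>"
proof -
  obtain j where j: "p i $ j \<noteq> 0" by (rule TE_nth_nonzero[OF assms(1,2)])
  have "a * p i $ j \<in> \<int>" using assms(3) by (simp add: int_vec_def)
  then show ?thesis by (rule pm1_scale_Ints[OF TE_pm1[OF assms(1,2)] j])
qed

text \<open>Nontrivial classes are split off by \<open>class_integral\<close>. Once all classes are
  trivial, contracting \<open>c\<close> either leaves \<open>i\<close> alone, and induction applies,
  or merges it with exactly one \<open>k\<close>; then the sum and difference of their coefficients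
  are integers, and adding them gives the factor 2.\<close>

lemma singleton_class_half:
  assumes "TE E p" "i \<in> E" "\<And>k. k \<in> E \<Longrightarrow> supp (p k) = supp (p i) \<Longrightarrow> k = i" "int_vec (lc E x p)"
  shows "2 * x i \<in> \<int>"
  using assms
proof (induction "card E" arbitrary: E p x rule: less_induct)
  case less
  note te = less.prems(1) and i = less.prems(2) and single = less.prems(3) and int = less.prems(4)
  have finE: "finite E" by (rule TE_finite[OF te])
  show ?case
  proof (cases "\<exists>a\<in>E. \<exists>b\<in>E. b \<noteq> a \<and> supp (p b) = supp (p a)")
    case True
    then obtain a b where ab: "a \<in> E" "b \<in> E" "b \<noteq> a" "supp (p b) = supp (p a)" by blast
    let ?I = "{k \<in> E. supp (p k) = supp (p a)}"
    have iI: "i \<notin> ?I"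
    proof
      assume "i \<in> ?I"
      then have e: "supp (p i) = supp (p a)" by simp
      have "a = i" by (rule single[OF ab(1) e[symmetric]])
      moreover have "b = i" by (rule single[OF ab(2)]) (simp only: ab(4) e)
      ultimately show False using ab(3) by simp
    qed
    have "int_vec (lc ?I x p)" by (rule class_integral[OF te ab int])
    from int_vec_diff[OF int this] have "int_vec (lc (E - ?I) x p)"
      using lc_split[OF finE, of ?I x p] by simp
    moreover have "card (E - ?I) < card E"
      using finE ab(1) by (intro psubset_card_mono) auto
    moreover have "TE (E - ?I) p" by (rule TE_subset[OF te]) auto
    ultimately show ?thesis using less.hyps[of "E - ?I" p x] i iI single by blast
  next
    case simple: False
    show ?thesis
    proof (cases "E = {i}")
      case True
      then have "x i \<in> \<int>" using int pm1_integral_multiple[OF te i] by (simp add: lc_def)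
      then show ?thesis by simp
    next
      case False
      then obtain c where hc: "c \<in> E" "c \<noteq> i" using i by blast
      obtain j0 where j0: "p c $ j0 \<noteq> 0" by (rule TE_nth_nonzero[OF te hc(1)])
      interpret contraction E p c j0 by unfold_locales (fact te hc(1) j0)+
      have ne: "supp (p k) \<noteq> supp (p c)" if "k \<in> E - {c}" for k using simple that hc by auto
      have s1: "pivot_scale p c k = 1" if "k \<in> E - {c}" for k using ne[OF that] by (simp add: pivot_scale_def)
      have int': "int_vec (lc (E - {c}) (\<lambda>i. pivot_scale p c i * x i) q)" by (rule int_down[OF int])
      have ic: "i \<in> E - {c}" using i hc by simp
      show ?thesis
      proof (cases "\<exists>k \<in> E - {c}. supp (q k) = supp (q i) \<and> k \<noteq> i")
        case True
        then obtain k where k: "k \<in> E - {c}" "supp (q k) = supp (q i)" "k \<noteq> i" by blast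
        have cls: "{l \<in> E - {c}. supp (q l) = supp (q i)} = {i, k}"
        proof -
          have alt: "supp (p l) = supp (p i) \<or> supp (p l) = sym_diff (supp (p i)) (supp (p c))"
            if "l \<in> E - {c}" "supp (q l) = supp (q i)" for l
            by (rule supp_q_eq[OF i ne[OF ic]]) (use that ne in auto)
          have inj: "a = b" if "a \<in> E" "b \<in> E" "supp (p a) = supp (p b)" for a b
            using simple that by metis
          have "supp (p k) \<noteq> supp (p i)" using inj[of k i] i k by auto
          then have pk: "supp (p k) = sym_diff (supp (p i)) (supp (p c))" using alt[OF k(1,2)] by simp
          have "l = i \<or> l = k" if l: "l \<in> E - {c}" "supp (q l) = supp (q i)" for l
            using alt[OF l]
          proof
            assume "supp (p l) = supp (p i)"
            then show ?thesis using inj[of l i] l i by simp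
          next
            assume "supp (p l) = sym_diff (supp (p i)) (supp (p c))"
            then have "supp (p l) = supp (p k)" by (simp only: pk)
            then show ?thesis using inj[of l k] l k by simp
          qed
          then show ?thesis using k ic by auto
        qed
        have "int_vec (lc {l \<in> E - {c}. supp (q l) = supp (q i)} (\<lambda>i. pivot_scale p c i * x i) q)"
          by (rule class_integral[OF te_q ic k(1,3,2) int'])
        then have "int_vec (x i *\<^sub>R q i + x k *\<^sub>R q k)"
          unfolding cls using k s1[OF ic] s1[OF k(1)] by (simp add: lc_def)
        from same_supp_pair[OF te_q ic k(1) k(3)[symmetric] k(2)[symmetric] this]
        have "(x i + x k) + (x i - x k) \<in> \<int>" by (rule Ints_add)
        then show ?thesis by simp
      next
        case False
        have "2 * (pivot_scale p c i * x i) \<in> \<int>"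
        proof (rule less.hyps[of "E - {c}" q "\<lambda>i. pivot_scale p c i * x i"])
          show "card (E - {c}) < card E" using finE hc(1) by (rule card_Diff1_less)
          show "k = i" if "k \<in> E - {c}" "supp (q k) = supp (q i)" for k using False that by blast
        qed (fact te_q ic int')+
        then show ?thesis using s1[OF ic] by simp
      qed
    qed
  qed
qed

text \<open>After contraction the support of a member records where it differs from a signed
  \<open>p c\<close>. That set determines the member up to sign, so a second one with the same set
  would be dependent on it.\<close>

lemma class_quotient_simple:
  assumes te: "TE E p" and c: "c \<in> E" "p c $ j0 \<noteq> 0" and all: "\<And>i. i \<in> E \<Longrightarrow> supp (p i) = supp (p c)"
    and ik: "i \<in> E - {c}" "k \<in> E - {c}" "supp (contr p c j0 k) = supp (contr p c j0 i)"
  shows "k = i"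
proof (rule ccontr)
  assume ne: "k \<noteq> i"
  interpret contraction E p c j0 by unfold_locales (fact te c)+
  have iE: "i \<in> E" and kE: "k \<in> E" using ik by auto
  obtain s where s: "s = 1 \<or> s = (-1::real)" "\<And>j. q i $ j = (if p i $ j = s * p c $ j then 0 else p i $ j)"
    using q_same[OF iE all[OF iE]] by metis
  obtain u where u: "u = 1 \<or> u = (-1::real)" "\<And>j. q k $ j = (if p k $ j = u * p c $ j then 0 else p k $ j)"
    using q_same[OF kE all[OF kE]] by metis
  have "p k $ j = (s * u) * p i $ j" for j
  proof -
    have "p i $ j \<noteq> 0 \<longleftrightarrow> p c $ j \<noteq> 0" "p k $ j \<noteq> 0 \<longleftrightarrow> p c $ j \<noteq> 0"
      using all[OF iE] all[OF kE] by (auto simp: supp_def)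
    moreover have "q i $ j \<noteq> 0 \<longleftrightarrow> q k $ j \<noteq> 0" using ik(3) by (auto simp: supp_def)
    moreover have "p i $ j \<in> {-1,0,1}" "p k $ j \<in> {-1,0,1}" "p c $ j \<in> {-1,0,1}"
      using pmE[OF iE] pmE[OF kE] pmc by (simp_all only: pm1_vec_def)
    moreover have "s \<in> {1,-1}" "u \<in> {1,-1}" using s(1) u(1) by auto
    ultimately show ?thesis
      unfolding s(2)[of j] u(2)[of j] by (elim insertE emptyE) simp_all
  qed
  then have "p k = (s * u) *\<^sub>R p i" by (simp add: vec_eq_iff)
  then show False using TE_not_pm[OF te kE iE ne] s(1) u(1) by auto
qed

text \<open>One factor 2 comes from \<open>singleton_class_half\<close> after contracting a member,
  the other from \<open>pivot_scale\<close> undoing the halving.\<close>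

lemma class_quarter:
  assumes te: "TE E p" and all: "\<And>i k. i \<in> E \<Longrightarrow> k \<in> E \<Longrightarrow> supp (p i) = supp (p k)"
    and int: "int_vec (lc E x p)" and i: "i \<in> E"
  shows "4 * x i \<in> \<int>"
proof (cases "E = {i}")
  case True
  then have "x i \<in> \<int>" using int pm1_integral_multiple[OF te i] by (simp add: lc_def)
  then show ?thesis by simp
next
  case False
  then obtain c where hc: "c \<in> E" "c \<noteq> i" using i by blast
  obtain j0 where j0: "p c $ j0 \<noteq> 0" by (rule TE_nth_nonzero[OF te hc(1)])
  interpret contraction E p c j0 by unfold_locales (fact te hc(1) j0)+
  have "2 * (pivot_scale p c i * x i) \<in> \<int>"
  proof (rule singleton_class_half[OF te_q])
    show "i \<in> E - {c}" using i hc by simp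
    show "int_vec (lc (E - {c}) (\<lambda>i. pivot_scale p c i * x i) q)" by (rule int_down[OF int])
    show "k = i" if "k \<in> E - {c}" "supp (q k) = supp (q i)" for k
      by (rule class_quotient_simple[OF te hc(1) j0 all[OF _ hc(1)]]) (use that i hc in auto)
  qed
  then show ?thesis using all[OF i hc(1)] by (simp add: pivot_scale_def)
qed

text \<open>The nontrivial coset of (1/2)Z in (1/4)Z, so on (1/4)Z this is a parity and additive
  modulo 2.\<close>

definition qodd :: "real \<Rightarrow> bool" where
  "qodd y \<longleftrightarrow> (\<exists>n::int. odd n \<and> 4 * y = of_int n)"

lemma qodd_iff: "4 * y = of_int n \<Longrightarrow> qodd y \<longleftrightarrow> odd n"
  by (auto simp: qodd_def)

lemma qodd_add: "4 * y \<in> \<int> \<Longrightarrow> 4 * z \<in> \<int> \<Longrightarrow> qodd (y + z) \<longleftrightarrow> qodd y \<noteq> qodd z"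
  by (elim Ints_cases) (simp add: qodd_iff[of _ "_ + _"] qodd_iff algebra_simps)

lemma qodd_minus: "qodd (- y) \<longleftrightarrow> qodd y"
proof -
  have "qodd (- z)" if "qodd z" for z
    using that unfolding qodd_def by (metis even_minus mult_minus_right of_int_minus)
  from this[of y] this[of "- y"] show ?thesis by auto
qed

lemma qodd_diff: "4 * y \<in> \<int> \<Longrightarrow> 4 * z \<in> \<int> \<Longrightarrow> qodd (y - z) \<longleftrightarrow> qodd y \<noteq> qodd z"
  using qodd_add[of y "- z"] by (simp add: qodd_minus)

lemma not_qodd: "4 * y \<in> \<int> \<Longrightarrow> \<not> qodd y \<longleftrightarrow> 2 * y \<in> \<int>"
proof (elim Ints_cases)
  fix n :: int assume n: "4 * y = of_int n"
  have "2 * y \<in> \<int> \<longleftrightarrow> even n"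
  proof
    assume "2 * y \<in> \<int>"
    then obtain m where "2 * y = of_int m" by (elim Ints_cases)
    then have "(of_int n :: real) = of_int (2 * m)" using n by simp
    then show "even n" by (simp only: of_int_eq_iff) simp
  next
    assume "even n"
    then obtain m where "n = 2 * m" by (elim evenE)
    then have "2 * y = of_int m" using n by simp
    then show "2 * y \<in> \<int>" by simp
  qed
  then show ?thesis by (simp add: qodd_iff[OF n])
qed

text \<open>In a column of the common support all entries are odd. Four times an integer combination
  in that column is even, and its parity counts the quarter-odd coefficients.\<close>

lemma class_even:
  assumes te: "TE E p" and all: "\<And>i k. i \<in> E \<Longrightarrow> k \<in> E \<Longrightarrow> supp (p i) = supp (p k)"
    and int: "int_vec (lc E x p)"
  shows "even (card {i \<in> E. qodd (x i)})"
proof (cases "E = {}")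
  case False
  then obtain c where c: "c \<in> E" by blast
  obtain j where j: "p c $ j \<noteq> 0" by (rule TE_nth_nonzero[OF te c(1)])
  have "\<exists>n. 4 * x i = of_int n" if "i \<in> E" for i
    using class_quarter[OF te all int that] by (auto elim: Ints_cases)
  then obtain n where n: "\<And>i. i \<in> E \<Longrightarrow> 4 * x i = of_int (n i)" by metis
  have "\<exists>e. odd e \<and> p i $ j = of_int e" if "i \<in> E" for i
  proof -
    have "p i $ j \<noteq> 0" using all[OF that c] j by (auto simp: supp_def)
    then have "p i $ j = of_int 1 \<or> p i $ j = of_int (-1)" using pm1_cases[OF TE_pm1[OF te that], of j] by auto
    then show ?thesis by (metis odd_one even_minus)
  qed
  then obtain e where e: "\<And>i. i \<in> E \<Longrightarrow> odd (e i)" "\<And>i. i \<in> E \<Longrightarrow> p i $ j = of_int (e i)" by metis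
  obtain m where m: "lc E x p $ j = of_int m" using int by (auto simp: int_vec_def elim: Ints_cases)
  have "4 * lc E x p $ j = (\<Sum>i\<in>E. (4 * x i) * p i $ j)" by (simp add: lc_nth sum_distrib_left mult.assoc)
  also have "\<dots> = of_int (\<Sum>i\<in>E. n i * e i)" using n e(2) by simp
  finally have "(of_int (4 * m) :: real) = of_int (\<Sum>i\<in>E. n i * e i)" using m by simp
  then have "even (\<Sum>i\<in>E. n i * e i)" by (simp only: of_int_eq_iff) (metis dvd_triv_left even_mult_iff even_numeral)
  then have "even (card {i \<in> E. odd (n i * e i)})" using TE_finite[OF te] by (simp add: even_sum_iff)
  moreover have "{i \<in> E. odd (n i * e i)} = {i \<in> E. qodd (x i)}" using e(1) qodd_iff[OF n] by auto
  ultimately show ?thesis by simp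
qed simp

section \<open>Half-integral combinations\<close>

text \<open>These sets form a binary linear code: the half-integral lattice points modulo integral
  combinations of the family.\<close>

definition word :: "'i set \<Rightarrow> ('i \<Rightarrow> real^'n) \<Rightarrow> 'i set \<Rightarrow> bool" where
  "word E p W \<longleftrightarrow> W \<subseteq> E \<and> int_vec (lc W (\<lambda>_. 1/2) p)"

lemma int_vec_lc: "(\<And>i. i \<in> S \<Longrightarrow> x i \<in> \<int>) \<Longrightarrow> (\<And>i. i \<in> S \<Longrightarrow> pm1_vec (p i)) \<Longrightarrow> int_vec (lc S x p)"
  unfolding lc_def by (intro int_vec_sum int_vec_scaleR) (auto intro: pm1_int_vec)

lemma half_integral_not_int:
  assumes "2 * y \<in> \<int>" "y \<notin> \<int>" shows "y - 1/2 \<in> (\<int>::real set)"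
proof -
  obtain n where n: "2 * y = of_int n" using assms(1) by (elim Ints_cases)
  have "odd n"
  proof
    assume "even n"
    then obtain m where "n = 2 * m" by (elim evenE)
    then have "y = of_int m" using n by simp
    then show False using assms(2) by simp
  qed
  then obtain m where "n = 2 * m + 1" by (elim oddE)
  then have "y - 1/2 = of_int m" using n by simp
  then show ?thesis by simp
qed

lemma half_not_int [simp]: "(1/2 :: real) \<notin> \<int>"
proof
  assume "(1/2 :: real) \<in> \<int>"
  then obtain n where "(1/2::real) = of_int n" by (elim Ints_cases)
  then have "(of_int 1 :: real) = of_int (2 * n)" by simp
  then show False by (simp only: of_int_eq_iff) presburger
qed

lemma word_of_half_integral:
  assumes te: "TE E p" and int: "int_vec (lc E x p)" and half: "\<And>i. i \<in> E \<Longrightarrow> 2 * x i \<in> \<int>"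
  shows "word E p {i \<in> E. x i \<notin> \<int>}"
proof -
  let ?W = "{i \<in> E. x i \<notin> \<int>}"
  have fE: "finite E" by (rule TE_finite[OF te])
  have "lc ?W (\<lambda>_. 1/2) p = lc E (\<lambda>i. if i \<in> ?W then 1/2 else 0) p"
    by (rule lc_mono_zero[OF fE]) auto
  moreover have "int_vec (lc E (\<lambda>i. x i - (if i \<in> ?W then 1/2 else 0)) p)"
    by (rule int_vec_lc) (use half half_integral_not_int TE_pm1[OF te] in auto)
  ultimately have "int_vec (lc E x p - lc ?W (\<lambda>_. 1/2) p)" by (simp add: lc_diff)
  from int_vec_diff[OF int this] show ?thesis by (simp add: word_def)
qed

lemma word_full:
  assumes "TE E p" "word E p W" shows "int_vec (lc E (\<lambda>i. if i \<in> W then 1/2 else 0) p)"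
  using assms lc_mono_zero[OF TE_finite[OF assms(1)], of W "\<lambda>_. 1/2" p] by (simp add: word_def)

lemma word_singleton: "TE E p \<Longrightarrow> \<not> word E p {a}"
  using pm1_integral_multiple[of E p a "1/2"] by (auto simp: word_def lc_def)

lemma word_pair:
  assumes te: "TE E p" and ab: "a \<in> E" "b \<in> E" "a \<noteq> b"
  shows "word E p {a, b} \<longleftrightarrow> supp (p a) = supp (p b)"
  using same_supp_half_sum[OF TE_pm1[OF te ab(1)] TE_pm1[OF te ab(2)]]
    half_sum_same_supp[OF TE_pm1[OF te ab(1)] TE_pm1[OF te ab(2)]] ab
  by (auto simp: word_def lc_def)

text \<open>A minimal nonempty code word, that is, a circuit of the binary matroid whose cycles are
  the words.\<close>

definition lace :: "'i set \<Rightarrow> ('i \<Rightarrow> real^'n) \<Rightarrow> 'i set \<Rightarrow> bool" where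
  "lace E p L \<longleftrightarrow> word E p L \<and> L \<noteq> {} \<and> (\<forall>V. word E p V \<longrightarrow> V \<noteq> {} \<longrightarrow> V \<subseteq> L \<longrightarrow> V = L)"

lemma laceD: "lace E p L \<Longrightarrow> word E p V \<Longrightarrow> V \<noteq> {} \<Longrightarrow> V \<subseteq> L \<Longrightarrow> V = L"
  by (auto simp: lace_def)

context contraction
begin

text \<open>Without rescaling, contraction punctures the code at \<open>c\<close>.\<close>

lemma word_down:
  assumes s1: "\<And>k. k \<in> E - {c} \<Longrightarrow> pivot_scale p c k = 1" and W: "word E p W"
  shows "word (E - {c}) q (W - {c})"
proof -
  have "int_vec (lc (E - {c}) (\<lambda>i. pivot_scale p c i * (if i \<in> W then 1/2 else 0)) q)"
    by (rule int_down[OF word_full[OF te W]])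
  also have "lc (E - {c}) (\<lambda>i. pivot_scale p c i * (if i \<in> W then 1/2 else 0)) q
      = lc (E - {c}) (\<lambda>i. if i \<in> W - {c} then 1/2 else 0) q"
    by (rule lc_cong) (auto simp: s1)
  also have "\<dots> = lc (W - {c}) (\<lambda>_. 1/2) q"
    by (rule lc_mono_zero[symmetric]) (use W finE in \<open>auto simp: word_def\<close>)
  finally show ?thesis using W by (auto simp: word_def)
qed

text \<open>Since the class of \<open>c\<close> is trivial, the lifted coordinate of
  \<open>c\<close> is half-integral, and whether it is an integer decides if \<open>c\<close> joins
  the word.\<close>

lemma word_up:
  assumes s: "\<And>k. k \<in> E \<Longrightarrow> supp (p k) = supp (p c) \<Longrightarrow> k = c" and V: "word (E - {c}) q V"
  shows "word E p V \<or> word E p (insert c V)"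
proof -
  obtain t where t: "int_vec (lc E (\<lambda>i. if i = c then t else (if i \<in> V then 1/2 else 0) / pivot_scale p c i) p)"
    by (rule int_up[OF word_full[OF te_q V]])
  define y where "y = (\<lambda>i. if i = c then t else (if i \<in> V then 1/2 else 0) / pivot_scale p c i)"
  have y: "int_vec (lc E y p)" using t by (simp add: y_def)
  have V': "V \<subseteq> E" "c \<notin> V" using V by (auto simp: word_def)
  have yi: "y i = (if i \<in> V then 1/2 else 0)" if "i \<in> E" "i \<noteq> c" for i
    using s that by (auto simp: y_def pivot_scale_def)
  have yc: "2 * y c \<in> \<int>" by (rule singleton_class_half[OF te c s y]) simp_all
  have half: "2 * y i \<in> \<int>" if "i \<in> E" for i using yi[OF that] yc by (cases "i = c") auto
  have w: "word E p {i \<in> E. y i \<notin> \<int>}" by (rule word_of_half_integral[OF te y half])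
  have iff: "y i \<notin> \<int> \<longleftrightarrow> i \<in> V" if "i \<in> E" "i \<noteq> c" for i using yi[OF that] by simp
  show ?thesis
  proof (cases "y c \<in> \<int>")
    case True
    then have "{i \<in> E. y i \<notin> \<int>} = V" using V' iff by blast
    then show ?thesis using w by simp
  next
    case False
    then have "{i \<in> E. y i \<notin> \<int>} = insert c V" using V' iff c by blast
    then show ?thesis using w by simp
  qed
qed

end

text \<open>By \<open>class_integral\<close>, cutting a word down to a nontrivial class leaves a
  word, so a lace meeting such a class lies inside it. There any two elements already form a word,
  which contradicts the size of the lace.\<close>

lemma lace_singleton_class:
  assumes te: "TE E p" and L: "lace E p L" "card L \<ge> 3" and t: "t \<in> L" "k \<in> E" "supp (p k) = supp (p t)"
  shows "k = t"
proof (rule ccontr)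
  assume ne: "k \<noteq> t"
  have LE: "L \<subseteq> E" and tE: "t \<in> E" using L t by (auto simp: lace_def word_def)
  let ?I = "{l \<in> E. supp (p l) = supp (p t)}"
  have "int_vec (lc ?I (\<lambda>i. if i \<in> L then 1/2 else 0) p)"
    by (rule class_integral[OF te tE t(2) ne t(3)]) (use L word_full[OF te] in \<open>simp add: lace_def\<close>)
  also have "lc ?I (\<lambda>i. if i \<in> L then 1/2 else 0) p = lc (?I \<inter> L) (\<lambda>_. 1/2) p"
    using TE_finite[OF te] by (subst lc_mono_zero[of ?I "?I \<inter> L"]) (auto intro!: lc_cong)
  finally have "word E p (?I \<inter> L)" by (auto simp: word_def)
  then have "?I \<inter> L = L" by (rule laceD[OF L(1)]) (use t tE in auto)
  moreover obtain e where e: "e \<in> L" "e \<noteq> t"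
  proof -
    have "\<not> L \<subseteq> {t}" using L(2) card_mono[of "{t}" L] by auto
    then show thesis using that by auto
  qed
  ultimately have "supp (p t) = supp (p e)" "e \<in> E" by auto
  then have "word E p {t, e}" using word_pair[OF te tE _ e(2)[symmetric]] by blast
  then have "{t, e} = L" by (rule laceD[OF L(1)]) (use t e in auto)
  then show False using L(2) card_insert_le_m1[of 2 "{e}" t] by (auto simp: card_insert_if split: if_splits)
qed

text \<open>Contracting elements of a lace one by one leaves a lace of three vectors, and contracting
  one of these makes the other two a complete support class.\<close>

lemma lace_word_dichotomy:
  assumes "TE E p" "lace E p L" "card L \<ge> 3" "word E p W"
  shows "L \<inter> W = {} \<or> L \<subseteq> W"
  using assms
proof (induction "card L" arbitrary: E p L W rule: less_induct)
  case less
  note te = less.prems(1) and L = less.prems(2,3) and W = less.prems(4)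
  have LE: "L \<subseteq> E" and wL: "word E p L" using L by (auto simp: lace_def word_def)
  have finL: "finite L" using L(2) card.infinite by fastforce
  note single = lace_singleton_class[OF te L]
  show ?case
  proof (rule ccontr)
    assume "\<not> ?case"
    then obtain a b where ab: "a \<in> L" "a \<in> W" "b \<in> L" "b \<notin> W" by blast
    have "a \<noteq> b" using ab by auto
    have "\<not> L \<subseteq> {a, b}"
      using L(2) card_mono[of "{a,b}" L] by (auto simp: card_insert_if split: if_splits)
    \<comment> \<open>Contracting a third element keeps both witnesses \<open>a\<close> and
      \<open>b\<close> of the violation.\<close>
    then obtain t where t: "t \<in> L" "t \<noteq> a" "t \<noteq> b" by blast
    have tE: "t \<in> E" using t LE by auto
    obtain j0 where j0: "p t $ j0 \<noteq> 0" by (rule TE_nth_nonzero[OF te tE])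
    interpret contraction E p t j0 by unfold_locales (fact te tE j0)+
    have s1: "pivot_scale p t k = 1" if "k \<in> E - {t}" for k using single[OF t(1)] that by (auto simp: pivot_scale_def)
    have wLt: "word (E - {t}) q (L - {t})" and wWt: "word (E - {t}) q (W - {t})"
      using word_down s1 wL W by blast+
    have aE: "a \<in> E - {t}" and bE: "b \<in> E - {t}" using ab t LE by auto
    show False
    proof (cases "card L = 3")
      case True
      have "L = {t, a, b}"
      proof (rule card_seteq[symmetric])
        show "card L \<le> card {t, a, b}" using True t \<open>a \<noteq> b\<close> by simp
      qed (use finL ab t in auto)
      then have "L - {t} = {a, b}" using t by auto
      then have sab: "supp (q a) = supp (q b)" using wLt word_pair[OF te_q aE bE] ab by auto
      have alt: "supp (p k) = supp (p a) \<or> supp (p k) = sym_diff (supp (p a)) (supp (p t))"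
        if "k \<in> E - {t}" "supp (q k) = supp (q a)" for k
        by (rule supp_q_eq) (use that aE s1[OF that(1)] s1[OF aE] in \<open>auto simp: pivot_scale_def split: if_splits\<close>)
      have cls: "{k \<in> E - {t}. supp (q k) = supp (q a)} = {a, b}"
      proof -
        have "supp (p b) \<noteq> supp (p a)" using single[OF ab(1), of b] bE ab by auto
        then have pb: "supp (p b) = sym_diff (supp (p a)) (supp (p t))"
          using alt[OF bE sab[symmetric]] by simp
        have "k = a \<or> k = b" if k: "k \<in> E - {t}" "supp (q k) = supp (q a)" for k
          using alt[OF k]
        proof
          assume "supp (p k) = supp (p a)"
          then show ?thesis using single[OF ab(1), of k] k by auto
        next
          assume "supp (p k) = sym_diff (supp (p a)) (supp (p t))"
          then have "supp (p k) = supp (p b)" by (simp only: pb)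
          then show ?thesis using single[OF ab(3), of k] k by auto
        qed
        then show ?thesis using aE bE sab by auto
      qed
      have "int_vec (lc {k \<in> E - {t}. supp (q k) = supp (q a)} (\<lambda>i. if i \<in> W - {t} then 1/2 else 0) q)"
        by (rule class_integral[OF te_q aE bE _ sab[symmetric] word_full[OF te_q wWt]]) (use ab in auto)
      \<comment> \<open>The class is exactly \<open>{a, b}\<close>, and \<open>W\<close> contains
        \<open>a\<close> but not \<open>b\<close>, so half of \<open>q a\<close> alone would be
        integral.\<close>
      then have "int_vec ((1/2) *\<^sub>R q a)" unfolding cls using ab t \<open>a \<noteq> b\<close> by (simp add: lc_def)
      from pm1_integral_multiple[OF te_q aE this] show False by simp
    next
      case False
      have "lace (E - {t}) q (L - {t})"
        unfolding lace_def
      proof (intro conjI allI impI)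
        show "word (E - {t}) q (L - {t})" by fact
        show "L - {t} \<noteq> {}" using ab t by auto
        fix V assume V: "word (E - {t}) q V" "V \<noteq> {}" "V \<subseteq> L - {t}"
        from word_up[OF single[OF t(1)] V(1)] show "V = L - {t}"
        proof
          assume "word E p V"
          then have "V = L" by (rule laceD[OF L(1)]) (use V in auto)
          then show ?thesis using V t by auto
        next
          assume "word E p (insert t V)"
          then have "insert t V = L" by (rule laceD[OF L(1)]) (use V t in auto)
          then show ?thesis using V by auto
        qed
      qed
      moreover have "card (L - {t}) = card L - 1" using t finL by simp
      moreover have "card L - 1 < card L" "card L - 1 \<ge> 3" using L(2) False by auto
      ultimately have "(L - {t}) \<inter> (W - {t}) = {} \<or> L - {t} \<subseteq> W - {t}"
        using less.hyps[of "L - {t}" "E - {t}" q "W - {t}"] te_q wWt by auto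
      then show False using ab t by auto
    qed
  qed
qed

section \<open>Denominators four\<close>

definition qodd_sets :: "'i set \<Rightarrow> ('i \<Rightarrow> real^'n) \<Rightarrow> 'i set set" where
  "qodd_sets E p = {{i \<in> E. qodd (x i)} | x. int_vec (lc E x p)}"

text \<open>Contracting some \<open>c\<close> in \<open>K\<close> doubles all other coordinates and
  turns quarter-odd sets into words, with \<open>K - {c}\<close> a lace. The dichotomy for laces
  then decides everything away from \<open>c\<close>, and \<open>c\<close> can be chosen apart from
  any two given elements.\<close>

lemma qodd_sets_dichotomy:
  assumes te: "TE E p" and all: "\<And>i k. i \<in> E \<Longrightarrow> k \<in> E \<Longrightarrow> supp (p i) = supp (p k)"
    and K: "K \<in> qodd_sets E p" "K \<noteq> {}" "\<And>K'. K' \<in> qodd_sets E p \<Longrightarrow> K' \<noteq> {} \<Longrightarrow> K' \<subseteq> K \<Longrightarrow> K' = K"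
    and K': "K' \<in> qodd_sets E p"
  shows "K \<inter> K' = {} \<or> K \<subseteq> K'"
proof -
  have KE: "K \<subseteq> E" using K(1) by (auto simp: qodd_sets_def)
  have finK: "finite K" using KE TE_finite[OF te] finite_subset by blast
  have evenK: "even (card K)" using K(1) class_even[OF te all] by (auto simp: qodd_sets_def)
  have key: "card (K - {c}) \<ge> 3 \<and> ((K - {c}) \<inter> (K' - {c}) = {} \<or> K - {c} \<subseteq> K' - {c})" if cK: "c \<in> K" for c
  proof -
    have cE: "c \<in> E" using cK KE by auto
    obtain j0 where j0: "p c $ j0 \<noteq> 0" by (rule TE_nth_nonzero[OF te cE])
    interpret contraction E p c j0 by unfold_locales (fact te cE j0)+
    have s2: "pivot_scale p c k = 2" if "k \<in> E" for k using all[OF that cE] by (simp add: pivot_scale_def)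
    have down: "word (E - {c}) q (H - {c})" if H: "H \<in> qodd_sets E p" for H
    proof -
      obtain x where x: "int_vec (lc E x p)" "H = {i \<in> E. qodd (x i)}"
        using H by (auto simp: qodd_sets_def)
      have q4: "4 * x i \<in> \<int>" if "i \<in> E" for i by (rule class_quarter[OF te all x(1) that])
      have "word (E - {c}) q {i \<in> E - {c}. pivot_scale p c i * x i \<notin> \<int>}"
        by (rule word_of_half_integral[OF te_q int_down[OF x(1)]]) (use s2 q4 in auto)
      moreover have "{i \<in> E - {c}. pivot_scale p c i * x i \<notin> \<int>} = H - {c}"
      proof -
        have "pivot_scale p c i * x i \<notin> \<int> \<longleftrightarrow> qodd (x i)" if "i \<in> E" for i
          using s2[OF that] not_qodd[OF q4[OF that]] by auto
        then show ?thesis by (auto simp: x(2))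
      qed
      ultimately show ?thesis by simp
    qed
    have up: "\<exists>H \<in> qodd_sets E p. H - {c} = V" if V: "word (E - {c}) q V" for V
    proof -
      obtain t where t: "int_vec (lc E (\<lambda>i. if i = c then t else (if i \<in> V then 1/2 else 0) / pivot_scale p c i) p)"
        by (rule int_up[OF word_full[OF te_q V]])
      define y where "y = (\<lambda>i. if i = c then t else (if i \<in> V then 1/2 else 0) / pivot_scale p c i)"
      have "qodd (y i) \<longleftrightarrow> i \<in> V" if "i \<in> E" "i \<noteq> c" for i
        using s2[OF that(1)] that(2) qodd_iff[of "1/4" 1] qodd_iff[of 0 0] by (simp add: y_def)
      then have "{i \<in> E. qodd (y i)} - {c} = V" using V by (auto simp: word_def)
      moreover have "{i \<in> E. qodd (y i)} \<in> qodd_sets E p"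
        using t unfolding y_def[symmetric] by (auto simp: qodd_sets_def)
      ultimately show ?thesis by blast
    qed
    \<comment> \<open>No singleton is a word, so the odd number of remaining elements is at least
      three, as \<open>lace_word_dichotomy\<close> requires.\<close>
    have odd: "odd (card (K - {c}))" using evenK cK finK by (simp add: card_gt_0_iff) (metis card_gt_0_iff dvd_diffD1 even_Suc Suc_pred empty_iff)
    have "card (K - {c}) \<noteq> 1"
      using down[OF K(1)] word_singleton[OF te_q] by (metis card_1_singletonE)
    then have c3: "card (K - {c}) \<ge> 3" using odd by presburger
    have "lace (E - {c}) q (K - {c})"
      unfolding lace_def
    proof (intro conjI allI impI)
      show "word (E - {c}) q (K - {c})" by (rule down[OF K(1)])
      show "K - {c} \<noteq> {}" using c3 by (metis card.empty not_numeral_le_zero)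
      fix V assume V: "word (E - {c}) q V" "V \<noteq> {}" "V \<subseteq> K - {c}"
      obtain H where H: "H \<in> qodd_sets E p" "H - {c} = V" using up[OF V(1)] by blast
      have "H = K" by (rule K(3)[OF H(1)]) (use H V cK in auto)
      then show "V = K - {c}" using H by simp
    qed
    have "(K - {c}) \<inter> (K' - {c}) = {} \<or> K - {c} \<subseteq> K' - {c}"
      by (rule lace_word_dichotomy[OF te_q \<open>lace (E - {c}) q (K - {c})\<close> c3 down[OF K']])
    then show ?thesis using c3 by blast
  qed
  show ?thesis
  proof (rule ccontr)
    assume "\<not> ?thesis"
    then obtain a b where ab: "a \<in> K" "a \<in> K'" "b \<in> K" "b \<notin> K'" by blast
    have "\<not> K - {a} \<subseteq> {b}" using key[OF ab(1)] card_mono[of "{b}" "K - {a}"] by auto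
    then obtain c where "c \<in> K" "c \<noteq> a" "c \<noteq> b" by blast
    then show False using key[of c] ab by auto
  qed
qed

lemma TE_quarter:
  assumes te: "TE E p" and int: "int_vec (lc E x p)" and i: "i \<in> E"
  shows "4 * x i \<in> \<int>"
proof (cases "\<exists>k\<in>E. k \<noteq> i \<and> supp (p k) = supp (p i)")
  case True
  then obtain k where k: "k \<in> E" "k \<noteq> i" "supp (p k) = supp (p i)" by blast
  let ?I = "{k \<in> E. supp (p k) = supp (p i)}"
  show ?thesis
  proof (rule class_quarter[of ?I p])
    show "TE ?I p" by (rule TE_subset[OF te]) auto
    show "int_vec (lc ?I x p)" by (rule class_integral[OF te i k int])
  qed (use i in auto)
next
  case False
  have "2 * x i \<in> \<int>" by (rule singleton_class_half[OF te i _ int]) (use False in blast)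
  from Ints_mult[OF Ints_numeral[of "num.Bit0 num.One"] this] show ?thesis by simp
qed

lemma even_card_matching:
  assumes "finite X" "even (card X)"
  shows "\<exists>M. (\<forall>m\<in>M. \<exists>a b. a \<noteq> b \<and> m = {a, b}) \<and> (\<forall>m\<in>M. \<forall>m'\<in>M. m \<noteq> m' \<longrightarrow> m \<inter> m' = {}) \<and> \<Union>M = X"
  using assms
proof (induction "card X" arbitrary: X rule: less_induct)
  case less
  show ?case
  proof (cases "X = {}")
    case True then show ?thesis by (intro exI[of _ "{}"]) auto
  next
    case False
    then obtain a where a: "a \<in> X" by blast
    have "X \<noteq> {a}" using less.prems(2) by auto
    then obtain b where b: "b \<in> X" "b \<noteq> a" using a by blast
    let ?Y = "X - {a, b}"
    have cY: "card X = card ?Y + 2"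
      using a b less.prems(1) by (simp add: card_Diff_subset) (metis Suc_diff_Suc Suc_1 card_gt_0_iff card_le_Suc0_iff_eq diff_Suc_1 diff_Suc_eq_diff_pred empty_iff le_less_linear less_Suc_eq_le numeral_2_eq_2 Suc_pred)
    obtain M where M: "\<forall>m\<in>M. \<exists>a b. a \<noteq> b \<and> m = {a, b}" "\<forall>m\<in>M. \<forall>m'\<in>M. m \<noteq> m' \<longrightarrow> m \<inter> m' = {}" "\<Union>M = ?Y"
      using less.hyps[of ?Y] cY less.prems by auto
    have "\<forall>m\<in>M. {a, b} \<inter> m = {} \<and> m \<inter> {a, b} = {}" using M(3) by blast
    then have "\<forall>m\<in>insert {a, b} M. \<forall>m'\<in>insert {a, b} M. m \<noteq> m' \<longrightarrow> m \<inter> m' = {}" using M(2) by auto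
    moreover have "\<Union>(insert {a, b} M) = X" using M(3) a b by auto
    moreover have "\<forall>m\<in>insert {a, b} M. \<exists>a b. a \<noteq> b \<and> m = {a, b}" using M(1) b by auto
    ultimately show ?thesis by blast
  qed
qed

text \<open>The block \<open>C a\<close> consists of the indices in the class of \<open>a\<close>
  that no lattice point separates from \<open>a\<close> by quarter-parity. For \<open>a\<close> in
  \<open>U\<close> it is a minimal quarter-odd set, hence even, and any perfect matching within the
  blocks has the desired properties.\<close>

lemma TE_qodd_matching:
  assumes te: "TE E p"
  obtains M where "\<And>m. m \<in> M \<Longrightarrow> \<exists>a\<in>E. \<exists>b\<in>E. a \<noteq> b \<and> m = {a, b} \<and> supp (p a) = supp (p b)"
    "\<And>m m'. m \<in> M \<Longrightarrow> m' \<in> M \<Longrightarrow> m \<noteq> m' \<Longrightarrow> m \<inter> m' = {}"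
    "\<And>x m. int_vec (lc E x p) \<Longrightarrow> m \<in> M \<Longrightarrow> m \<subseteq> {i. qodd (x i)} \<or> m \<inter> {i. qodd (x i)} = {}"
    "\<And>x i. int_vec (lc E x p) \<Longrightarrow> i \<in> E \<Longrightarrow> qodd (x i) \<Longrightarrow> i \<in> \<Union>M"
proof -
  define G where "G = {x. int_vec (lc E x p)}"
  define C where "C a = {b \<in> E. supp (p b) = supp (p a) \<and> (\<forall>x\<in>G. qodd (x b) \<longleftrightarrow> qodd (x a))}" for a
  define U where "U = {a \<in> E. \<exists>x\<in>G. qodd (x a)}"
  have finE: "finite E" by (rule TE_finite[OF te])
  have evenC: "even (card (C a))" if a: "a \<in> U" for a
  proof -
    obtain x where x: "x \<in> G" "qodd (x a)" and aE: "a \<in> E" using a by (auto simp: U_def)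
    have int: "int_vec (lc E x p)" using x by (simp add: G_def)
    have "\<exists>k\<in>E. k \<noteq> a \<and> supp (p k) = supp (p a)"
    proof (rule ccontr)
      assume no: "\<not> ?thesis"
      have "2 * x a \<in> \<int>" by (rule singleton_class_half[OF te aE _ int]) (use no in blast)
      then show False using not_qodd[OF TE_quarter[OF te int aE]] x(2) by blast
    qed
    then obtain k where k: "k \<in> E" "k \<noteq> a" "supp (p k) = supp (p a)" by blast
    let ?I = "{k \<in> E. supp (p k) = supp (p a)}"
    have teI: "TE ?I p" by (rule TE_subset[OF te]) auto
    have allI: "\<And>i k. i \<in> ?I \<Longrightarrow> k \<in> ?I \<Longrightarrow> supp (p i) = supp (p k)" by auto
    have restr: "{i \<in> ?I. qodd (y i)} \<in> qodd_sets ?I p" if "y \<in> G" for y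
      using class_integral[OF te aE k, of y] that by (auto simp: qodd_sets_def G_def)
    let ?P = "\<lambda>K. K \<in> qodd_sets ?I p \<and> a \<in> K"
    have "?P {i \<in> ?I. qodd (x i)}" using restr[OF x(1)] x(2) aE by auto
    from ex_has_least_nat[of ?P, OF this, of card] obtain K where K: "K \<in> qodd_sets ?I p" "a \<in> K"
      and least: "\<And>K'. K' \<in> qodd_sets ?I p \<Longrightarrow> a \<in> K' \<Longrightarrow> card K \<le> card K'" by blast
    obtain y where y: "int_vec (lc ?I y p)" "K = {i \<in> ?I. qodd (y i)}" using K by (auto simp: qodd_sets_def)
    have finK: "finite K" using finE by (simp add: y(2))
    \<comment> \<open>A proper nonempty subset missing \<open>a\<close> has a complement in
      \<open>K\<close> that contains \<open>a\<close>, is again a quarter-odd set, and is smaller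
      than \<open>K\<close>.\<close>
    have min: "K' = K" if K': "K' \<in> qodd_sets ?I p" "K' \<noteq> {}" "K' \<subseteq> K" for K'
    proof (cases "a \<in> K'")
      case True
      then show ?thesis using least[OF K'(1)] K'(3) finK by (intro card_seteq) auto
    next
      case False
      obtain z where z: "int_vec (lc ?I z p)" "K' = {i \<in> ?I. qodd (z i)}" using K' by (auto simp: qodd_sets_def)
      have "int_vec (lc ?I (\<lambda>i. y i - z i) p)" using y(1) z(1) by (simp add: lc_diff int_vec_diff)
      then have "{i \<in> ?I. qodd (y i - z i)} \<in> qodd_sets ?I p" by (auto simp: qodd_sets_def)
      moreover have "{i \<in> ?I. qodd (y i - z i)} = K - K'"
      proof -
        have "qodd (y i - z i) \<longleftrightarrow> (i \<in> K) \<noteq> (i \<in> K')" if "i \<in> ?I" for i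
          using qodd_diff[OF class_quarter[OF teI allI y(1) that] class_quarter[OF teI allI z(1) that]] that
          by (simp add: y(2) z(2))
        then show ?thesis using K'(3) y(2) by blast
      qed
      ultimately have "card K \<le> card (K - K')" using least[of "K - K'"] K(2) False by auto
      moreover have "card (K - K') < card K" using K'(2,3) finK by (intro psubset_card_mono) auto
      ultimately show ?thesis by simp
    qed
    have dich: "K \<inter> K' = {} \<or> K \<subseteq> K'" if "K' \<in> qodd_sets ?I p" for K'
      by (rule qodd_sets_dichotomy[OF teI allI K(1) _ min that]) (use K in auto)
    have "C a = K"
    proof (intro Set.set_eqI iffI)
      fix b assume b: "b \<in> K"
      have "qodd (z b) \<longleftrightarrow> qodd (z a)" if "z \<in> G" for z
        using dich[OF restr[OF that]] b K(2) by (auto simp: y(2))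
      then show "b \<in> C a" using b by (auto simp: C_def y(2))
    next
      fix b assume b: "b \<in> C a"
      have bI: "b \<in> ?I" using b by (auto simp: C_def)
      \<comment> \<open>Extension by zero makes the lattice point of the class one of the whole
        family, which then separates \<open>K\<close> from the rest.\<close>
      have "(\<lambda>i. if i \<in> ?I then y i else 0) \<in> G"
        using y(1) lc_mono_zero[OF finE, of ?I y p] by (auto simp: G_def)
      moreover have "\<forall>x\<in>G. qodd (x b) \<longleftrightarrow> qodd (x a)" using b by (simp add: C_def)
      ultimately have "qodd (if b \<in> ?I then y b else 0) \<longleftrightarrow> qodd (if a \<in> ?I then y a else 0)"
        by (drule_tac bspec)
      then show "b \<in> K" using bI aE K(2) by (simp add: y(2))
    qed
    then show ?thesis using class_even[OF teI allI y(1)] y(2) by simp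
  qed
  have finC: "finite (C a)" for a using finE by (simp add: C_def)
  \<comment> \<open>The choice depends on the block only, so all indices of one block receive the
    same matching.\<close>
  define mt where "mt X = (SOME M. (\<forall>m\<in>M. \<exists>a b. a \<noteq> b \<and> m = {a, b}) \<and> (\<forall>m\<in>M. \<forall>m'\<in>M. m \<noteq> m' \<longrightarrow> m \<inter> m' = {}) \<and> \<Union>M = X)"
    for X :: "'a set"
  have mt: "(\<forall>m\<in>mt (C a). \<exists>a b. a \<noteq> b \<and> m = {a, b})
      \<and> (\<forall>m\<in>mt (C a). \<forall>m'\<in>mt (C a). m \<noteq> m' \<longrightarrow> m \<inter> m' = {}) \<and> \<Union>(mt (C a)) = C a" if "a \<in> U" for a
    unfolding mt_def by (rule someI_ex) (rule even_card_matching[OF finC evenC[OF that]])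
  have mt1: "\<exists>u v. u \<noteq> v \<and> m = {u, v}" if "a \<in> U" "m \<in> mt (C a)" for a m
    using mt[OF that(1)] that(2) by simp
  have mt2: "m \<inter> m' = {}" if "a \<in> U" "m \<in> mt (C a)" "m' \<in> mt (C a)" "m \<noteq> m'" for a m m'
    using mt[OF that(1)] that(2-) by simp
  have mt3: "\<Union>(mt (C a)) = C a" if "a \<in> U" for a
    using mt[OF that] by simp
  have Ceq: "C b = C a" if "b \<in> C a" for a b using that by (auto simp: C_def)
  define M where "M = (\<Union>a\<in>U. mt (C a))"
  show thesis
  proof (rule that[of M])
    fix m assume "m \<in> M"
    then obtain a where a: "a \<in> U" "m \<in> mt (C a)" by (auto simp: M_def)
    then obtain u v where uv: "u \<noteq> v" "m = {u, v}" using mt1[OF a] by auto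
    have "m \<subseteq> C a" using mt3[OF a(1)] a(2) by auto
    then have "u \<in> C a" "v \<in> C a" using uv by auto
    then have "u \<in> E" "v \<in> E" "supp (p u) = supp (p a)" "supp (p v) = supp (p a)"
      by (simp_all add: C_def)
    then show "\<exists>a\<in>E. \<exists>b\<in>E. a \<noteq> b \<and> m = {a, b} \<and> supp (p a) = supp (p b)"
      using uv by (intro bexI[of _ u] bexI[of _ v]) simp_all
  next
    fix m m' assume m: "m \<in> M" "m' \<in> M" "m \<noteq> m'"
    obtain a b where ab: "a \<in> U" "m \<in> mt (C a)" "b \<in> U" "m' \<in> mt (C b)" using m by (auto simp: M_def)
    show "m \<inter> m' = {}"
    proof (rule ccontr)
      assume "m \<inter> m' \<noteq> {}"
      then obtain u where "u \<in> m" "u \<in> m'" by blast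
      then have "u \<in> C a" "u \<in> C b" using mt3[OF ab(1)] mt3[OF ab(3)] ab(2,4) by auto
      then have "C a = C b" using Ceq[of u a] Ceq[of u b] by simp
      then show False using mt2[OF ab(1,2) _ m(3)] ab(4) \<open>m \<inter> m' \<noteq> {}\<close> by simp
    qed
  next
    fix x m assume x: "int_vec (lc E x p)" and "m \<in> M"
    then obtain a where a: "a \<in> U" "m \<in> mt (C a)" by (auto simp: M_def)
    have sub: "m \<subseteq> C a" using mt3[OF a(1)] a(2) by auto
    have "qodd (x b) \<longleftrightarrow> qodd (x a)" if "b \<in> m" for b
      using sub that x by (auto simp: C_def G_def)
    then show "m \<subseteq> {i. qodd (x i)} \<or> m \<inter> {i. qodd (x i)} = {}" by blast
  next
    fix x i assume x: "int_vec (lc E x p)" "i \<in> E" "qodd (x i)"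
    then have iU: "i \<in> U" by (auto simp: U_def G_def)
    have "i \<in> C i" using x by (auto simp: C_def)
    then have "i \<in> \<Union>(mt (C i))" using mt3[OF iU] by simp
    then show "i \<in> \<Union>M" using iU by (auto simp: M_def)
  qed
qed

section \<open>Regular triangulations by stellar subdivision\<close>

abbreviation coord :: "(real^'n) set \<Rightarrow> real^'n \<Rightarrow> real^'n \<Rightarrow> real" where
  "coord \<equiv> representation"

abbreviation hsum :: "(real^'n) set \<Rightarrow> real^'n" where
  "hsum F \<equiv> \<Sum>h\<in>F. (1/2) *\<^sub>R h"

section \<open>Coordinates over a basis and simplicial cones\<close>

lemma representation_lincomb:
  fixes G :: "(real^'n) set"
  assumes "finite G" "independent G"
  shows "coord G (\<Sum>g\<in>G. c g *\<^sub>R g) = (\<lambda>g. if g \<in> G then c g else 0)"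
proof -
  have "(\<Sum>g\<in>G. c g *\<^sub>R g) \<in> span G" by (intro span_sum span_scale span_base)
  moreover have "finite {b. (if b \<in> G then c b else 0) \<noteq> 0}"
    by (rule finite_subset[OF _ assms(1)]) auto
  moreover have "(\<Sum>b | (if b \<in> G then c b else 0) \<noteq> 0. (if b \<in> G then c b else 0) *\<^sub>R b) = (\<Sum>g\<in>G. c g *\<^sub>R g)"
    by (rule sum.mono_neutral_cong_left) (use assms in auto)
  ultimately show ?thesis using assms(2) by (intro representation_eqI) (auto split: if_splits)
qed

lemma sum_representation:
  fixes G :: "(real^'n) set"
  assumes "finite G" "independent G" "x \<in> span G"
  shows "(\<Sum>g\<in>G. coord G x g *\<^sub>R g) = x"
  using sum_representation_eq[OF assms(2,3,1)] by simp

lemma gen_cone_span: "gen_cone G \<subseteq> span G"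
  unfolding gen_cone_def by (auto intro: span_sum span_scale span_base)

lemma gen_cone_iff:
  assumes "finite G" "independent G"
  shows "x \<in> gen_cone G \<longleftrightarrow> x \<in> span G \<and> (\<forall>g\<in>G. coord G x g \<ge> 0)"
proof
  assume x: "x \<in> gen_cone G"
  then obtain c where "\<forall>g\<in>G. c g \<ge> 0" "x = (\<Sum>g\<in>G. c g *\<^sub>R g)" by (auto simp: gen_cone_def)
  then show "x \<in> span G \<and> (\<forall>g\<in>G. coord G x g \<ge> 0)"
    using subsetD[OF gen_cone_span x] by (simp add: representation_lincomb[OF assms])
next
  assume "x \<in> span G \<and> (\<forall>g\<in>G. coord G x g \<ge> 0)"
  then show "x \<in> gen_cone G" unfolding gen_cone_def using sum_representation[OF assms] by fastforce
qed

lemma gen_cone_add: "x \<in> gen_cone G \<Longrightarrow> y \<in> gen_cone G \<Longrightarrow> x + y \<in> gen_cone G"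
proof -
  assume "x \<in> gen_cone G" "y \<in> gen_cone G"
  then obtain c d where c: "\<forall>g\<in>G. c g \<ge> 0" "x = (\<Sum>g\<in>G. c g *\<^sub>R g)"
    and d: "\<forall>g\<in>G. d g \<ge> 0" "y = (\<Sum>g\<in>G. d g *\<^sub>R g)" by (auto simp: gen_cone_def)
  have "x + y = (\<Sum>g\<in>G. (c g + d g) *\<^sub>R g)" using c d by (simp add: scaleR_left_distrib sum.distrib)
  then show "x + y \<in> gen_cone G" unfolding gen_cone_def using c d by (auto intro!: exI[of _ "\<lambda>g. c g + d g"])
qed

lemma gen_cone_scale: "x \<in> gen_cone G \<Longrightarrow> a \<ge> 0 \<Longrightarrow> a *\<^sub>R x \<in> gen_cone G"
proof -
  assume "x \<in> gen_cone G" "a \<ge> 0"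
  then obtain c where c: "\<forall>g\<in>G. c g \<ge> 0" "x = (\<Sum>g\<in>G. c g *\<^sub>R g)" by (auto simp: gen_cone_def)
  have "a *\<^sub>R x = (\<Sum>g\<in>G. (a * c g) *\<^sub>R g)" using c by (simp add: scaleR_sum_right)
  then show "a *\<^sub>R x \<in> gen_cone G" unfolding gen_cone_def using c \<open>a \<ge> 0\<close> by (auto intro!: exI[of _ "\<lambda>g. a * c g"])
qed

lemma gen_cone_0: "0 \<in> gen_cone G"
  unfolding gen_cone_def by (auto intro!: exI[of _ "\<lambda>_. 0"])

lemma gen_cone_base: "finite G \<Longrightarrow> g \<in> G \<Longrightarrow> g \<in> gen_cone G"
proof -
  assume "finite G" "g \<in> G"
  then have "g = (\<Sum>h\<in>G. (if h = g then 1 else 0) *\<^sub>R h)" by (simp add: if_distrib[of "\<lambda>c. c *\<^sub>R _"] cong: if_cong)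
  then show "g \<in> gen_cone G" unfolding gen_cone_def by (auto intro!: exI[of _ "\<lambda>h. if h = g then 1 else 0"])
qed

lemma gen_cone_sum: "(\<And>i. i \<in> I \<Longrightarrow> f i \<in> gen_cone G) \<Longrightarrow> sum f I \<in> gen_cone G"
  by (induction I rule: infinite_finite_induct) (auto intro: gen_cone_0 gen_cone_add)

lemma gen_cone_subset: "G \<subseteq> gen_cone H \<Longrightarrow> gen_cone G \<subseteq> gen_cone H"
proof
  fix x assume G: "G \<subseteq> gen_cone H" and "x \<in> gen_cone G"
  then obtain c where c: "\<forall>g\<in>G. c g \<ge> 0" "x = (\<Sum>g\<in>G. c g *\<^sub>R g)" by (auto simp: gen_cone_def)
  show "x \<in> gen_cone H" unfolding c(2) by (intro gen_cone_sum gen_cone_scale) (use c G in auto)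
qed

lemma convex_gen_cone: "convex (gen_cone G)"
  unfolding convex_def by (auto intro: gen_cone_add gen_cone_scale)

text \<open>The height function \<open>w\<close> on the generators induces the triangulation as a lower hull: the linear
  function interpolating \<open>w\<close> on a cell stays strictly below \<open>w\<close> on all other generators.\<close>

definition lower_hull_cells :: "(real^'n) set set \<Rightarrow> (real^'n \<Rightarrow> real) \<Rightarrow> (real^'n) set \<Rightarrow> (real^'n \<Rightarrow> real) \<Rightarrow> bool" where
  "lower_hull_cells T w G l \<longleftrightarrow> linear l \<and> (\<forall>g\<in>G. l g = w g) \<and> (\<forall>h\<in>\<Union>T. h \<notin> G \<longrightarrow> l h < w h)"

text \<open>Covering and one common height function suffice: intersection in faces and regularity
  both follow from the strict inequalities of the lower hull.\<close>

definition triang :: "(real^'n) set \<Rightarrow> (real^'n) set set \<Rightarrow> bool" where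
  "triang A T \<longleftrightarrow> finite T \<and>
     (\<forall>G\<in>T. finite G \<and> independent G \<and> span G = span A \<and> G \<subseteq> gen_cone A) \<and>
     (\<forall>x\<in>gen_cone A. \<exists>G\<in>T. x \<in> gen_cone G) \<and>
     (\<exists>w. \<forall>G\<in>T. \<exists>l. lower_hull_cells T w G l)"

lemma triangE:
  assumes "triang A T"
  obtains w where "finite T" "\<And>G. G \<in> T \<Longrightarrow> finite G \<and> independent G \<and> span G = span A \<and> G \<subseteq> gen_cone A"
    "\<And>x. x \<in> gen_cone A \<Longrightarrow> \<exists>G\<in>T. x \<in> gen_cone G"
    "\<And>G. G \<in> T \<Longrightarrow> \<exists>l. lower_hull_cells T w G l"
proof -
  from assms obtain w where w: "\<forall>G\<in>T. \<exists>l. lower_hull_cells T w G l" unfolding triang_def by blast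
  show thesis by (rule that[of w]) (use assms w in \<open>simp_all add: triang_def\<close>)
qed

lemma linear_lincomb: "linear l \<Longrightarrow> l (\<Sum>g\<in>G. c g *\<^sub>R g) = (\<Sum>g\<in>G. c g * l g)"
  by (simp add: linear_sum linear_scale)

lemma linear_eq_representation:
  fixes G :: "(real^'n) set" and l :: "real^'n \<Rightarrow> real"
  assumes "finite G" "independent G" "x \<in> span G" "linear l"
  shows "l x = (\<Sum>g\<in>G. coord G x g * l g)"
  using linear_lincomb[OF assms(4), of "coord G x" G] sum_representation[OF assms(1-3)] by simp

text \<open>At each generator of \<open>G\<close> the interpolant of another cell is at most the
  height, with equality only at common generators; expanding \<open>x\<close> over \<open>G\<close>
  sums these inequalities.\<close>

lemma lower_hull_le:
  assumes G: "finite G" "independent G" and x: "x \<in> gen_cone G"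
    and l: "lower_hull_cells T w G l" "lower_hull_cells T w G' l'" and T: "G \<in> T"
  shows "l' x \<le> l x" and "l' x = l x \<Longrightarrow> g \<in> G \<Longrightarrow> coord G x g > 0 \<Longrightarrow> g \<in> G'"
proof -
  have xs: "x \<in> span G" and xp: "\<And>g. g \<in> G \<Longrightarrow> coord G x g \<ge> 0"
    using x gen_cone_iff[OF G] by auto
  have lin: "linear l" "linear l'" using l by (auto simp: lower_hull_cells_def)
  have le: "l' g \<le> l g" if "g \<in> G" for g
    using l that T unfolding lower_hull_cells_def by (metis UnionI less_le order_refl)
  note eq = linear_eq_representation[OF G xs lin(1)] linear_eq_representation[OF G xs lin(2)]
  have le': "coord G x g * l' g \<le> coord G x g * l g" if "g \<in> G" for g
    using xp[OF that] le[OF that] by (intro mult_left_mono)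
  show "l' x \<le> l x" unfolding eq by (rule sum_mono) (rule le')
  assume h: "l' x = l x" "g \<in> G" "coord G x g > 0"
  have "coord G x g * l' g = coord G x g * l g"
    by (rule sum_mono_inv[OF h(1)[unfolded eq] le' h(2) G(1)])
  then have "l' g = l g" using h(3) by simp
  then have "l' g = w g" using l(1) h(2) by (simp add: lower_hull_cells_def)
  then show "g \<in> G'" using l(2) h(2) T unfolding lower_hull_cells_def by (metis UnionI less_irrefl)
qed

lemma gen_cone_of_positive:
  assumes G: "finite G" "independent G" "x \<in> gen_cone G"
    and G': "finite G'" "\<And>g. g \<in> G \<Longrightarrow> coord G x g > 0 \<Longrightarrow> g \<in> G'"
  shows "x \<in> gen_cone G'"
proof -
  have xs: "x \<in> span G" and xp: "\<And>g. g \<in> G \<Longrightarrow> coord G x g \<ge> 0"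
    using G gen_cone_iff[OF G(1,2)] by auto
  have "(\<Sum>g\<in>G. coord G x g *\<^sub>R g) \<in> gen_cone G'"
  proof (rule gen_cone_sum)
    fix g assume g: "g \<in> G"
    show "coord G x g *\<^sub>R g \<in> gen_cone G'"
    proof (cases "coord G x g = 0")
      case True then show ?thesis by (simp add: gen_cone_0)
    next
      case False
      then have "coord G x g > 0" using xp[OF g] by simp
      then show ?thesis using G'(2)[OF g] by (intro gen_cone_scale gen_cone_base[OF G'(1)]) auto
    qed
  qed
  then show ?thesis using sum_representation[OF G(1,2) xs] by simp
qed

text \<open>On \<open>gen_cone G1\<close> the difference \<open>l1 - l2\<close> is nonnegative and
  vanishes exactly on the intersection with \<open>gen_cone G2\<close>, which is therefore an
  exposed face.\<close>

lemma triang_cone_triangulation: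
  assumes T: "triang A T"
  shows "cone_triangulation (gen_cone A) T"
proof -
  obtain w where fin: "finite T" and G: "\<And>G. G \<in> T \<Longrightarrow> finite G \<and> independent G \<and> span G = span A \<and> G \<subseteq> gen_cone A"
    and cov: "\<And>x. x \<in> gen_cone A \<Longrightarrow> \<exists>G\<in>T. x \<in> gen_cone G"
    and w: "\<And>G. G \<in> T \<Longrightarrow> \<exists>l. lower_hull_cells T w G l"
    by (rule triangE[OF T]) (rule that)
  have face: "(gen_cone G1 \<inter> gen_cone G2) face_of gen_cone G1" if G12: "G1 \<in> T" "G2 \<in> T" for G1 G2
  proof -
    obtain l1 l2 where l: "lower_hull_cells T w G1 l1" "lower_hull_cells T w G2 l2" using w G12 by blast
    have G1: "finite G1" "independent G1" and G2: "finite G2" "independent G2" using G G12 by auto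
    have lin: "linear l1" "linear l2" using l by (auto simp: lower_hull_cells_def)
    have int: "x \<in> gen_cone G2 \<longleftrightarrow> l2 x = l1 x" if x: "x \<in> gen_cone G1" for x
    proof
      assume x2: "x \<in> gen_cone G2"
      show "l2 x = l1 x"
        using lower_hull_le(1)[OF G1 x l G12(1)] lower_hull_le(1)[OF G2 x2 l(2,1) G12(2)] by simp
    next
      assume "l2 x = l1 x"
      then show "x \<in> gen_cone G2"
        using lower_hull_le(2)[OF G1 x l G12(1)] by (intro gen_cone_of_positive[OF G1 x G2(1)]) auto
    qed
    have le: "l2 x \<le> l1 x" if "x \<in> gen_cone G1" for x by (rule lower_hull_le(1)[OF G1 that l G12(1)])
    show ?thesis unfolding face_of_def
    proof (intro conjI ballI impI)
      show "convex (gen_cone G1 \<inter> gen_cone G2)" by (intro convex_Int convex_gen_cone)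
      fix a b x assume ab: "a \<in> gen_cone G1" "b \<in> gen_cone G1" and x: "x \<in> gen_cone G1 \<inter> gen_cone G2"
        and seg: "x \<in> open_segment a b"
      obtain u where u: "0 < u" "u < 1" "x = (1 - u) *\<^sub>R a + u *\<^sub>R b" using seg by (auto simp: in_segment)
      have eq: "l2 x = l1 x" using int x by blast
      have "(1 - u) * (l1 a - l2 a) + u * (l1 b - l2 b) = 0"
      proof -
        have "l1 x = (1 - u) * l1 a + u * l1 b" "l2 x = (1 - u) * l2 a + u * l2 b"
          using lin unfolding u(3) by (simp_all add: linear_add linear_scale)
        then show ?thesis using eq by (simp add: right_diff_distrib)
      qed
      moreover have "(1 - u) * (l1 a - l2 a) \<ge> 0" "u * (l1 b - l2 b) \<ge> 0" using u le ab by auto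
      ultimately have "(1 - u) * (l1 a - l2 a) = 0" "u * (l1 b - l2 b) = 0" by linarith+
      then have "l2 a = l1 a" "l2 b = l1 b" using u by auto
      then have "a \<in> gen_cone G2 \<and> b \<in> gen_cone G2" using int ab by simp
      then show "a \<in> gen_cone G1 \<inter> gen_cone G2" "b \<in> gen_cone G1 \<inter> gen_cone G2" using ab by auto
    qed auto
  qed
  have "(\<Union>G\<in>T. gen_cone G) = gen_cone A"
  proof (intro equalityI subsetI)
    fix x assume "x \<in> (\<Union>G\<in>T. gen_cone G)"
    then obtain G' where G': "G' \<in> T" "x \<in> gen_cone G'" by auto
    have "G' \<subseteq> gen_cone A" using G[OF G'(1)] by simp
    from subsetD[OF gen_cone_subset[OF this] G'(2)] show "x \<in> gen_cone A" .
  next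
    fix x assume "x \<in> gen_cone A"
    from cov[OF this] show "x \<in> (\<Union>G\<in>T. gen_cone G)" by auto
  qed
  moreover have "(gen_cone G1 \<inter> gen_cone G2) face_of gen_cone G2" if "G1 \<in> T" "G2 \<in> T" for G1 G2
    using face[OF that(2,1)] by (simp add: Int_commute)
  ultimately show ?thesis unfolding cone_triangulation_def
    using fin G face by simp
qed

text \<open>The convex function is the maximum of the interpolants; on each cell its own interpolant
  attains it.\<close>

lemma triang_regular:
  assumes T: "triang A T"
  shows "regular_triangulation (gen_cone A) T"
proof -
  obtain w where fin: "finite T" and G: "\<And>G. G \<in> T \<Longrightarrow> finite G \<and> independent G \<and> span G = span A \<and> G \<subseteq> gen_cone A"
    and cov: "\<And>x. x \<in> gen_cone A \<Longrightarrow> \<exists>G\<in>T. x \<in> gen_cone G"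
    and w: "\<And>G. G \<in> T \<Longrightarrow> \<exists>l. lower_hull_cells T w G l"
    by (rule triangE[OF T]) (rule that)
  obtain l where l: "\<And>G. G \<in> T \<Longrightarrow> lower_hull_cells T w G (l G)" using w by metis
  have lin: "linear (l G)" if "G \<in> T" for G using l[OF that] by (simp add: lower_hull_cells_def)
  define f where "f x = Max ((\<lambda>G. l G x) ` T)" for x
  have ne: "T \<noteq> {}" using cov[OF gen_cone_0] by auto
  have fge: "l G x \<le> f x" if "G \<in> T" for G x using fin that by (simp add: f_def)
  have feq: "f x = l G x" if GT: "G \<in> T" and x: "x \<in> gen_cone G" for G x
  proof (rule antisym)
    have "l G' x \<le> l G x" if "G' \<in> T" for G'
      using lower_hull_le(1)[OF _ _ x l[OF GT] l[OF that] GT] G[OF GT] by auto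
    then show "f x \<le> l G x" using fin ne by (simp add: f_def)
  qed (rule fge[OF GT])
  have conv: "convex_on (gen_cone A) f"
    unfolding convex_on_def
  proof (intro conjI ballI allI impI)
    show "convex (gen_cone A)" by (rule convex_gen_cone)
    fix x y u v assume uv: "(u::real) \<ge> 0" "(v::real) \<ge> 0"
    have "l G (u *\<^sub>R x + v *\<^sub>R y) \<le> u * f x + v * f y" if GT: "G \<in> T" for G
    proof -
      have "l G (u *\<^sub>R x + v *\<^sub>R y) = u * l G x + v * l G y"
        using lin[OF GT] by (simp add: linear_add linear_scale)
      then show ?thesis using uv fge[OF GT] by (simp add: add_mono mult_left_mono)
    qed
    then show "f (u *\<^sub>R x + v *\<^sub>R y) \<le> u * f x + v * f y"
      using fin ne by (subst f_def) simp
  qed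
  \<comment> \<open>A common linear function agrees with the interpolant of \<open>G1\<close> on the
    whole span, so at a generator of \<open>G2\<close> that interpolant reaches the height, which
    happens only at generators of \<open>G1\<close>.\<close>
  have sub: "G2 \<subseteq> G1" if G12: "G1 \<in> T" "G2 \<in> T" and m: "linear m" "\<forall>x\<in>gen_cone G1 \<union> gen_cone G2. f x = m x"
    for G1 G2 m
  proof
    fix g assume g: "g \<in> G2"
    have G1: "finite G1" "independent G1" and fG2: "finite G2" and sp: "g \<in> span G1"
      using G G12 g span_base[of g G2] by auto
    have "m h = l G1 h" if "h \<in> G1" for h
      using m(2) feq[OF G12(1)] gen_cone_base[OF G1(1) that] by force
    then have "m g = l G1 g"
      unfolding linear_eq_representation[OF G1 sp m(1)] linear_eq_representation[OF G1 sp lin[OF G12(1)]] by simp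
    moreover have "m g = l G2 g"
      using m(2) feq[OF G12(2)] gen_cone_base[OF fG2 g] by force
    moreover have "l G2 g = w g" using l[OF G12(2)] g by (simp add: lower_hull_cells_def)
    moreover have "g \<notin> G1 \<longrightarrow> l G1 g < w g" using l[OF G12(1)] g G12(2) by (auto simp: lower_hull_cells_def)
    ultimately show "g \<in> G1" by auto
  qed
  have max: "\<exists>G\<in>T. \<sigma> = gen_cone G" if "\<sigma> \<in> maximal_cones T" for \<sigma>
    using that by (auto simp: maximal_cones_def)
  show ?thesis unfolding regular_triangulation_def
  proof (rule conjI[OF triang_cone_triangulation[OF T]], rule exI[of _ f], rule conjI[OF conv], rule conjI;
      intro ballI impI)
    show "\<exists>l. linear l \<and> (\<forall>x\<in>\<sigma>. f x = l x)" if "\<sigma> \<in> maximal_cones T" for \<sigma>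
      using max[OF that] lin feq by blast
  next
    fix \<sigma> \<tau> assume st: "\<sigma> \<in> maximal_cones T" "\<tau> \<in> maximal_cones T" "\<sigma> \<noteq> \<tau>"
    obtain G1 G2 where G12: "G1 \<in> T" "\<sigma> = gen_cone G1" "G2 \<in> T" "\<tau> = gen_cone G2"
      using max st by blast
    show "\<not> (\<exists>l. linear l \<and> (\<forall>x\<in>\<sigma> \<union> \<tau>. f x = l x))"
    proof
      assume "\<exists>l. linear l \<and> (\<forall>x\<in>\<sigma> \<union> \<tau>. f x = l x)"
      then obtain m where m: "linear m" "\<forall>x\<in>gen_cone G1 \<union> gen_cone G2. f x = m x" using G12 by auto
      have "G2 \<subseteq> G1" "G1 \<subseteq> G2" using sub[OF G12(1,3) m] sub[OF G12(3,1) m(1)] m(2) by auto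
      then show False using G12 st(3) by auto
    qed
  qed
qed

lemma triang_initial:
  assumes "finite A" "independent A" shows "triang A {A}"
proof -
  have "lower_hull_cells {A} (\<lambda>_. 0) A (\<lambda>_. 0)" by (simp add: lower_hull_cells_def linear_zero)
  then show ?thesis unfolding triang_def using assms gen_cone_base by blast
qed

section \<open>Stellar subdivision of regular triangulations\<close>

lemma small_perturbation:
  fixes S :: "(real \<times> real \<times> real) set"
  assumes "finite S" "\<And>a b d. (a, b, d) \<in> S \<Longrightarrow> a < d"
  obtains \<epsilon> where "\<epsilon> > 0" "\<And>a b d. (a, b, d) \<in> S \<Longrightarrow> a + \<epsilon> * b < d"
proof -
  have "\<exists>\<epsilon>>0. \<forall>\<delta>. 0 < \<delta> \<longrightarrow> \<delta> \<le> \<epsilon> \<longrightarrow> (\<forall>(a, b, d)\<in>S. a + \<delta> * b < d)"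
    using assms
  proof (induction S rule: finite_induct)
    case empty then show ?case by (auto intro: exI[of _ 1])
  next
    case (insert t S)
    obtain a b d where t: "t = (a, b, d)" by (cases t) auto
    have ad: "a < d" using insert.prems[of a b d] t by simp
    obtain \<epsilon> where e: "\<epsilon> > 0" "\<And>\<delta>. 0 < \<delta> \<Longrightarrow> \<delta> \<le> \<epsilon> \<Longrightarrow> (\<forall>(a, b, d)\<in>S. a + \<delta> * b < d)"
      using insert.IH insert.prems by blast
    \<comment> \<open>The added 1 keeps the denominator positive when \<open>b\<close> is 0; the
      factor 2 leaves strict slack.\<close>
    define \<eta> where "\<eta> = (d - a) / (2 * (\<bar>b\<bar> + 1))"
    have "\<eta> > 0" using ad by (simp add: \<eta>_def)
    have "a + \<delta> * b < d" if "0 < \<delta>" "\<delta> \<le> \<eta>" for \<delta>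
    proof -
      have "\<delta> * b \<le> \<delta> * (\<bar>b\<bar> + 1)" using that by (intro mult_left_mono) auto
      also have "\<dots> \<le> \<eta> * (\<bar>b\<bar> + 1)" using that by (intro mult_right_mono) auto
      also have "\<dots> = (d - a) / 2" by (simp add: \<eta>_def field_simps)
      finally show ?thesis using ad by simp
    qed
    then show ?case using e \<open>\<eta> > 0\<close> t by (intro exI[of _ "min \<epsilon> \<eta>"]) auto
  qed
  then obtain \<epsilon> where e: "\<epsilon> > 0" "\<And>\<delta>. 0 < \<delta> \<Longrightarrow> \<delta> \<le> \<epsilon> \<Longrightarrow> (\<forall>(a, b, d)\<in>S. a + \<delta> * b < d)" by blast
  show thesis
  proof (rule that[OF e(1)])
    fix a b d assume "(a, b, d) \<in> S"
    with e(2)[OF e(1) order_refl] show "a + \<epsilon> * b < d" by auto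
  qed
qed

lemma stellar_cell:
  fixes G :: "(real^'n) set"
  assumes G: "finite G" "independent G" and u: "u \<in> span G" "u \<notin> G"
    and g: "g \<in> G" "coord G u g > 0"
  shows "independent (insert u (G - {g}))" "span (insert u (G - {g})) = span G"
proof -
  have "u \<notin> span (G - {g})"
  proof
    assume "u \<in> span (G - {g})"
    from representation_extend[OF G(2) this] have "coord G u = coord (G - {g}) u" by auto
    then have "coord (G - {g}) u g \<noteq> 0" using g by simp
    then show False using representation_ne_zero by blast
  qed
  then show ind: "independent (insert u (G - {g}))"
    using independent_mono[OF G(2), of "G - {g}"] by (auto simp: independent_insert)
  have sub: "insert u (G - {g}) \<subseteq> span G" using u span_base by auto
  let ?S = "span (insert u (G - {g}))"
  have "u = coord G u g *\<^sub>R g + (\<Sum>h\<in>G - {g}. coord G u h *\<^sub>R h)"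
    using sum_representation[OF G u(1)] sum.remove[OF G(1) g(1), of "\<lambda>h. coord G u h *\<^sub>R h"] by simp
  then have "u - (\<Sum>h\<in>G - {g}. coord G u h *\<^sub>R h) = coord G u g *\<^sub>R g"
    by (simp only: diff_eq_eq)
  then have "g = (1 / coord G u g) *\<^sub>R (u - (\<Sum>h\<in>G - {g}. coord G u h *\<^sub>R h))"
    using g(2) by simp
  also have "\<dots> \<in> ?S" by (intro span_scale span_diff span_sum span_base) auto
  finally have "g \<in> ?S" .
  moreover have "h \<in> ?S" if "h \<in> G" "h \<noteq> g" for h by (rule span_base) (use that in simp)
  ultimately have "G \<subseteq> ?S" by auto
  then show "?S = span G" using sub by (simp add: span_eq)
qed

lemma linear_minus_multiple:
  fixes f g :: "real^'n \<Rightarrow> real"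
  assumes "linear f" "linear g" shows "linear (\<lambda>x. f x - k * g x)"
  by (rule linearI) (use assms in \<open>simp_all add: linear_add linear_scale algebra_simps\<close>)

text \<open>Stellar subdivision at \<open>u\<close>; its height is chosen slightly below the current lower hull.\<close>

lemma triang_stellar:
  assumes T: "triang A T" and u: "u \<in> gen_cone A" "u \<noteq> 0"
  obtains T' where "triang A T'"
    "\<And>G'. G' \<in> T' \<Longrightarrow> (G' \<in> T \<and> u \<notin> gen_cone G') \<or>
       (\<exists>G\<in>T. \<exists>g\<in>G. u \<in> gen_cone G \<and> coord G u g > 0 \<and> G' = insert u (G - {g}))"
proof -
  obtain w where fin: "finite T" and G: "\<And>G. G \<in> T \<Longrightarrow> finite G \<and> independent G \<and> span G = span A \<and> G \<subseteq> gen_cone A"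
    and cov: "\<And>x. x \<in> gen_cone A \<Longrightarrow> \<exists>G\<in>T. x \<in> gen_cone G"
    and w: "\<And>G. G \<in> T \<Longrightarrow> \<exists>l. lower_hull_cells T w G l"
    by (rule triangE[OF T]) (rule that)
  obtain l where l: "\<And>G. G \<in> T \<Longrightarrow> lower_hull_cells T w G (l G)" using w by metis
  have fG: "finite G" and iG: "independent G" and sG: "span G = span A" if "G \<in> T" for G using G[OF that] by auto
  have lin: "linear (l G)" and lw: "\<And>g. g \<in> G \<Longrightarrow> l G g = w g"
    and llt: "\<And>h. h \<in> \<Union>T \<Longrightarrow> h \<notin> G \<Longrightarrow> l G h < w h" if "G \<in> T" for G
    using l[OF that] by (auto simp: lower_hull_cells_def)
  have uA: "u \<in> span A" by (rule subsetD[OF gen_cone_span u(1)])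
  show thesis
  proof (cases "u \<in> \<Union>T")
    case True
    then obtain G0 where G0: "G0 \<in> T" "u \<in> G0" by blast
    \<comment> \<open>If \<open>u\<close> is already a generator somewhere, it is a generator of
      every cell containing it. Then \<open>T\<close> itself serves, with \<open>u\<close> replaced
      by \<open>u\<close>.\<close>
    have inG: "u \<in> G" if GT: "G \<in> T" and uG: "u \<in> gen_cone G" for G
    proof -
      have "l G0 u \<le> l G u" by (rule lower_hull_le(1)[OF fG[OF GT] iG[OF GT] uG l[OF GT] l[OF G0(1)] GT])
      then show ?thesis using lw[OF G0] llt[OF GT True] by force
    qed
    show thesis
    proof (rule that[OF T])
      fix G' assume G': "G' \<in> T"
      show "(G' \<in> T \<and> u \<notin> gen_cone G') \<or>
       (\<exists>G\<in>T. \<exists>g\<in>G. u \<in> gen_cone G \<and> coord G u g > 0 \<and> G' = insert u (G - {g}))"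
      proof (cases "u \<in> gen_cone G'")
        case True
        then have "u \<in> G'" "coord G' u u > 0"
          using inG[OF G'] representation_basis[OF iG[OF G'], of u] by auto
        then show ?thesis using G' True by (intro disjI2 bexI[of _ G'] bexI[of _ u]) auto
      qed (use G' in auto)
    qed
  next
    case False
    obtain G1 where G1: "G1 \<in> T" "u \<in> gen_cone G1" using cov[OF u(1)] by blast
    define v0 where "v0 = l G1 u"
    have le1: "l G u \<le> v0" if GT: "G \<in> T" for G
      unfolding v0_def by (rule lower_hull_le(1)[OF fG[OF G1(1)] iG[OF G1(1)] G1(2) l[OF G1(1)] l[OF GT] G1(1)])
    have eq1: "l G u = v0" if GT: "G \<in> T" and uG: "u \<in> gen_cone G" for G
      using le1[OF GT] lower_hull_le(1)[OF fG[OF GT] iG[OF GT] uG l[OF GT] l[OF G1(1)] GT] by (simp add: v0_def)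
    have lt1: "l G u < v0" if GT: "G \<in> T" and uG: "u \<notin> gen_cone G" for G
    proof (rule ccontr)
      assume "\<not> l G u < v0"
      then have "l G u = l G1 u" using le1[OF GT] by (simp add: v0_def)
      from lower_hull_le(2)[OF fG[OF G1(1)] iG[OF G1(1)] G1(2) l[OF G1(1)] l[OF GT] G1(1) this]
      have "u \<in> gen_cone G" by (intro gen_cone_of_positive[OF fG[OF G1(1)] iG[OF G1(1)] G1(2) fG[OF GT]])
      then show False using uG by blast
    qed
    \<comment> \<open>The first family keeps the interpolants of cells missing \<open>u\<close>
      below the new height. The second keeps the pivoted interpolants below the heights of
      generators outside \<open>G\<close>; where \<open>coord G u g\<close> is 0 the quotient is 0
      by convention and the triple is harmless.\<close>
    define S where "S = (\<lambda>G. (l G u, 1, v0)) ` {G\<in>T. u \<notin> gen_cone G}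
      \<union> (\<lambda>(G, g, h). (l G h, - (coord G h g / coord G u g), w h)) `
          {(G, g, h). G \<in> T \<and> g \<in> G \<and> h \<in> \<Union>T - G}"
    have "finite {(G, g, h). G \<in> T \<and> g \<in> G \<and> h \<in> \<Union>T - G}"
      by (rule finite_subset[of _ "T \<times> \<Union>T \<times> \<Union>T"]) (use fin fG in auto)
    then have finS: "finite S" unfolding S_def using fin by simp
    have Slt: "a < d" if "(a, b, d) \<in> S" for a b d using that lt1 llt by (auto simp: S_def)
    obtain \<epsilon> where e: "\<epsilon> > 0" "\<And>a b d. (a, b, d) \<in> S \<Longrightarrow> a + \<epsilon> * b < d"
    proof (rule small_perturbation[OF finS])
      show "a < d" if "(a, b, d) \<in> S" for a b d by (rule Slt[OF that])
    qed (rule that)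
    have e1: "l G u < v0 - \<epsilon>" if "G \<in> T" "u \<notin> gen_cone G" for G
    proof -
      have "(l G u, 1, v0) \<in> S" unfolding S_def by (rule UnI1) (use that in auto)
      from e(2)[OF this] show ?thesis by simp
    qed
    have e2: "l G h - (\<epsilon> / coord G u g) * coord G h g < w h"
      if "G \<in> T" "g \<in> G" "h \<in> \<Union>T" "h \<notin> G" for G g h
    proof -
      have "(l G h, - (coord G h g / coord G u g), w h) \<in> S"
        unfolding S_def by (rule UnI2) (rule image_eqI[of _ _ "(G, g, h)"], use that in auto)
      from e(2)[OF this] show ?thesis by simp
    qed
    define T' where "T' = {G\<in>T. u \<notin> gen_cone G}
      \<union> (\<lambda>(G, g). insert u (G - {g})) ` {(G, g). G \<in> T \<and> g \<in> G \<and> u \<in> gen_cone G \<and> coord G u g > 0}"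
    have T'cases: "(G' \<in> T \<and> u \<notin> gen_cone G') \<or>
       (\<exists>G\<in>T. \<exists>g\<in>G. u \<in> gen_cone G \<and> coord G u g > 0 \<and> G' = insert u (G - {g}))" if "G' \<in> T'" for G'
      using that unfolding T'_def by auto
    have unT': "\<Union>T' \<subseteq> insert u (\<Union>T)" using T'cases by blast
    have unG: "u \<notin> G" if "G \<in> T" for G using False that by blast
    define w' where "w' = w(u := v0 - \<epsilon>)"
    have w'w: "w' h = w h" if "h \<in> \<Union>T" for h using that False by (auto simp: w'_def)
    have "triang A T'" unfolding triang_def
    proof (intro conjI ballI)
      have "finite {(G, g). G \<in> T \<and> g \<in> G \<and> u \<in> gen_cone G \<and> coord G u g > 0}"
        by (rule finite_subset[of _ "T \<times> \<Union>T"]) (use fin fG in auto)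
      then show "finite T'" unfolding T'_def using fin by simp
    next
      fix G' assume "G' \<in> T'"
      from T'cases[OF this] have "finite G' \<and> independent G' \<and> span G' = span A \<and> G' \<subseteq> gen_cone A"
      proof
        assume "\<exists>G\<in>T. \<exists>g\<in>G. u \<in> gen_cone G \<and> coord G u g > 0 \<and> G' = insert u (G - {g})"
        then obtain G g where Gg: "G \<in> T" "g \<in> G" "coord G u g > 0" "G' = insert u (G - {g})" by blast
        have "u \<in> span G" using uA sG[OF Gg(1)] by simp
        from stellar_cell[OF fG[OF Gg(1)] iG[OF Gg(1)] this unG[OF Gg(1)] Gg(2,3)]
        show ?thesis using Gg G[OF Gg(1)] u(1) by auto
      qed (use G in auto)
      then show "finite G'" "independent G'" "span G' = span A" "G' \<subseteq> gen_cone A" by auto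
    next
      fix x assume "x \<in> gen_cone A"
      then obtain G where GT: "G \<in> T" and xG: "x \<in> gen_cone G" using cov by blast
      show "\<exists>G'\<in>T'. x \<in> gen_cone G'"
      proof (cases "u \<in> gen_cone G")
        case False
        then show ?thesis using GT xG by (intro bexI[of _ G]) (auto simp: T'_def)
      next
        case True
        note fi = fG[OF GT] iG[OF GT]
        let ?c = "coord G u" and ?y = "coord G x"
        have us: "u \<in> span G" and cp: "\<And>g. g \<in> G \<Longrightarrow> ?c g \<ge> 0" using True gen_cone_iff[OF fi] by auto
        have xs: "x \<in> span G" and yp: "\<And>g. g \<in> G \<Longrightarrow> ?y g \<ge> 0" using xG gen_cone_iff[OF fi] by auto
        let ?P = "{g \<in> G. ?c g > 0}"
        have "?P \<noteq> {}"
        proof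
          assume "?P = {}"
          then have "\<forall>g\<in>G. ?c g = 0" using cp by (force simp: order_less_le)
          then have "(\<Sum>g\<in>G. ?c g *\<^sub>R g) = 0" by simp
          then show False using sum_representation[OF fi us] u(2) by simp
        qed
        \<comment> \<open>The ratio test of the simplex method: \<open>g\<close> is the first
          generator in the support of \<open>u\<close> whose coordinate reaches 0 when multiples of
          \<open>u\<close> are subtracted from \<open>x\<close>.\<close>
        obtain g where g: "g \<in> ?P" and gmin: "\<And>h. h \<in> ?P \<Longrightarrow> ?y g / ?c g \<le> ?y h / ?c h"
        proof -
          have "finite ?P" using fi(1) by simp
          from arg_min_if_finite[OF this \<open>?P \<noteq> {}\<close>, of "\<lambda>h. ?y h / ?c h"] show thesis
            by (intro that[of "arg_min_on (\<lambda>h. ?y h / ?c h) ?P"]) (auto simp: not_less)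
        qed
        let ?t = "?y g / ?c g"
        have gG: "g \<in> G" and gc: "?c g > 0" using g by auto
        have t0: "?t \<ge> 0" using yp[OF gG] gc by simp
        have "x = (\<Sum>h\<in>G. (?y h - ?t * ?c h) *\<^sub>R h) + ?t *\<^sub>R u"
        proof -
          have "(\<Sum>h\<in>G. (?y h - ?t * ?c h) *\<^sub>R h) = (\<Sum>h\<in>G. ?y h *\<^sub>R h) - ?t *\<^sub>R (\<Sum>h\<in>G. ?c h *\<^sub>R h)"
            by (simp add: scaleR_left_diff_distrib sum_subtractf scaleR_sum_right)
          then show ?thesis using sum_representation[OF fi us] sum_representation[OF fi xs] by simp
        qed
        also have "(\<Sum>h\<in>G. (?y h - ?t * ?c h) *\<^sub>R h) = (\<Sum>h\<in>G - {g}. (?y h - ?t * ?c h) *\<^sub>R h)"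
          using fi gG gc by (simp add: sum.remove)
        finally have xe: "x = (\<Sum>h\<in>G - {g}. (?y h - ?t * ?c h) *\<^sub>R h) + ?t *\<^sub>R u" .
        have fin': "finite (insert u (G - {g}))" using fi by simp
        have "(\<Sum>h\<in>G - {g}. (?y h - ?t * ?c h) *\<^sub>R h) \<in> gen_cone (insert u (G - {g}))"
        proof (rule gen_cone_sum)
          fix h assume h: "h \<in> G - {g}"
          have "?t * ?c h \<le> ?y h"
          proof (cases "?c h > 0")
            case True
            then have "?t \<le> ?y h / ?c h" using gmin h by simp
            then show ?thesis using True by (simp add: pos_le_divide_eq)
          next
            case False
            then have "?c h = 0" using cp[of h] h by auto
            then show ?thesis using yp[of h] h by simp
          qed
          then show "(?y h - ?t * ?c h) *\<^sub>R h \<in> gen_cone (insert u (G - {g}))"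
            using h by (intro gen_cone_scale gen_cone_base[OF fin']) auto
        qed
        moreover have "?t *\<^sub>R u \<in> gen_cone (insert u (G - {g}))"
          using t0 by (intro gen_cone_scale gen_cone_base[OF fin']) auto
        ultimately have "x \<in> gen_cone (insert u (G - {g}))" by (subst xe) (rule gen_cone_add)
        moreover have "insert u (G - {g}) \<in> T'" unfolding T'_def using GT gG gc True by auto
        ultimately show ?thesis by blast
      qed
    next
      show "\<exists>w'. \<forall>G'\<in>T'. \<exists>l'. lower_hull_cells T' w' G' l'"
      proof (rule exI[of _ w'], rule ballI)
      fix G' assume "G' \<in> T'"
      from T'cases[OF this] show "\<exists>l'. lower_hull_cells T' w' G' l'"
      proof
        assume G': "G' \<in> T \<and> u \<notin> gen_cone G'"
        have "l G' h < w' h" if h: "h \<in> \<Union>T'" "h \<notin> G'" for h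
        proof (cases "h = u")
          case True then show ?thesis using e1 G' by (simp add: w'_def)
        next
          case False
          then have "h \<in> \<Union>T" using unT' h by blast
          then show ?thesis using llt[of G' h] G' h w'w by simp
        qed
        moreover have "l G' h = w' h" if "h \<in> G'" for h
        proof -
          have "h \<in> \<Union>T" using G' that by blast
          then show ?thesis using lw[of G' h] w'w G' that by simp
        qed
        ultimately show ?thesis using G' lin[of G'] unfolding lower_hull_cells_def
          by (intro exI[of _ "l G'"]) simp
      next
        assume "\<exists>G\<in>T. \<exists>g\<in>G. u \<in> gen_cone G \<and> coord G u g > 0 \<and> G' = insert u (G - {g})"
        then obtain G g where GT: "G \<in> T" and gG: "g \<in> G" and uG: "u \<in> gen_cone G"
          and gp: "coord G u g > 0" and G'e: "G' = insert u (G - {g})" by blast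
        note fi = fG[OF GT] iG[OF GT]
        let ?cg = "coord G u g"
        obtain gs :: "real^'a \<Rightarrow> real" where gs: "linear gs" "\<forall>h\<in>G. gs h = (if h = g then 1 else 0)"
          using linear_independent_extend[OF iG[OF GT], of "\<lambda>h. if h = g then 1 else (0::real)"] by blast
        have gsr: "gs x = coord G x g" if "x \<in> span G" for x
        proof -
          have "gs x = (\<Sum>h\<in>G. coord G x h * gs h)" by (rule linear_eq_representation[OF fi that gs(1)])
          also have "\<dots> = (\<Sum>h\<in>G. if h = g then coord G x h else 0)" by (rule sum.cong) (use gs(2) in auto)
          finally show ?thesis using fi gG by simp
        qed
        \<comment> \<open>Tilting along the coordinate of \<open>g\<close> lowers the value at
          \<open>u\<close> by exactly \<epsilon>, keeps the values on the rest of \<open>G\<close>,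
          and pushes the value at \<open>g\<close> strictly below its height.\<close>
        define l' where "l' x = l G x - (\<epsilon> / ?cg) * gs x" for x
        have "linear l'" unfolding l'_def by (rule linear_minus_multiple[OF lin[OF GT] gs(1)])
        moreover have "l' h = w' h" if "h \<in> G'" for h
        proof (cases "h = u")
          case True
          have "gs u = ?cg" by (rule gsr) (use uA sG[OF GT] in simp)
          then show ?thesis using True eq1[OF GT uG] gp by (simp add: l'_def w'_def)
        next
          case False
          then have h: "h \<in> G" "h \<noteq> g" using that G'e by auto
          then have "h \<in> \<Union>T" using GT by blast
          then show ?thesis using h lw[OF GT] gs(2) w'w by (simp add: l'_def)
        qed
        moreover have "l' h < w' h" if h: "h \<in> \<Union>T'" "h \<notin> G'" for h
        proof -
          have hT: "h \<in> \<Union>T" using unT' h G'e by blast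
          show ?thesis
          proof (cases "h = g")
            case True
            then show ?thesis using lw[OF GT gG] gs(2) gG w'w[OF hT] e(1) gp by (simp add: l'_def)
          next
            case False
            then have hG: "h \<notin> G" using h G'e by auto
            obtain G2 where "G2 \<in> T" "h \<in> G2" using hT by blast
            then have "h \<in> span G" using span_base[of h G2] sG GT by auto
            then show ?thesis using e2[OF GT gG hT hG] w'w[OF hT] gsr by (simp add: l'_def)
          qed
        qed
        ultimately show ?thesis unfolding lower_hull_cells_def by blast
      qed
      qed
    qed
    then show thesis by (rule that) (rule T'cases)
  qed
qed

text \<open>A later step could spoil an earlier one only by removing a generator \<open>g\<close>
  that still lies in the new cell. Then \<open>u\<close> would be a positive multiple of
  \<open>g\<close>, which \<open>prim\<close> excludes.\<close>

lemma triang_iterate: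
  assumes "finite U" "triang A T" "\<And>G. G \<in> T \<Longrightarrow> P G"
    and U: "\<And>u. u \<in> U \<Longrightarrow> u \<in> gen_cone A \<and> u \<noteq> 0"
    and prim: "\<And>u v c. u \<in> U \<Longrightarrow> v \<in> U \<Longrightarrow> u = c *\<^sub>R v \<Longrightarrow> c \<ge> 0 \<Longrightarrow> u = v"
    and step: "\<And>G u g. P G \<Longrightarrow> finite G \<Longrightarrow> independent G \<Longrightarrow> span G = span A \<Longrightarrow> u \<in> U \<Longrightarrow> u \<in> gen_cone G \<Longrightarrow>
      u \<notin> G \<Longrightarrow> g \<in> G \<Longrightarrow> coord G u g > 0 \<Longrightarrow> P (insert u (G - {g}))"
  obtains T' where "triang A T'" "\<And>G. G \<in> T' \<Longrightarrow> P G"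
    "\<And>G u. G \<in> T' \<Longrightarrow> u \<in> U \<Longrightarrow> u \<in> gen_cone G \<Longrightarrow> u \<in> G"
proof -
  have "\<exists>T'. triang A T' \<and> (\<forall>G\<in>T'. P G \<and> (\<forall>u\<in>V. u \<in> gen_cone G \<longrightarrow> u \<in> G))" if "V \<subseteq> U" for V
    using finite_subset[OF that assms(1)] that
  proof (induction V rule: finite_induct)
    case empty then show ?case using assms(2,3) by auto
  next
    case (insert u V)
    then obtain T1 where T1: "triang A T1" "\<And>G. G \<in> T1 \<Longrightarrow> P G"
      "\<And>G v. G \<in> T1 \<Longrightarrow> v \<in> V \<Longrightarrow> v \<in> gen_cone G \<Longrightarrow> v \<in> G" by auto
    have uU: "u \<in> U" and VU: "V \<subseteq> U" using insert.prems by auto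
    obtain T2 where T2: "triang A T2" "\<And>G'. G' \<in> T2 \<Longrightarrow> (G' \<in> T1 \<and> u \<notin> gen_cone G') \<or>
       (\<exists>G\<in>T1. \<exists>g\<in>G. u \<in> gen_cone G \<and> coord G u g > 0 \<and> G' = insert u (G - {g}))"
      by (rule triang_stellar[OF T1(1), of u]) (use U uU in auto)
    have "P G' \<and> (\<forall>v\<in>insert u V. v \<in> gen_cone G' \<longrightarrow> v \<in> G')" if G': "G' \<in> T2" for G'
      using T2(2)[OF G']
    proof
      assume "G' \<in> T1 \<and> u \<notin> gen_cone G'"
      then show ?thesis using T1 by auto
    next
      assume "\<exists>G\<in>T1. \<exists>g\<in>G. u \<in> gen_cone G \<and> coord G u g > 0 \<and> G' = insert u (G - {g})"
      then obtain G g where GT: "G \<in> T1" and gG: "g \<in> G" and uG: "u \<in> gen_cone G"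
          and gp: "coord G u g > 0" and G'e: "G' = insert u (G - {g})" by blast
      have fi: "finite G" "independent G" "span G = span A" using T1(1) GT by (auto simp: triang_def)
      show ?thesis
      proof (cases "u \<in> G")
        case True
        then have "g = u" using gp representation_basis[OF fi(2) True] by (auto split: if_splits)
        then have "G' = G" using G'e True by auto
        then show ?thesis using T1(2,3)[OF GT] True by auto
      next
        case False
        have "P G'" unfolding G'e by (rule step[OF T1(2)[OF GT] fi uU uG False gG gp])
        moreover have "v \<in> G'" if v: "v \<in> V" "v \<in> gen_cone G'" for v
        proof -
          have "G' \<subseteq> gen_cone G" using G'e uG gen_cone_base[OF fi(1)] by auto
          then have vG: "v \<in> G" using T1(3)[OF GT v(1)] gen_cone_subset v(2) by blast
          have "v \<noteq> g"
          proof
            assume vg: "v = g"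
            have us: "u \<in> span G" and cp: "\<And>h. h \<in> G \<Longrightarrow> coord G u h \<ge> 0"
              using uG gen_cone_iff[OF fi(1,2)] by auto
            obtain c where c: "\<forall>h\<in>G'. c h \<ge> 0" "g = (\<Sum>h\<in>G'. c h *\<^sub>R h)"
              using v(2) vg by (auto simp: gen_cone_def)
            have "g = c u *\<^sub>R u + (\<Sum>h\<in>G - {g}. c h *\<^sub>R h)"
              using c(2) fi(1) False by (simp add: G'e)
            also have "c u *\<^sub>R u = (\<Sum>h\<in>G. (c u * coord G u h) *\<^sub>R h)"
              using sum_representation[OF fi(1,2) us] by (metis (no_types, lifting) scaleR_scaleR scaleR_sum_right sum.cong)
            also have "(\<Sum>h\<in>G - {g}. c h *\<^sub>R h) = (\<Sum>h\<in>G. (if h = g then 0 else c h) *\<^sub>R h)"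
              using fi(1) gG by (simp add: sum.remove)
            finally have "g = (\<Sum>h\<in>G. (c u * coord G u h + (if h = g then 0 else c h)) *\<^sub>R h)"
              by (simp add: scaleR_left_distrib sum.distrib)
            then have "coord G g = (\<lambda>h. if h \<in> G then c u * coord G u h + (if h = g then 0 else c h) else 0)"
              using representation_lincomb[OF fi(1,2), of "\<lambda>h. c u * coord G u h + (if h = g then 0 else c h)"] by simp
            \<comment> \<open>Comparing coordinates of \<open>g\<close>: off \<open>g\<close> both
              nonnegative terms must vanish, so \<open>u\<close> has no coordinate other than that
              of \<open>g\<close>.\<close>
            then have r: "(if h = g then 1 else 0) = c u * coord G u h + (if h = g then 0 else c h)" if "h \<in> G" for h
              using representation_basis[OF fi(2) gG] that by (metis (mono_tags, lifting))
            have cu: "c u * coord G u g = 1" using r[OF gG] by simp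
            have cu0: "c u \<ge> 0" using c(1) G'e by simp
            have "coord G u h = 0" if h: "h \<in> G" "h \<noteq> g" for h
            proof -
              have "c u * coord G u h + c h = 0" using r[OF h(1)] h(2) by simp
              moreover have "c h \<ge> 0" "c u * coord G u h \<ge> 0" using c(1) G'e h cu0 cp by auto
              ultimately have "c u * coord G u h = 0" by linarith
              then show ?thesis using cu by auto
            qed
            then have "u = coord G u g *\<^sub>R g"
              using sum_representation[OF fi(1,2) us] fi(1) gG by (simp add: sum.remove)
            then have "u = v" using prim[OF uU _ _ less_imp_le[OF gp], of v] v(1) VU vg by auto
            then show False using False vG by simp
          qed
          then show ?thesis using vG G'e by simp
        qed
        ultimately show ?thesis using G'e by auto
      qed
    qed
    then show ?case using T2(1) by blast
  qed
  from this[of U] that show thesis by blast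
qed

section \<open>Unimodular triangulations\<close>

text \<open>For a lattice \<open>\<Gamma>\<close> containing \<open>G\<close> this bounds the
  quotient by the lattice of \<open>G\<close> to an elementary abelian 2-group; generators added
  after \<open>B\<close> carry no denominators.\<close>

definition half_integral_on :: "(real^'n) set \<Rightarrow> (real^'n) set \<Rightarrow> (real^'n) set \<Rightarrow> bool" where
  "half_integral_on \<Gamma> B G \<longleftrightarrow> (\<forall>x\<in>\<Gamma>. \<forall>g\<in>G. 2 * coord G x g \<in> \<int> \<and>
     (g \<notin> B \<longrightarrow> coord G x g \<in> \<int>))"

lemma representation_stellar:
  fixes G :: "(real^'n) set"
  assumes G: "finite G" "independent G" and u: "u \<in> span G" "u \<notin> G"
    and g: "g \<in> G" "coord G u g > 0" and x: "x \<in> span G"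
  shows "coord (insert u (G - {g})) x u = coord G x g / coord G u g"
    and "h \<in> G - {g} \<Longrightarrow> coord (insert u (G - {g})) x h
      = coord G x h - coord G x g / coord G u g * coord G u h"
proof -
  let ?G = "insert u (G - {g})"
  let ?t = "coord G x g / coord G u g"
  define c where "c h = (if h = u then ?t else coord G x h - ?t * coord G u h)" for h
  have "(\<Sum>h\<in>?G. c h *\<^sub>R h) = ?t *\<^sub>R u + (\<Sum>h\<in>G - {g}. (coord G x h - ?t * coord G u h) *\<^sub>R h)"
  proof -
    have "(\<Sum>h\<in>G - {g}. c h *\<^sub>R h) = (\<Sum>h\<in>G - {g}. (coord G x h - ?t * coord G u h) *\<^sub>R h)"
      by (rule sum.cong) (use u in \<open>auto simp: c_def\<close>)
    then show ?thesis using G u by (simp add: c_def)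
  qed
  also have "(\<Sum>h\<in>G - {g}. (coord G x h - ?t * coord G u h) *\<^sub>R h)
      = (\<Sum>h\<in>G. (coord G x h - ?t * coord G u h) *\<^sub>R h)"
    using G g by (simp add: sum.remove)
  also have "\<dots> = (\<Sum>h\<in>G. coord G x h *\<^sub>R h) - ?t *\<^sub>R (\<Sum>h\<in>G. coord G u h *\<^sub>R h)"
    by (simp add: scaleR_left_diff_distrib sum_subtractf scaleR_sum_right)
  also have "\<dots> = x - ?t *\<^sub>R u" using sum_representation[OF G u(1)] sum_representation[OF G x] by simp
  finally have "(\<Sum>h\<in>?G. c h *\<^sub>R h) = x" by simp
  moreover have "finite ?G" using G by simp
  ultimately have r: "coord ?G x = (\<lambda>h. if h \<in> ?G then c h else 0)"
    using representation_lincomb[of ?G c] stellar_cell(1)[OF G u g] by simp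
  show "coord ?G x u = ?t" unfolding r by (simp add: c_def)
  show "coord ?G x h = coord G x h - ?t * coord G u h" if "h \<in> G - {g}"
  proof -
    have "h \<noteq> u" "h \<in> ?G" using that u(2) by auto
    then show ?thesis unfolding r by (simp add: c_def)
  qed
qed

text \<open>The new coordinate at \<open>u\<close> is twice the old one at \<open>g\<close>, hence
  an integer. The other coordinates change only where \<open>u\<close> has coordinate 1/2, which
  forces membership in \<open>B\<close>, and there they change by a half-integer.\<close>

lemma half_integral_on_stellar:
  fixes G :: "(real^'n) set"
  assumes G: "finite G" "independent G" and \<Gamma>: "\<Gamma> \<subseteq> span G" and hi: "half_integral_on \<Gamma> B G"
    and u: "u \<in> \<Gamma>" "u \<notin> G" "\<And>h. h \<in> G \<Longrightarrow> coord G u h = 0 \<or> coord G u h = 1/2"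
    and g: "g \<in> G" "coord G u g > 0"
  shows "half_integral_on \<Gamma> B (insert u (G - {g}))"
proof -
  have us: "u \<in> span G" using u \<Gamma> by auto
  have ug: "coord G u g = 1/2" using u(3)[OF g(1)] g(2) by auto
  have inB: "coord G u h = 0" if "h \<in> G" "h \<notin> B" for h
    using u(3)[OF that(1)] hi u(1) that unfolding half_integral_on_def by (metis half_not_int)
  show ?thesis unfolding half_integral_on_def
  proof (intro ballI)
    fix x h assume x: "x \<in> \<Gamma>" and h: "h \<in> insert u (G - {g})"
    have xs: "x \<in> span G" using x \<Gamma> by auto
    note r = representation_stellar[OF G us u(2) g xs]
    have hiG: "2 * coord G x k \<in> \<int>" "k \<notin> B \<Longrightarrow> coord G x k \<in> \<int>" if "k \<in> G" for k
      using hi x that unfolding half_integral_on_def by auto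
    show "2 * coord (insert u (G - {g})) x h \<in> \<int> \<and> (h \<notin> B \<longrightarrow> coord (insert u (G - {g})) x h \<in> \<int>)"
    proof (cases "h = u")
      case True
      have "coord (insert u (G - {g})) x u = 2 * coord G x g" by (simp add: r(1) ug)
      then have "coord (insert u (G - {g})) x h \<in> \<int>" using True hiG(1)[OF g(1)] by simp
      then show ?thesis using Ints_mult[OF Ints_numeral] by blast
    next
      case False
      then have hG: "h \<in> G - {g}" using h by simp
      have e: "coord (insert u (G - {g})) x h = coord G x h - 2 * coord G x g * coord G u h"
        by (simp add: r(2)[OF hG] ug)
      show ?thesis
      proof (cases "coord G u h = 0")
        case True
        then show ?thesis using e hiG hG by simp
      next
        case False
        then have hB: "h \<in> B" and uh: "coord G u h = 1/2" using inB u(3) hG by auto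
        have "2 * coord (insert u (G - {g})) x h = 2 * coord G x h - 2 * coord G x g"
          unfolding e uh by simp
        moreover have "2 * coord G x h - 2 * coord G x g \<in> \<int>"
          using hiG(1) hG g(1) by (intro Ints_diff) auto
        ultimately show ?thesis using hB by simp
      qed
    qed
  qed
qed

lemma half_sum_notin:
  fixes G :: "(real^'n) set"
  assumes "finite G" "independent G" "F \<subseteq> G"
  shows "(hsum F) \<notin> G"
proof
  let ?q = "hsum F"
  assume q: "?q \<in> G"
  have "?q = (\<Sum>h\<in>G. (if h \<in> F then 1/2 else 0) *\<^sub>R h)"
    by (rule sum.mono_neutral_cong_left) (use assms in auto)
  then have "coord G ?q = (\<lambda>g. if g \<in> G then (if g \<in> F then 1/2 else 0) else 0)"
    using representation_lincomb[OF assms(1,2), of "\<lambda>h. if h \<in> F then 1/2 else 0"] by simp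
  from fun_cong[OF this, of ?q] show False using representation_basis[OF assms(2) q] q by (auto split: if_splits)
qed

text \<open>\<open>M\<close> matches the vectors in pairs with integral half sums such that the vectors with a coordinate
  in \<open>1/4 + (1/2)\<int>\<close> always form a union of pairs. Subdividing at these half sums first puts them
  into every cell.\<close>

locale quarter_lattice =
  fixes A :: "(real^'n) set" and \<Lambda> :: "(real^'n) set" and M :: "(real^'n) set set"
  assumes finA: "finite A" and indA: "independent A"
    and Lspan: "\<Lambda> \<subseteq> span A" and AL: "A \<subseteq> \<Lambda>" and L0: "0 \<in> \<Lambda>"
    and Ladd: "x \<in> \<Lambda> \<Longrightarrow> y \<in> \<Lambda> \<Longrightarrow> x + y \<in> \<Lambda>" and Lminus: "x \<in> \<Lambda> \<Longrightarrow> - x \<in> \<Lambda>"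
    and quarter: "x \<in> \<Lambda> \<Longrightarrow> a \<in> A \<Longrightarrow> 4 * coord A x a \<in> \<int>"
    and prim: "a \<in> A \<Longrightarrow> t *\<^sub>R a \<in> \<Lambda> \<Longrightarrow> t \<in> \<int>"
    and M: "m \<in> M \<Longrightarrow> \<exists>a\<in>A. \<exists>b\<in>A. a \<noteq> b \<and> m = {a, b} \<and> (1/2) *\<^sub>R a + (1/2) *\<^sub>R b \<in> \<Lambda> \<and>
        (\<forall>s t. s *\<^sub>R a + t *\<^sub>R b \<in> \<Lambda> \<longrightarrow> s + t \<in> \<int> \<and> s - t \<in> \<int>)"
    and disjM: "m \<in> M \<Longrightarrow> m' \<in> M \<Longrightarrow> m \<noteq> m' \<Longrightarrow> m \<inter> m' = {}"
    and qM: "x \<in> \<Lambda> \<Longrightarrow> m \<in> M \<Longrightarrow> m \<subseteq> {a. qodd (coord A x a)} \<or> m \<inter> {a. qodd (coord A x a)} = {}"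
    and qUM: "x \<in> \<Lambda> \<Longrightarrow> a \<in> A \<Longrightarrow> qodd (coord A x a) \<Longrightarrow> a \<in> \<Union>M"
begin

abbreviation "rp \<equiv> coord A"
abbreviation "C \<equiv> gen_cone A"

text \<open>The irreducible elements of the monoid \<open>\<Lambda> \<inter> C\<close>, which turn
  out to be the Hilbert basis.\<close>

definition "Irr = {x \<in> \<Lambda> \<inter> C. x \<noteq> 0 \<and> (\<forall>u\<in>\<Lambda> \<inter> C. \<forall>v\<in>\<Lambda> \<inter> C. x = u + v \<longrightarrow> u = 0 \<or> v = 0)}"
definition "Half = {x \<in> \<Lambda>. \<forall>a\<in>A. 2 * rp x a \<in> \<int>}"
definition "hm m = (hsum m)"

lemma Ldiff: "x \<in> \<Lambda> \<Longrightarrow> y \<in> \<Lambda> \<Longrightarrow> x - y \<in> \<Lambda>"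
  using Ladd[of x "- y"] Lminus by simp

lemma Lsum: "(\<And>i. i \<in> I \<Longrightarrow> f i \<in> \<Lambda>) \<Longrightarrow> sum f I \<in> \<Lambda>"
  by (induction I rule: infinite_finite_induct) (auto intro: L0 Ladd)

lemma Lint: assumes "x \<in> \<Lambda>" "c \<in> \<int>" shows "c *\<^sub>R x \<in> \<Lambda>"
proof -
  have n: "real n *\<^sub>R x \<in> \<Lambda>" for n
    by (induction n) (auto simp: L0 scaleR_left_distrib intro: Ladd assms)
  obtain k where k: "c = of_int k" using assms(2) by (elim Ints_cases)
  show ?thesis
  proof (cases "k \<ge> 0")
    case True
    then have "c = real (nat k)" by (simp add: k)
    then show ?thesis using n by simp
  next
    case False
    then have "c *\<^sub>R x = - (real (nat (- k)) *\<^sub>R x)" by (simp add: k)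
    then show ?thesis using Lminus[OF n] by simp
  qed
qed

lemma Irr_L: "x \<in> Irr \<Longrightarrow> x \<in> \<Lambda>" and Irr_C: "x \<in> Irr \<Longrightarrow> x \<in> C" and Irr_nz: "x \<in> Irr \<Longrightarrow> x \<noteq> 0"
  by (auto simp: Irr_def)

lemma IrrD: "x \<in> Irr \<Longrightarrow> u \<in> \<Lambda> \<Longrightarrow> u \<in> C \<Longrightarrow> v \<in> \<Lambda> \<Longrightarrow> v \<in> C \<Longrightarrow> x = u + v \<Longrightarrow> u = 0 \<or> v = 0"
  unfolding Irr_def by blast

lemma rp_lincomb: "rp (\<Sum>a\<in>A. c a *\<^sub>R a) = (\<lambda>a. if a \<in> A then c a else 0)"
  by (rule representation_lincomb[OF finA indA])

lemma rp_sub: "S \<subseteq> A \<Longrightarrow> rp (\<Sum>a\<in>S. c a *\<^sub>R a) = (\<lambda>a. if a \<in> S then c a else 0)"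
proof -
  assume S: "S \<subseteq> A"
  have "(\<Sum>a\<in>S. c a *\<^sub>R a) = (\<Sum>a\<in>A. (if a \<in> S then c a else 0) *\<^sub>R a)"
    by (rule sum.mono_neutral_cong_left) (use S finA in auto)
  then show ?thesis using S by (auto simp: rp_lincomb fun_eq_iff)
qed

lemma sum_rp: "x \<in> span A \<Longrightarrow> (\<Sum>a\<in>A. rp x a *\<^sub>R a) = x"
  by (rule sum_representation[OF finA indA])

lemma rp_eqI: "x \<in> span A \<Longrightarrow> y \<in> span A \<Longrightarrow> (\<And>a. a \<in> A \<Longrightarrow> rp x a = rp y a) \<Longrightarrow> x = y"
  using sum_rp[of x] sum_rp[of y] by (metis (no_types, lifting) sum.cong)

lemma rp_add: "x \<in> span A \<Longrightarrow> y \<in> span A \<Longrightarrow> rp (x + y) a = rp x a + rp y a"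
  by (simp add: representation_add[OF indA])

lemma rp_nonneg: "x \<in> C \<Longrightarrow> a \<in> A \<Longrightarrow> rp x a \<ge> 0"
  using gen_cone_iff[OF finA indA] by blast

lemma decomp_le:
  assumes "u \<in> C" "v \<in> C" "a \<in> A" shows "rp u a \<le> rp (u + v) a" "rp v a \<le> rp (u + v) a"
  using rp_add[OF subsetD[OF gen_cone_span assms(1)] subsetD[OF gen_cone_span assms(2)]]
    rp_nonneg[OF assms(1,3)] rp_nonneg[OF assms(2,3)] by auto

lemma A_Irr: "A \<subseteq> Irr"
proof
  fix a assume a: "a \<in> A"
  have "u = 0 \<or> v = 0" if u: "u \<in> \<Lambda>" "u \<in> C" and v: "v \<in> \<Lambda>" "v \<in> C" and e: "a = u + v" for u v
  proof -
    have ra: "rp a b = (if b = a then 1 else 0)" for b using representation_basis[OF indA a] by simp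
    have us: "u \<in> span A" and vs: "v \<in> span A" using u v Lspan by auto
    have z: "rp u b = 0" "rp v b = 0" if "b \<in> A" "b \<noteq> a" for b
      using decomp_le[OF u(2) v(2) that(1)] rp_nonneg[OF u(2) that(1)] rp_nonneg[OF v(2) that(1)] ra[of b] that e by auto
    have ue: "u = rp u a *\<^sub>R a" and ve: "v = rp v a *\<^sub>R a"
      using sum_rp[OF us] sum_rp[OF vs] z finA a by (auto simp: sum.remove)
    have "rp u a \<in> \<int>" "rp v a \<in> \<int>" using prim[OF a] ue ve u(1) v(1) by metis+
    then obtain k l where kl: "rp u a = of_int k" "rp v a = of_int l" by (auto elim!: Ints_cases)
    have "rp u a + rp v a = 1" using rp_add[OF us vs, of a] ra[of a] e by simp
    then have "k + l = 1" "k \<ge> 0" "l \<ge> 0"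
      using kl rp_nonneg[OF u(2) a] rp_nonneg[OF v(2) a] by (simp_all flip: of_int_add)
    then have "k = 0 \<or> l = 0" by linarith
    then show ?thesis using ue ve kl by auto
  qed
  moreover have "a \<noteq> 0" using indA a dependent_zero by blast
  ultimately show "a \<in> Irr" using a AL gen_cone_base[OF finA a] by (auto simp: Irr_def)
qed

text \<open>A coordinate of at least 1 would allow the generator \<open>h\<close> to be split off
  from \<open>x\<close>.\<close>

lemma Irr_lt_1:
  assumes x: "x \<in> Irr" and G: "finite G" "independent G" "G \<subseteq> \<Lambda> \<inter> C" "x \<in> gen_cone G" "x \<notin> G" and h: "h \<in> G"
  shows "coord G x h < 1"
proof (rule ccontr)
  assume "\<not> ?thesis"
  then have ge: "coord G x h \<ge> 1" by simp
  have xs: "x \<in> span G" and nn: "\<forall>g\<in>G. coord G x g \<ge> 0" using G gen_cone_iff[OF G(1,2)] by auto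
  have hs: "h \<in> span G" by (rule span_base[OF h])
  have "x - h \<in> gen_cone G"
    unfolding gen_cone_iff[OF G(1,2)]
    using ge nn xs hs representation_basis[OF G(2) h] by (auto simp: span_diff representation_diff[OF G(2) hs xs])
  then have "x - h \<in> C" using gen_cone_subset[of G A] G(3) by auto
  moreover have "x - h \<in> \<Lambda>" using x Irr_L Ldiff G(3) h by auto
  moreover have "h \<noteq> 0" using G(2) h dependent_zero by blast
  ultimately have "x - h = 0" using IrrD[OF x, of h "x - h"] G(3) h by auto
  then show False using G(5) h by simp
qed

lemma finite_Irr: "finite Irr"
proof (rule finite_subset)
  \<comment> \<open>The elements of (1/4)Z in the interval from 0 to below 1, where
    \<open>Irr_lt_1\<close> confines the coordinates.\<close>
  let ?V = "{0, 1/4, 1/2, 3/4 :: real}"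
  show "Irr \<subseteq> A \<union> (\<lambda>f. \<Sum>a\<in>A. f a *\<^sub>R a) ` (A \<rightarrow>\<^sub>E ?V)"
  proof
    fix x assume x: "x \<in> Irr"
    show "x \<in> A \<union> (\<lambda>f. \<Sum>a\<in>A. f a *\<^sub>R a) ` (A \<rightarrow>\<^sub>E ?V)"
    proof (cases "x \<in> A")
      case False
      have "rp x a \<in> ?V" if a: "a \<in> A" for a
      proof -
        have "A \<subseteq> \<Lambda> \<inter> C" using AL gen_cone_base[OF finA] by auto
        then have "rp x a < 1" by (rule Irr_lt_1[OF x finA indA _ Irr_C[OF x] False a])
        moreover have "rp x a \<ge> 0" by (rule rp_nonneg[OF Irr_C[OF x] a])
        moreover obtain n where "4 * rp x a = of_int n" using quarter[OF Irr_L[OF x] a] by (elim Ints_cases)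
        moreover from calculation have "n = 0 \<or> n = 1 \<or> n = 2 \<or> n = 3" by linarith
        ultimately show ?thesis by auto
      qed
      moreover have "x = (\<Sum>a\<in>A. restrict (rp x) A a *\<^sub>R a)"
        using sum_rp[of x] Irr_L[OF x] Lspan by auto
      ultimately show ?thesis by (intro UnI2 image_eqI[of _ _ "restrict (rp x) A"]) auto
    qed simp
  qed
  show "finite (A \<union> (\<lambda>f. \<Sum>a\<in>A. f a *\<^sub>R a) ` (A \<rightarrow>\<^sub>E ?V))"
    using finA by (intro finite_UnI finite_imageI finite_PiE) auto
qed

text \<open>Of two irreducibles on one ray the shorter could be split off from the longer. This
  supplies the hypothesis \<open>prim\<close> of \<open>triang_iterate\<close>.\<close>

lemma Irr_multiple:
  assumes u: "u \<in> Irr" and v: "v \<in> Irr" and e: "u = c *\<^sub>R v" "c \<ge> 0"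
  shows "u = v"
proof (cases "c \<ge> 1")
  case True
  have "u - v = (c - 1) *\<^sub>R v" by (simp add: e scaleR_left_diff_distrib)
  then have "u - v \<in> C" using True gen_cone_scale[OF Irr_C[OF v]] by simp
  then show ?thesis using IrrD[OF u Irr_L[OF v] Irr_C[OF v] Ldiff[OF Irr_L[OF u] Irr_L[OF v]]] Irr_nz[OF v] by auto
next
  case False
  have "v - u = (1 - c) *\<^sub>R v" by (simp add: e scaleR_left_diff_distrib)
  then have "v - u \<in> C" using False gen_cone_scale[OF Irr_C[OF v]] by simp
  then show ?thesis using IrrD[OF v Irr_L[OF u] Irr_C[OF u] Ldiff[OF Irr_L[OF v] Irr_L[OF u]]] Irr_nz[OF u] by auto
qed

lemma Irr_half_coords:
  assumes x: "x \<in> Irr" and G: "finite G" "independent G" "G \<subseteq> Irr" "x \<in> gen_cone G" "x \<notin> G" and h: "h \<in> G"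
    and half: "2 * coord G x h \<in> \<int>"
  shows "coord G x h = 0 \<or> coord G x h = 1/2"
proof -
  have "G \<subseteq> \<Lambda> \<inter> C" using G(3) by (auto simp: Irr_def)
  then have "coord G x h < 1" by (rule Irr_lt_1[OF x G(1,2) _ G(4,5) h])
  moreover have "coord G x h \<ge> 0" using G gen_cone_iff[OF G(1,2)] h by auto
  moreover obtain n where "2 * coord G x h = of_int n" using half by (elim Ints_cases)
  moreover from calculation have "n = 0 \<or> n = 1" by linarith
  ultimately show ?thesis by auto
qed

lemma rational_half_sum:
  assumes G: "finite G" "independent G" "G \<subseteq> \<Lambda>" and x: "x \<in> \<Lambda>" "x \<in> span G" and half: "\<And>g. g \<in> G \<Longrightarrow> 2 * coord G x g \<in> \<int>"
  shows "(\<Sum>g\<in>{g\<in>G. coord G x g \<notin> \<int>}. (1/2) *\<^sub>R g) \<in> \<Lambda>"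
proof -
  let ?F = "{g\<in>G. coord G x g \<notin> \<int>}"
  have "(hsum ?F) = (\<Sum>g\<in>G. (if g \<in> ?F then 1/2 else 0) *\<^sub>R g)"
    by (rule sum.mono_neutral_cong_left) (use G in auto)
  then have "x - (hsum ?F) = (\<Sum>g\<in>G. coord G x g *\<^sub>R g) - (\<Sum>g\<in>G. (if g \<in> ?F then 1/2 else 0) *\<^sub>R g)"
    using sum_representation[OF G(1,2) x(2)] by simp
  also have "\<dots> = (\<Sum>g\<in>G. (coord G x g - (if g \<in> ?F then 1/2 else 0)) *\<^sub>R g)"
    by (simp add: sum_subtractf scaleR_left_diff_distrib)
  also have "\<dots> \<in> \<Lambda>"
    by (intro Lsum Lint) (use G(3) half half_integral_not_int in auto)
  finally have "x - (x - (hsum ?F)) \<in> \<Lambda>" by (rule Ldiff[OF x(1)])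
  then show ?thesis by simp
qed

lemma M_subset: "m \<in> M \<Longrightarrow> m \<subseteq> A" using M by blast
lemma finM: "finite M" by (rule finite_subset[of _ "Pow A"]) (use M_subset finA in auto)

lemma hm_L: "m \<in> M \<Longrightarrow> hm m \<in> \<Lambda>"
  using M[of m] by (auto simp: hm_def)

lemma rp_hm: "m \<in> M \<Longrightarrow> rp (hm m) = (\<lambda>a. if a \<in> m then 1/2 else 0)"
  unfolding hm_def by (rule rp_sub[OF M_subset])

lemma hm_notin_A: "m \<in> M \<Longrightarrow> hm m \<notin> A"
  unfolding hm_def by (rule half_sum_notin[OF finA indA M_subset])

lemma hm_inj: "inj_on hm M"
proof (rule inj_onI)
  fix m m' assume m: "m \<in> M" "m' \<in> M" "hm m = hm m'"
  then have "(\<lambda>a. if a \<in> m then 1/2 else (0::real)) = (\<lambda>a. if a \<in> m' then 1/2 else 0)"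
    using rp_hm by metis
  from fun_cong[OF this] have "a \<in> m \<longleftrightarrow> a \<in> m'" for a by (fastforce split: if_splits)
  then show "m = m'" by blast
qed

lemma half_sum_C: "S \<subseteq> A \<Longrightarrow> (hsum S) \<in> C"
  by (intro gen_cone_sum gen_cone_scale gen_cone_base[OF finA]) auto

text \<open>A summand is supported on the pair with both coordinates between 0 and 1/2. Their sum
  and difference are integers, so both coordinates are 0 or both are 1/2.\<close>

lemma hm_Irr:
  assumes m: "m \<in> M" shows "hm m \<in> Irr"
proof -
  obtain a b where ab: "a \<in> A" "b \<in> A" "a \<noteq> b" "m = {a, b}"
    and pr: "\<And>s t. s *\<^sub>R a + t *\<^sub>R b \<in> \<Lambda> \<Longrightarrow> s + t \<in> \<int> \<and> s - t \<in> \<int>" using M[OF m] by blast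
  have "u = 0 \<or> v = 0" if u: "u \<in> \<Lambda>" "u \<in> C" and v: "v \<in> \<Lambda>" "v \<in> C" and e: "hm m = u + v" for u v
  proof -
    have us: "u \<in> span A" and vs: "v \<in> span A" using u v Lspan by auto
    have le: "rp u c \<le> (if c \<in> m then 1/2 else 0)" if "c \<in> A" for c
      using decomp_le(1)[OF u(2) v(2) that] rp_hm[OF m] e by simp
    have z: "rp u c = 0" if "c \<in> A" "c \<noteq> a" "c \<noteq> b" for c
      using le[OF that(1)] rp_nonneg[OF u(2) that(1)] that ab by simp
    have "(\<Sum>c\<in>A. rp u c *\<^sub>R c) = (\<Sum>c\<in>{a, b}. rp u c *\<^sub>R c)"
      by (rule sum.mono_neutral_right) (use z ab finA in auto)
    then have ue: "u = rp u a *\<^sub>R a + rp u b *\<^sub>R b" using sum_rp[OF us] ab by simp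
    have int: "rp u a + rp u b \<in> \<int>" "rp u a - rp u b \<in> \<int>" using pr ue u(1) by metis+
    have bnd: "0 \<le> rp u a" "rp u a \<le> 1/2" "0 \<le> rp u b" "rp u b \<le> 1/2"
      using le[OF ab(1)] le[OF ab(2)] rp_nonneg[OF u(2)] ab by auto
    obtain k where k: "rp u a - rp u b = of_int k" using int(2) by (elim Ints_cases)
    have "k = 0" using k bnd by linarith
    obtain l where l: "rp u a + rp u b = of_int l" using int(1) by (elim Ints_cases)
    have "l = 0 \<or> l = 1" using l bnd by linarith
    then show ?thesis
    proof
      assume "l = 0"
      then have "u = 0" using l k \<open>k = 0\<close> ue by simp
      then show ?thesis ..
    next
      assume "l = 1"
      then have "rp u a = 1/2" "rp u b = 1/2" using l k \<open>k = 0\<close> by auto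
      then have "u = (1/2) *\<^sub>R a + (1/2) *\<^sub>R b" using ue by metis
      then have "u = hm m" using ab by (simp add: hm_def)
      then show ?thesis using e by simp
    qed
  qed
  moreover have "hm m \<noteq> 0" using fun_cong[OF rp_hm[OF m], of a] ab by (auto simp: representation_zero)
  moreover have "hm m \<in> C" unfolding hm_def by (rule half_sum_C[OF M_subset[OF m]])
  ultimately show ?thesis using hm_L[OF m] by (auto simp: Irr_def)
qed

text \<open>A quarter-odd coordinate in a summand would put a whole matched pair into
  \<open>L\<close>, which minimality reduces to \<open>L\<close> being that pair. Otherwise every
  summand is the half sum of a subset of \<open>L\<close>.\<close>

lemma minimal_half_sum_Irr:
  assumes L: "L \<subseteq> A" "L \<noteq> {}" "(hsum L) \<in> \<Lambda>"
    and min: "\<And>S. S \<subseteq> L \<Longrightarrow> S \<noteq> {} \<Longrightarrow> (hsum S) \<in> \<Lambda> \<Longrightarrow> S = L"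
  shows "(hsum L) \<in> Irr"
proof (cases "\<exists>m\<in>M. m \<subseteq> L")
  case True
  then obtain m where m: "m \<in> M" "m \<subseteq> L" by blast
  moreover have "m \<noteq> {}" using M[OF m(1)] by blast
  ultimately have "m = L" using min[of m] hm_L[OF m(1)] by (simp add: hm_def)
  then show ?thesis using hm_Irr[OF m(1)] by (simp add: hm_def)
next
  case False
  let ?h = "hsum L"
  have rh: "rp ?h = (\<lambda>a. if a \<in> L then 1/2 else 0)" by (rule rp_sub[OF L(1)])
  have "u = 0 \<or> v = 0" if u: "u \<in> \<Lambda>" "u \<in> C" and v: "v \<in> \<Lambda>" "v \<in> C" and e: "?h = u + v" for u v
  proof -
    have us: "u \<in> span A" using u Lspan by auto
    have le: "rp u c \<le> (if c \<in> L then 1/2 else 0)" if "c \<in> A" for c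
      using decomp_le(1)[OF u(2) v(2) that] rh e by simp
    have nq: "\<not> qodd (rp u c)" if c: "c \<in> A" for c
    proof
      assume q: "qodd (rp u c)"
      then obtain m where m: "m \<in> M" "c \<in> m" using qUM[OF u(1) c] by blast
      then have mq: "m \<subseteq> {a. qodd (rp u a)}" using qM[OF u(1) m(1)] q by blast
      have "m \<subseteq> L"
      proof
        fix b assume b: "b \<in> m"
        then have "qodd (rp u b)" "b \<in> A" using mq M_subset[OF m(1)] by auto
        then show "b \<in> L" using le[of b] rp_nonneg[OF u(2), of b] qodd_iff[of 0 0] by (cases "b \<in> L") auto
      qed
      then show False using False m by blast
    qed
    let ?S = "{a\<in>A. rp u a \<noteq> 0}"
    have val: "rp u c = (if c \<in> ?S then 1/2 else 0)" if c: "c \<in> A" for c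
    proof -
      have "2 * rp u c \<in> \<int>" using not_qodd[OF quarter[OF u(1) c]] nq[OF c] by simp
      then obtain n where n: "2 * rp u c = of_int n" by (elim Ints_cases)
      have "rp u c \<le> 1/2" using le[OF c] by (auto split: if_splits)
      then have "n = 0 \<or> n = 1" using n rp_nonneg[OF u(2) c] by linarith
      then show ?thesis using n c by auto
    qed
    have uS: "u = (hsum ?S)"
    proof (rule rp_eqI[OF us])
      show "(hsum ?S) \<in> span A" by (intro span_sum span_scale span_base) simp
      fix a assume a: "a \<in> A"
      have "rp (hsum ?S) = (\<lambda>a. if a \<in> ?S then 1/2 else 0)" by (rule rp_sub) auto
      then show "rp u a = rp (hsum ?S) a" using val[OF a] by simp
    qed
    have "?S \<subseteq> L" using le rp_nonneg[OF u(2)] by (force split: if_splits)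
    then have "?S = {} \<or> ?S = L" using min[of ?S] uS u(1) by metis
    then show ?thesis
    proof
      assume "?S = {}"
      then have "u = (\<Sum>a\<in>{}. (1/2) *\<^sub>R a)" by (subst uS) (simp only:)
      then have "u = 0" by simp
      then show ?thesis ..
    next
      assume "?S = L"
      then have "u = ?h" using uS by simp
      then show ?thesis using e by simp
    qed
  qed
  moreover have "?h \<noteq> 0"
  proof
    assume "?h = 0"
    then have z: "rp ?h a = 0" for a by (simp add: representation_zero)
    obtain a where "a \<in> L" using L(2) by blast
    then show False using z[of a] unfolding rh by simp
  qed
  ultimately show ?thesis using L half_sum_C[OF L(1)] by (auto simp: Irr_def)
qed

end

section \<open>First and second pass: matched pairs and half-integral irreducibles\<close>

context quarter_lattice
begin

text \<open>The evenness of the coordinates of \<open>A\<close> at new generators makes every vector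
  with half-integral coordinates over \<open>A\<close> integral there, whether or not it lies in
  \<open>\<Lambda>\<close>.\<close>

definition half_cell :: "(real^'n) set \<Rightarrow> bool" where
  "half_cell G \<longleftrightarrow> G \<subseteq> Irr \<inter> Half \<and> half_integral_on Half A G \<and>
     (\<forall>a\<in>A. \<forall>h\<in>G. coord G a h \<in> \<int> \<and> (h \<notin> A \<longrightarrow> coord G a h / 2 \<in> \<int>))"

lemma Half_L: "x \<in> Half \<Longrightarrow> x \<in> \<Lambda>"
  by (simp add: Half_def)

lemma A_Half: "A \<subseteq> Half"
  using AL by (auto simp: Half_def representation_basis[OF indA])

lemma hm_Half: "m \<in> M \<Longrightarrow> hm m \<in> Half"
  using hm_L by (auto simp: Half_def rp_hm)

lemma half_cell_A: "half_cell A"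
  using A_Irr A_Half unfolding half_cell_def half_integral_on_def
  by (auto simp: Half_def representation_basis[OF indA])

lemma half_cell_coords:
  assumes G: "finite G" "independent G" "half_cell G" and u: "u \<in> Irr" "u \<in> Half" "u \<in> gen_cone G" "u \<notin> G" and h: "h \<in> G"
  shows "coord G u h = 0 \<or> coord G u h = 1/2" "h \<notin> A \<Longrightarrow> coord G u h = 0"
proof -
  have hi: "2 * coord G u h \<in> \<int>" "h \<notin> A \<Longrightarrow> coord G u h \<in> \<int>"
    using G(3) u(2) h unfolding half_cell_def half_integral_on_def by auto
  have "G \<subseteq> Irr" using G(3) by (auto simp: half_cell_def)
  then show 1: "coord G u h = 0 \<or> coord G u h = 1/2"
    by (rule Irr_half_coords[OF u(1) G(1,2) _ u(3,4) h hi(1)])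
  show "coord G u h = 0" if "h \<notin> A" using 1 hi(2)[OF that] half_not_int by metis
qed

text \<open>The point \<open>u\<close> has coordinate 0 at all generators outside \<open>A\<close>,
  so only a vector of \<open>A\<close> can be removed. A vector of \<open>A\<close> gets twice its
  old integer coordinate at \<open>u\<close>, which is even.\<close>

lemma half_cell_stellar:
  assumes G: "finite G" "independent G" "span G = span A" "half_cell G"
    and u: "u \<in> Irr" "u \<in> Half" "u \<in> gen_cone G" "u \<notin> G" and g: "g \<in> G" "coord G u g > 0"
  shows "half_cell (insert u (G - {g}))" "g \<in> A"
proof -
  note co = half_cell_coords[OF G(1,2,4) u]
  show gA: "g \<in> A" using co(2)[OF g(1)] g(2) by auto
  have ug: "coord G u g = 1/2" using co(1)[OF g(1)] g(2) by auto
  have us: "u \<in> span G" by (rule subsetD[OF gen_cone_span u(3)])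
  have Hs: "Half \<subseteq> span G" using G(3) Lspan by (auto simp: Half_def)
  show "half_cell (insert u (G - {g}))" unfolding half_cell_def
  proof (intro conjI ballI impI)
    show "insert u (G - {g}) \<subseteq> Irr \<inter> Half" using G(4) u by (auto simp: half_cell_def)
    show "half_integral_on Half A (insert u (G - {g}))"
      by (rule half_integral_on_stellar[OF G(1,2) Hs _ u(2,4) co(1) g]) (use G(4) in \<open>simp add: half_cell_def\<close>)
    fix a h assume a: "a \<in> A" and h: "h \<in> insert u (G - {g})"
    have as: "a \<in> span G" using a Hs A_Half by auto
    note r = representation_stellar[OF G(1,2) us u(4) g as]
    have old: "coord G a k \<in> \<int>" "k \<notin> A \<Longrightarrow> coord G a k / 2 \<in> \<int>" if "k \<in> G" for k
      using G(4) a that by (auto simp: half_cell_def)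
    have "coord (insert u (G - {g})) a h \<in> \<int> \<and> (h \<notin> A \<longrightarrow> coord (insert u (G - {g})) a h / 2 \<in> \<int>)"
    proof (cases "h = u")
      case True
      have e: "coord (insert u (G - {g})) a u = 2 * coord G a g" by (simp add: r(1) ug)
      have "2 * coord G a g \<in> \<int>" by (rule Ints_mult[OF Ints_numeral old(1)[OF g(1)]])
      then show ?thesis using True e old(1)[OF g(1)] by simp
    next
      case False
      then have hG: "h \<in> G - {g}" using h by simp
      have e: "coord (insert u (G - {g})) a h = coord G a h - 2 * coord G a g * coord G u h"
        by (simp add: r(2)[OF hG] ug)
      show ?thesis
      proof (cases "coord G u h = 0")
        case True
        then show ?thesis using e old hG by simp
      next
        case False
        then have "h \<in> A" and uh: "coord G u h = 1/2" using co hG by auto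
        moreover have "coord (insert u (G - {g})) a h = coord G a h - coord G a g"
          unfolding e uh by simp
        ultimately show ?thesis using old(1) hG g(1) by auto
      qed
    qed
    then show "coord (insert u (G - {g})) a h \<in> \<int>"
      "h \<notin> A \<Longrightarrow> coord (insert u (G - {g})) a h / 2 \<in> \<int>" by auto
  qed
qed

text \<open>The invariant keeps all untreated pairs inside every cell. Thus the next half sum lies
  in every cell, the generator it replaces belongs to its own pair, and disjointness protects the
  other pairs.\<close>

lemma matched_triangulation:
  "\<exists>T. triang A T \<and> (\<forall>G\<in>T. half_cell G \<and> hm ` M \<subseteq> G)"
proof -
  have "\<exists>T. triang A T \<and> (\<forall>G\<in>T. half_cell G \<and> hm ` N \<subseteq> G \<and> \<Union>(M - N) \<subseteq> G)" if "N \<subseteq> M" for N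
    using finite_subset[OF that finM] that
  proof (induction N rule: finite_induct)
    case empty
    have "\<Union>M \<subseteq> A" using M_subset by blast
    then show ?case using triang_initial[OF finA indA] half_cell_A by (intro exI[of _ "{A}"]) simp
  next
    case (insert m N)
    then obtain T where T: "triang A T" "\<And>G. G \<in> T \<Longrightarrow> half_cell G \<and> hm ` N \<subseteq> G \<and> \<Union>(M - N) \<subseteq> G" by auto
    have m: "m \<in> M" and NM: "N \<subseteq> M" and mN: "m \<notin> N" using insert by auto
    have mI: "hm m \<in> Irr" by (rule hm_Irr[OF m])
    obtain T' where T': "triang A T'" "\<And>G'. G' \<in> T' \<Longrightarrow> (G' \<in> T \<and> hm m \<notin> gen_cone G') \<or>
       (\<exists>G\<in>T. \<exists>g\<in>G. hm m \<in> gen_cone G \<and> coord G (hm m) g > 0 \<and> G' = insert (hm m) (G - {g}))"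
      by (rule triang_stellar[OF T(1) Irr_C[OF mI] Irr_nz[OF mI]]) (rule that)
    have "half_cell G' \<and> hm ` (insert m N) \<subseteq> G' \<and> \<Union>(M - insert m N) \<subseteq> G'" if G': "G' \<in> T'" for G'
      using T'(2)[OF G']
    proof
      \<comment> \<open>This case cannot occur: the cell contains the pair and hence its half
        sum.\<close>
      assume h: "G' \<in> T \<and> hm m \<notin> gen_cone G'"
      have "finite G'" using T(1) h by (auto simp: triang_def)
      moreover have "m \<subseteq> G'" using T(2)[of G'] h m mN by auto
      ultimately have "hm m \<in> gen_cone G'" unfolding hm_def
        by (intro gen_cone_sum gen_cone_scale gen_cone_base) auto
      then show ?thesis using h by simp
    next
      assume "\<exists>G\<in>T. \<exists>g\<in>G. hm m \<in> gen_cone G \<and> coord G (hm m) g > 0 \<and> G' = insert (hm m) (G - {g})"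
      then obtain G g where GT: "G \<in> T" and g: "g \<in> G" "coord G (hm m) g > 0"
        and uG: "hm m \<in> gen_cone G" and G'e: "G' = insert (hm m) (G - {g})" by blast
      have fi: "finite G" "independent G" "span G = span A" using T(1) GT by (auto simp: triang_def)
      have hc: "half_cell G" and hN: "hm ` N \<subseteq> G" and UN: "\<Union>(M - N) \<subseteq> G" using T(2)[OF GT] by auto
      have mG: "m \<subseteq> G" using UN m mN by blast
      have nG: "hm m \<notin> G" unfolding hm_def by (rule half_sum_notin[OF fi(1,2) mG])
      note st = half_cell_stellar[OF fi hc mI hm_Half[OF m] uG nG g]
      have "hm m = (\<Sum>h\<in>G. (if h \<in> m then 1/2 else 0) *\<^sub>R h)"
        unfolding hm_def by (rule sum.mono_neutral_cong_left) (use fi mG in auto)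
      then have "coord G (hm m) = (\<lambda>h. if h \<in> G then (if h \<in> m then 1/2 else 0) else 0)"
        using representation_lincomb[OF fi(1,2), of "\<lambda>h. if h \<in> m then 1/2 else 0"] by simp
      then have gm: "g \<in> m" using g by (auto split: if_splits)
      have "\<Union>(M - insert m N) \<subseteq> G - {g}"
      proof
        fix x assume "x \<in> \<Union>(M - insert m N)"
        then obtain m' where m': "m' \<in> M" "m' \<notin> N" "m' \<noteq> m" "x \<in> m'" by auto
        then have "m' \<inter> m = {}" using disjM m by simp
        then show "x \<in> G - {g}" using m' gm UN by blast
      qed
      moreover have "hm ` N \<subseteq> G - {g}" using hN st(2) hm_notin_A NM by blast
      ultimately show ?thesis using st(1) G'e by auto
    qed
    then show ?case using T'(1) by blast
  qed
  from this[of M] show ?thesis by simp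
qed

definition full_half_cell :: "(real^'n) set \<Rightarrow> bool" where
  "full_half_cell B \<longleftrightarrow> finite B \<and> independent B \<and> span B = span A \<and> half_cell B \<and> hm ` M \<subseteq> B \<and>
     (\<forall>x\<in>Irr \<inter> Half. x \<in> gen_cone B \<longrightarrow> x \<in> B)"

lemma half_triangulation: "\<exists>T. triang A T \<and> (\<forall>G\<in>T. full_half_cell G)"
proof -
  obtain T0 where T0: "triang A T0" "\<And>G. G \<in> T0 \<Longrightarrow> half_cell G \<and> hm ` M \<subseteq> G"
    using matched_triangulation by blast
  obtain T where T: "triang A T" "\<And>G. G \<in> T \<Longrightarrow> half_cell G \<and> hm ` M \<subseteq> G"
    "\<And>G u. G \<in> T \<Longrightarrow> u \<in> Irr \<inter> Half \<Longrightarrow> u \<in> gen_cone G \<Longrightarrow> u \<in> G"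
  proof (rule triang_iterate[of "Irr \<inter> Half" A T0 "\<lambda>G. half_cell G \<and> hm ` M \<subseteq> G"])
    show "finite (Irr \<inter> Half)" using finite_Irr by simp
    show "u \<in> C \<and> u \<noteq> 0" if "u \<in> Irr \<inter> Half" for u using that Irr_C Irr_nz by blast
    show "u = v" if "u \<in> Irr \<inter> Half" "v \<in> Irr \<inter> Half" "u = c *\<^sub>R v" "c \<ge> 0" for u v c
      using Irr_multiple[of u v c] that by blast
    show "half_cell (insert u (G - {g})) \<and> hm ` M \<subseteq> insert u (G - {g})"
      if "half_cell G \<and> hm ` M \<subseteq> G" "finite G" "independent G" "span G = span A" "u \<in> Irr \<inter> Half" "u \<in> gen_cone G"
        "u \<notin> G" "g \<in> G" "coord G u g > 0" for G u g
    proof -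
      have u: "u \<in> Irr" "u \<in> Half" and hc: "half_cell G" using that by auto
      note st = half_cell_stellar[OF that(2,3,4) hc u that(6-9)]
      \<comment> \<open>Removed generators lie in \<open>A\<close>, so the half sums of pairs
        survive the second pass.\<close>
      have "g \<notin> hm ` M" using st(2) hm_notin_A by blast
      then show ?thesis using st(1) that(1) by auto
    qed
  qed (use T0 in auto)
  have "full_half_cell G" if "G \<in> T" for G
    using T that unfolding full_half_cell_def triang_def by auto
  then show ?thesis using T(1) by blast
qed

lemma minimal_nonempty_subset:
  assumes "finite F" "F \<noteq> {}" "P F"
  obtains L where "L \<subseteq> F" "L \<noteq> {}" "P L" "\<And>S. S \<subseteq> L \<Longrightarrow> S \<noteq> {} \<Longrightarrow> P S \<Longrightarrow> S = L"
proof -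
  let ?Q = "\<lambda>L. L \<subseteq> F \<and> L \<noteq> {} \<and> P L"
  have "?Q F" using assms by simp
  from ex_has_least_nat[of ?Q, OF this, of card] obtain L where L: "?Q L" "\<And>S. ?Q S \<Longrightarrow> card L \<le> card S" by blast
  show thesis
  proof (rule that[of L])
    fix S assume S: "S \<subseteq> L" "S \<noteq> {}" "P S"
    then have "card L \<le> card S" using L by blast
    moreover have "finite L" using L(1) assms(1) finite_subset by blast
    ultimately show "S = L" using S(1) by (intro card_seteq)
  qed (use L(1) in auto)
qed

text \<open>Fractional coordinates occur only at generators in \<open>A\<close>. A minimal half sum
  among these is irreducible, so the second pass made it a generator of the cell, which a half sum
  of generators cannot be.\<close>

lemma full_half_cell_integral:
  assumes B: "full_half_cell B" and x: "x \<in> Half" and g: "g \<in> B"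
  shows "coord B x g \<in> \<int>"
proof (rule ccontr)
  assume ng: "coord B x g \<notin> \<int>"
  have fi: "finite B" "independent B" "span B = span A" and hc: "half_cell B" using B by (auto simp: full_half_cell_def)
  have BI: "B \<subseteq> Irr" using hc by (auto simp: half_cell_def)
  have BL: "B \<subseteq> \<Lambda>" using BI Irr_L by blast
  have hi: "2 * coord B x h \<in> \<int>" "h \<notin> A \<Longrightarrow> coord B x h \<in> \<int>" if "h \<in> B" for h
    using hc x that unfolding half_cell_def half_integral_on_def by auto
  define F where "F = {h\<in>B. coord B x h \<notin> \<int>}"
  have xs: "x \<in> span B" using x Lspan fi(3) by (auto simp: Half_def)
  have FL: "(hsum F) \<in> \<Lambda>" unfolding F_def
    by (rule rational_half_sum[OF fi(1,2) BL Half_L[OF x] xs hi(1)])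
  have FA: "F \<subseteq> A" using hi(2) by (auto simp: F_def)
  obtain L where L: "L \<subseteq> F" "L \<noteq> {}" "(hsum L) \<in> \<Lambda>"
    and min: "\<And>S. S \<subseteq> L \<Longrightarrow> S \<noteq> {} \<Longrightarrow> (hsum S) \<in> \<Lambda> \<Longrightarrow> S = L"
  proof (rule minimal_nonempty_subset[of F "\<lambda>S. (hsum S) \<in> \<Lambda>"])
    show "finite F" using fi by (simp add: F_def)
    show "F \<noteq> {}" using g ng by (auto simp: F_def)
  qed (use FL in auto)
  let ?h = "hsum L"
  have LA: "L \<subseteq> A" and LB: "L \<subseteq> B" using L(1) FA by (auto simp: F_def)
  have "?h \<in> Irr" by (rule minimal_half_sum_Irr[OF LA L(2,3) min])
  moreover have "?h \<in> Half" using L(3) by (simp add: Half_def rp_sub[OF LA])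
  moreover have "?h \<in> gen_cone B" using LB by (intro gen_cone_sum gen_cone_scale gen_cone_base[OF fi(1)]) auto
  ultimately have "?h \<in> B" using B by (auto simp: full_half_cell_def)
  then show False using half_sum_notin[OF fi(1,2) LB] by simp
qed

section \<open>Third pass: the remaining irreducibles\<close>

lemma rp_quarter_half:
  assumes "K \<subseteq> A" "P \<subseteq> A"
  shows "rp ((\<Sum>a\<in>K. (1/4) *\<^sub>R a) + (hsum P))
    = (\<lambda>a. (if a \<in> K then 1/4 else 0) + (if a \<in> P then 1/2 else 0))"
proof -
  have "(\<Sum>a\<in>K. (1/4::real) *\<^sub>R a) \<in> span A" "(hsum P) \<in> span A"
    using assms by (intro span_sum span_scale span_base; auto)+
  then show ?thesis
    using rp_sub[OF assms(1), of "\<lambda>_. 1/4"] rp_sub[OF assms(2), of "\<lambda>_. 1/2"] by (auto simp: rp_add)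
qed

text \<open>Half of the half sum of a pair is a quarter of its sum. Disjoint pairs, injectivity of
  \<open>hm\<close> and \<open>hm_notin_A\<close> make all these sums add up without
  overlap.\<close>

lemma matched_half_sum:
  assumes K: "K = \<Union>{m\<in>M. m \<subseteq> K}" and P: "P \<subseteq> A" "finite P"
  shows "(\<Sum>h\<in>hm ` {m\<in>M. m \<subseteq> K} \<union> P. (1/2) *\<^sub>R h) = (\<Sum>a\<in>K. (1/4) *\<^sub>R a) + (hsum P)"
proof -
  let ?N = "{m\<in>M. m \<subseteq> K}"
  have "(\<Sum>h\<in>hm ` ?N \<union> P. (1/2::real) *\<^sub>R h) = (\<Sum>h\<in>hm ` ?N. (1/2) *\<^sub>R h) + (hsum P)"
    by (rule sum.union_disjoint) (use finM P hm_notin_A in auto)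
  also have "(\<Sum>h\<in>hm ` ?N. (1/2::real) *\<^sub>R h) = (\<Sum>m\<in>?N. (1/2) *\<^sub>R hm m)"
    using inj_on_subset[OF hm_inj, of ?N] by (subst sum.reindex) auto
  also have "\<dots> = (\<Sum>m\<in>?N. \<Sum>a\<in>m. (1/4) *\<^sub>R a)"
    by (rule sum.cong) (auto simp: hm_def scaleR_sum_right)
  also have "\<dots> = (\<Sum>a\<in>\<Union>?N. (1/4) *\<^sub>R a)"
  proof (rule sum.Union_disjoint[symmetric, unfolded o_def])
    show "\<forall>m\<in>?N. finite m" using finite_subset[OF M_subset finA] by simp
  qed (use disjM in auto)
  finally show ?thesis using K by simp
qed

lemma qodd_set_matched:
  assumes "x \<in> \<Lambda>" and K: "K = {a\<in>A. qodd (rp x a)}"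
  shows "K = \<Union>{m\<in>M. m \<subseteq> K}"
proof
  show "K \<subseteq> \<Union>{m\<in>M. m \<subseteq> K}"
  proof
    fix a assume a: "a \<in> K"
    then obtain m where m: "m \<in> M" "a \<in> m" using qUM[OF assms(1)] K by blast
    then have "m \<subseteq> K" using qM[OF assms(1) m(1)] M_subset[OF m(1)] a K by auto
    then show "a \<in> \<Union>{m\<in>M. m \<subseteq> K}" using m by blast
  qed
qed auto

text \<open>Compare with \<open>1/4\<close> times the sum over \<open>K\<close>, which is half the sum of the matched half sums in \<open>K\<close>:
  the difference is half-integral in \<open>A\<close>, hence integral at the generators outside \<open>A\<close>.\<close>

lemma cell_half_sum_shape:
  assumes B: "full_half_cell B" and F: "F \<subseteq> B" and q: "(hsum F) \<in> \<Lambda>"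
    and K: "K = {a\<in>A. qodd (rp (hsum F) a)}"
  shows "F = hm ` {m\<in>M. m \<subseteq> K} \<union> (F \<inter> A)"
proof -
  let ?q = "hsum F" and ?N = "hm ` {m\<in>M. m \<subseteq> K}"
  have fi: "finite B" "independent B" "span B = span A" and hc: "half_cell B" and hB: "hm ` M \<subseteq> B"
    using B by (auto simp: full_half_cell_def)
  have KA: "K \<subseteq> A" using K by auto
  have NB: "?N \<subseteq> B" using hB by blast
  let ?c = "hsum ?N"
  have ce: "?c = (\<Sum>a\<in>K. (1/4) *\<^sub>R a)"
    using matched_half_sum[OF qodd_set_matched[OF q K], of "{}"] by simp
  have halfrep: "coord B (hsum S) = (\<lambda>h. if h \<in> S then 1/2 else 0)" if S: "S \<subseteq> B" for S
  proof -
    have "(hsum S) = (\<Sum>h\<in>B. (if h \<in> S then 1/2 else 0) *\<^sub>R h)"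
      by (rule sum.mono_neutral_cong_left) (use fi S in auto)
    then show ?thesis using S by (auto simp: representation_lincomb[OF fi(1,2)] fun_eq_iff)
  qed
  \<comment> \<open>This vector need not lie in \<open>\<Lambda>\<close>, so its integrality at new
    generators rests on the evenness clause of \<open>half_cell\<close>: a half-integer times an
    even integer.\<close>
  define d where "d = ?q - ?c"
  have qs: "?q \<in> span A" using q Lspan by auto
  have cs: "?c \<in> span A" unfolding ce using KA by (intro span_sum span_scale span_base) auto
  have ds: "d \<in> span A" unfolding d_def using qs cs by (rule span_diff)
  have rc: "rp ?c = (\<lambda>a. if a \<in> K then 1/4 else 0)" unfolding ce by (rule rp_sub[OF KA])
  have rd: "2 * rp d a \<in> \<int>" if a: "a \<in> A" for a
  proof -
    have e: "rp d a = rp ?q a - rp ?c a" unfolding d_def using representation_diff[OF indA cs qs] by simp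
    have c4: "4 * rp ?c a \<in> \<int>" "qodd (rp ?c a) \<longleftrightarrow> a \<in> K"
      unfolding rc using qodd_iff[of "1/4" 1] qodd_iff[of 0 0] by auto
    have q4: "4 * rp ?q a \<in> \<int>" by (rule quarter[OF q a])
    have "\<not> qodd (rp d a)" unfolding e qodd_diff[OF q4 c4(1)] c4(2) using K a by simp
    moreover have "4 * rp d a \<in> \<int>" unfolding e right_diff_distrib by (rule Ints_diff[OF q4 c4(1)])
    ultimately show ?thesis using not_qodd by blast
  qed
  have intd: "coord B d h \<in> \<int>" if h: "h \<in> B" "h \<notin> A" for h
  proof -
    have asp: "\<And>a. a \<in> A \<Longrightarrow> a \<in> span B" using fi(3) span_base by blast
    have "coord B d h = coord B (\<Sum>a\<in>A. rp d a *\<^sub>R a) h" using sum_rp[OF ds] by simp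
    also have "\<dots> = (\<Sum>a\<in>A. coord B (rp d a *\<^sub>R a) h)"
      using representation_sum[OF fi(2), of A "\<lambda>a. rp d a *\<^sub>R a"] asp by (simp add: span_scale)
    also have "\<dots> = (\<Sum>a\<in>A. (2 * rp d a) * (coord B a h / 2))"
      by (rule sum.cong) (use representation_scale[OF fi(2) asp] in auto)
    also have "\<dots> \<in> \<int>"
    proof (rule Ints_sum)
      fix a assume a: "a \<in> A"
      have "coord B a h / 2 \<in> \<int>" using hc h a by (simp add: half_cell_def)
      then show "(2 * rp d a) * (coord B a h / 2) \<in> \<int>" by (rule Ints_mult[OF rd[OF a]])
    qed
    finally show ?thesis .
  qed
  have "h \<in> F \<longleftrightarrow> h \<in> ?N" if h: "h \<in> B" "h \<notin> A" for h
  proof -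
    have "?q \<in> span B" "?c \<in> span B" using qs cs fi(3) by auto
    then have "coord B d h = (if h \<in> F then 1/2 else 0) - (if h \<in> ?N then 1/2 else 0)"
      unfolding d_def by (simp add: representation_diff[OF fi(2)] halfrep[OF F] halfrep[OF NB])
    then show ?thesis using intd[OF h] half_not_int Ints_minus[of "-(1/2) :: real"] by (auto split: if_splits)
  qed
  moreover have "?N \<inter> A = {}" using hm_notin_A by blast
  ultimately show ?thesis using F NB by blast
qed

text \<open>Any summand has the same shape as \<open>q\<close>, a quarter of a union of pairs plus
  half of a subset of \<open>P\<close>. It is therefore the half sum of a subset of
  \<open>F\<close>, and minimality leaves only 0 and \<open>q\<close>.\<close>

lemma minimal_cell_half_sum_Irr:
  assumes B: "full_half_cell B" and F: "F \<subseteq> B" "F \<noteq> {}" "(hsum F) \<in> \<Lambda>"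
    and min: "\<And>S. S \<subseteq> F \<Longrightarrow> S \<noteq> {} \<Longrightarrow> (hsum S) \<in> \<Lambda> \<Longrightarrow> S = F"
  shows "(hsum F) \<in> Irr"
proof -
  define q where "q = (hsum F)"
  define K where "K = {a\<in>A. qodd (rp q a)}"
  define P where "P = F \<inter> A"
  have fi: "finite B" "independent B" "span B = span A" and hB: "hm ` M \<subseteq> B" and hc: "half_cell B"
    using B by (auto simp: full_half_cell_def)
  have qL: "q \<in> \<Lambda>" using F by (simp add: q_def)
  have KA: "K \<subseteq> A" and PA: "P \<subseteq> A" and PB: "P \<subseteq> B" using F by (auto simp: K_def P_def)
  have finP: "finite P" using finA by (simp add: P_def)
  have Fe: "F = hm ` {m\<in>M. m \<subseteq> K} \<union> P"
    unfolding P_def by (rule cell_half_sum_shape[OF B F(1,3)]) (simp add: K_def q_def)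
  have KM: "K = \<Union>{m\<in>M. m \<subseteq> K}" by (rule qodd_set_matched[OF qL K_def])
  have qe: "q = (\<Sum>a\<in>K. (1/4) *\<^sub>R a) + (hsum P)"
    unfolding q_def by (subst Fe) (rule matched_half_sum[OF KM PA finP])
  have rq: "rp q = (\<lambda>a. (if a \<in> K then 1/4 else 0) + (if a \<in> P then 1/2 else 0))"
    unfolding qe by (rule rp_quarter_half[OF KA PA])
  \<comment> \<open>If both vectors of a pair were generators, its half sum, an element of
    \<open>Half\<close>, would have coordinate 1/2 in a full half cell.\<close>
  have noM: "\<not> m \<subseteq> P" if m: "m \<in> M" for m
  proof
    assume mP: "m \<subseteq> P"
    then have mB: "m \<subseteq> B" using PB by auto
    obtain a where a: "a \<in> m" using M[OF m] by blast
    have "hm m = (\<Sum>h\<in>B. (if h \<in> m then 1/2 else 0) *\<^sub>R h)"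
      unfolding hm_def by (rule sum.mono_neutral_cong_left) (use fi mB in auto)
    then have e: "coord B (hm m) a = 1/2"
      using a mB by (auto simp: representation_lincomb[OF fi(1,2)])
    have "coord B (hm m) a \<in> \<int>"
      by (rule full_half_cell_integral[OF B hm_Half[OF m]]) (use a mB in auto)
    then show False unfolding e by simp
  qed
  have "u = 0 \<or> v = 0" if u: "u \<in> \<Lambda>" "u \<in> C" and v: "v \<in> \<Lambda>" "v \<in> C" and e: "q = u + v" for u v
  proof -
    define K1 where "K1 = {a\<in>A. qodd (rp u a)}"
    define K2 where "K2 = {a\<in>A. qodd (rp v a)}"
    have us: "u \<in> span A" and vs: "v \<in> span A" using u v Lspan by auto
    have K1M: "K1 = \<Union>{m\<in>M. m \<subseteq> K1}" by (rule qodd_set_matched[OF u(1) K1_def])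
    have add: "rp q a = rp u a + rp v a" for a unfolding e by (rule rp_add[OF us vs])
    have xor: "a \<in> K \<longleftrightarrow> (a \<in> K1) \<noteq> (a \<in> K2)" if "a \<in> A" for a
      using qodd_add[OF quarter[OF u(1) that] quarter[OF v(1) that]] that by (simp add: K_def K1_def K2_def add)
    have pos: "rp w a \<ge> 1/4" if "w \<in> \<Lambda>" "w \<in> C" "a \<in> A" "qodd (rp w a)" for w a
    proof -
      from that(4) obtain n where n: "odd n" "4 * rp w a = of_int n" by (auto simp: qodd_def)
      have "n \<noteq> 0" using n(1) by auto
      moreover have "n \<ge> 0" using n(2) rp_nonneg[OF that(2,3)] by linarith
      ultimately show ?thesis using n(2) by linarith
    qed
    \<comment> \<open>A pair quarter-odd in both summands has coordinates at least 1/4 in each,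
      while their sum is not quarter-odd; so \<open>q\<close> has coordinate 1/2 there and the pair
      lies in \<open>P\<close>, against \<open>noM\<close>.\<close>
    have disj: "K1 \<inter> K2 = {}"
    proof (rule ccontr)
      assume "K1 \<inter> K2 \<noteq> {}"
      then obtain a where a: "a \<in> K1" "a \<in> K2" by blast
      then obtain m where m: "m \<in> M" "a \<in> m" "m \<subseteq> K1" using K1M by blast
      have m2: "m \<subseteq> K2"
        using qM[OF v(1) m(1)] a(2) m(2) M_subset[OF m(1)] by (auto simp: K2_def)
      have "m \<subseteq> P"
      proof
        fix b assume b: "b \<in> m"
        have bA: "b \<in> A" using b M_subset[OF m(1)] by auto
        have "b \<notin> K" using xor[OF bA] b m(3) m2 by auto
        moreover have "rp u b \<ge> 1/4" by (rule pos[OF u bA]) (use b m(3) in \<open>auto simp: K1_def\<close>)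
        moreover have "rp v b \<ge> 1/4" by (rule pos[OF v bA]) (use b m2 in \<open>auto simp: K2_def\<close>)
        ultimately show "b \<in> P" using add[of b] fun_cong[OF rq, of b] by (auto split: if_splits)
      qed
      then show False using noM[OF m(1)] by simp
    qed
    have K1K: "K1 \<subseteq> K" using xor disj by (auto simp: K1_def)
    \<comment> \<open>The coordinates of \<open>u\<close> are among 0, 1/4, 1/2, 3/4;
      \<open>S\<close> marks those that contain a half, and \<open>K1\<close> those that contain a
      quarter.\<close>
    define S where "S = {a\<in>A. rp u a \<ge> 1/2}"
    have SP: "S \<subseteq> P"
    proof
      fix a assume "a \<in> S"
      then have "a \<in> A" "rp q a \<ge> 1/2" using decomp_le(1)[OF u(2) v(2), of a] e by (auto simp: S_def)
      then show "a \<in> P" using fun_cong[OF rq, of a] by (auto split: if_splits)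
    qed
    have val: "rp u a = (if a \<in> K1 then 1/4 else 0) + (if a \<in> S then 1/2 else 0)" if a: "a \<in> A" for a
    proof -
      obtain n where n: "4 * rp u a = of_int n" using quarter[OF u(1) a] by (elim Ints_cases)
      have "rp u a \<le> rp q a" using decomp_le(1)[OF u(2) v(2) a] e by simp
      also have "\<dots> \<le> 3/4" unfolding rq by auto
      finally have "n \<le> 3" using n by linarith
      moreover have "n \<ge> 0" using n rp_nonneg[OF u(2) a] by linarith
      ultimately have "n \<in> {0, 1, 2, 3}" by auto
      moreover have "a \<in> K1 \<longleftrightarrow> odd n" using qodd_iff[OF n] a by (simp add: K1_def)
      ultimately show ?thesis using n a by (auto simp: S_def)
    qed
    have K1A: "K1 \<subseteq> A" and SA: "S \<subseteq> A" by (auto simp: K1_def S_def)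
    have ue: "u = (\<Sum>a\<in>K1. (1/4) *\<^sub>R a) + (hsum S)"
    proof (rule rp_eqI[OF us])
      show "(\<Sum>a\<in>K1. (1/4) *\<^sub>R a) + (hsum S) \<in> span A"
        using K1A SA by (intro span_add span_sum span_scale span_base) auto
    qed (simp add: val rp_quarter_half[OF K1A SA])
    define F' where "F' = hm ` {m\<in>M. m \<subseteq> K1} \<union> S"
    have "finite S" using finA by (simp add: S_def)
    then have uF: "(hsum F') = u"
      unfolding F'_def ue by (rule matched_half_sum[OF K1M SA])
    have "F' \<subseteq> F"
    proof -
      have "hm ` {m\<in>M. m \<subseteq> K1} \<subseteq> hm ` {m\<in>M. m \<subseteq> K}" using K1K by blast
      then show ?thesis unfolding F'_def Fe using SP by blast
    qed
    then have "F' = {} \<or> F' = F" using min[of F'] uF u(1) by auto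
    then show ?thesis
    proof
      assume "F' = {}"
      then show ?thesis using uF by simp
    next
      assume "F' = F"
      then have "u = q" using uF by (simp add: q_def)
      then show ?thesis using e by simp
    qed
  qed
  moreover have "q \<noteq> 0"
  proof
    assume "q = 0"
    then have "\<And>a. rp q a = 0" by (simp add: representation_zero)
    then have "K = {}" "P = {}" unfolding rq using KA PA by (force split: if_splits)+
    then have "{m\<in>M. m \<subseteq> K} = {}" using M by blast
    then show False using Fe F(2) \<open>P = {}\<close> by simp
  qed
  moreover have "q \<in> C"
  proof -
    have "B \<subseteq> C" using hc Irr_C by (auto simp: half_cell_def)
    then show ?thesis unfolding q_def using F(1) by (intro gen_cone_sum gen_cone_scale) auto
  qed
  ultimately show ?thesis using qL unfolding Irr_def q_def by blast
qed

text \<open>A full half cell is a lattice basis of \<open>Half\<close>. Hence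
  \<open>\<Lambda>\<close> is half-integral over it, and the third pass runs like the second with
  the cell \<open>B\<close> in the role of \<open>A\<close>.\<close>

theorem unimodular_Irr_triangulation:
  "\<exists>T. triang A T \<and> (\<forall>G\<in>T. G \<subseteq> Irr \<and> (\<forall>x\<in>\<Lambda>. \<forall>g\<in>G. coord G x g \<in> \<int>))"
proof -
  obtain T0 where T0: "triang A T0" "\<And>G. G \<in> T0 \<Longrightarrow> full_half_cell G" using half_triangulation by blast
  define Q where "Q G \<longleftrightarrow> G \<subseteq> Irr \<and> (\<exists>B. full_half_cell B \<and> half_integral_on \<Lambda> B G)" for G
  obtain T where T: "triang A T" "\<And>G. G \<in> T \<Longrightarrow> Q G" "\<And>G u. G \<in> T \<Longrightarrow> u \<in> Irr \<Longrightarrow> u \<in> gen_cone G \<Longrightarrow> u \<in> G"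
  proof (rule triang_iterate[of Irr A T0 Q])
    show "finite Irr" by (rule finite_Irr)
    show "triang A T0" by (rule T0(1))
    show "Q G" if G: "G \<in> T0" for G
    proof -
      note B = T0(2)[OF G]
      have fi: "independent G" "span G = span A" using B by (auto simp: full_half_cell_def)
      have "2 * coord G x g \<in> \<int>" if x: "x \<in> \<Lambda>" and g: "g \<in> G" for x g
      proof -
        have xs: "x \<in> span A" using x Lspan by auto
        \<comment> \<open>Doubling quarter-integral coordinates makes them half-integral.\<close>
        have "2 *\<^sub>R x \<in> Half"
          using Lint[OF x, of 2] quarter[OF x] representation_scale[OF indA xs, of 2] by (simp add: Half_def)
        from full_half_cell_integral[OF B this g] show ?thesis
          using representation_scale[OF fi(1), of x 2] xs fi(2) by simp
      qed
      then have "half_integral_on \<Lambda> G G" by (simp add: half_integral_on_def)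
      then show ?thesis using B unfolding Q_def by (auto simp: full_half_cell_def half_cell_def)
    qed
    show "u \<in> C \<and> u \<noteq> 0" if "u \<in> Irr" for u using that Irr_C Irr_nz by blast
    show "u = v" if "u \<in> Irr" "v \<in> Irr" "u = c *\<^sub>R v" "c \<ge> 0" for u v c by (rule Irr_multiple[OF that])
    show "Q (insert u (G - {g}))"
      if "Q G" "finite G" "independent G" "span G = span A" "u \<in> Irr" "u \<in> gen_cone G" "u \<notin> G" "g \<in> G" "coord G u g > 0"
      for G u g
    proof -
      from that(1) obtain B where B: "full_half_cell B" "half_integral_on \<Lambda> B G" and GI: "G \<subseteq> Irr" by (auto simp: Q_def)
      have Ls: "\<Lambda> \<subseteq> span G" using Lspan that(4) by simp
      have "half_integral_on \<Lambda> B (insert u (G - {g}))"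
      proof (rule half_integral_on_stellar[OF that(2,3) Ls B(2) Irr_L[OF that(5)] that(7) _ that(8,9)])
        fix h assume h: "h \<in> G"
        have "2 * coord G u h \<in> \<int>" using B(2) Irr_L[OF that(5)] h by (simp add: half_integral_on_def)
        then show "coord G u h = 0 \<or> coord G u h = 1/2"
          by (rule Irr_half_coords[OF that(5,2,3) GI that(6,7) h])
      qed
      then show ?thesis using B(1) GI that(5) by (auto simp: Q_def)
    qed
  qed (rule that)
  have "coord G x g \<in> \<int>" if G: "G \<in> T" and x: "x \<in> \<Lambda>" and g: "g \<in> G" for G x g
  proof (rule ccontr)
    assume ng: "coord G x g \<notin> \<int>"
    obtain B where B: "full_half_cell B" "half_integral_on \<Lambda> B G" and GI: "G \<subseteq> Irr" using T(2)[OF G] by (auto simp: Q_def)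
    have fi: "finite G" "independent G" "span G = span A" using T(1) G by (auto simp: triang_def)
    have GL: "G \<subseteq> \<Lambda>" using GI Irr_L by blast
    have hi: "2 * coord G x h \<in> \<int>" "h \<notin> B \<Longrightarrow> coord G x h \<in> \<int>" if "h \<in> G" for h
      using B(2) x that by (auto simp: half_integral_on_def)
    define F where "F = {h\<in>G. coord G x h \<notin> \<int>}"
    have xs: "x \<in> span G" using x Lspan fi(3) by auto
    have FL: "(hsum F) \<in> \<Lambda>" unfolding F_def
      by (rule rational_half_sum[OF fi(1,2) GL x xs hi(1)])
    have FB: "F \<subseteq> B" using hi(2) by (auto simp: F_def)
    obtain L where L: "L \<subseteq> F" "L \<noteq> {}" "(hsum L) \<in> \<Lambda>"
      and min: "\<And>S. S \<subseteq> L \<Longrightarrow> S \<noteq> {} \<Longrightarrow> (hsum S) \<in> \<Lambda> \<Longrightarrow> S = L"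
    proof (rule minimal_nonempty_subset[of F "\<lambda>S. (hsum S) \<in> \<Lambda>"])
      show "finite F" using fi by (simp add: F_def)
      show "F \<noteq> {}" using g ng by (auto simp: F_def)
    qed (use FL in auto)
    let ?h = "hsum L"
    have LB: "L \<subseteq> B" and LG: "L \<subseteq> G" using L(1) FB by (auto simp: F_def)
    have "?h \<in> Irr" by (rule minimal_cell_half_sum_Irr[OF B(1) LB L(2,3) min])
    moreover have "?h \<in> gen_cone G" using LG by (intro gen_cone_sum gen_cone_scale gen_cone_base[OF fi(1)]) auto
    ultimately have "?h \<in> G" using T(3)[OF G] by blast
    then show False using half_sum_notin[OF fi(1,2) LG] by simp
  qed
  then show ?thesis using T(1,2) unfolding Q_def by blast
qed

end

section \<open>Totally equimodular sets\<close>

text \<open>A separating set of least size has, for each of its columns, a vector vanishing on all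
  its other columns. Scaled, these vectors form a basis dual to the columns, which fixes the number
  of columns.\<close>

lemma separating_columns:
  fixes S :: "(real^'n) set" and N :: "'n set"
  assumes S: "finite S" "independent S"
    and N: "\<And>w. w \<in> span S \<Longrightarrow> (\<forall>j\<in>N. w $ j = 0) \<Longrightarrow> w = 0"
  obtains B where "B \<subseteq> N" "card B = card S" "\<And>w. w \<in> span S \<Longrightarrow> (\<forall>j\<in>B. w $ j = 0) \<Longrightarrow> w = 0"
    "\<And>j. j \<in> B \<Longrightarrow> \<exists>w\<in>span S. \<forall>k\<in>B. w $ k = (if k = j then 1 else 0)"
proof -
  let ?P = "\<lambda>B. B \<subseteq> N \<and> (\<forall>w\<in>span S. (\<forall>j\<in>B. w $ j = 0) \<longrightarrow> w = 0)"
  have "?P N" using N by simp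
  from ex_has_least_nat[of ?P, OF this, of card] obtain B where B: "?P B" "\<And>B'. ?P B' \<Longrightarrow> card B \<le> card B'" by blast
  have dual: "\<exists>w\<in>span S. \<forall>k\<in>B. w $ k = (if k = j then 1 else 0)" if j: "j \<in> B" for j
  proof -
    have "\<not> ?P (B - {j})"
    proof
      assume "?P (B - {j})"
      then have "card B \<le> card (B - {j})" by (rule B(2))
      then show False using card_Diff1_less[of B j] j by simp
    qed
    then obtain w where w: "w \<in> span S" "\<forall>k\<in>B - {j}. w $ k = 0" "w \<noteq> 0" using B(1) by blast
    have "w $ j \<noteq> 0" using B(1) w by blast
    then have "\<forall>k\<in>B. ((1 / w $ j) *\<^sub>R w) $ k = (if k = j then 1 else 0)" using w(2) by auto
    then show ?thesis using span_scale[OF w(1)] by blast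
  qed
  then obtain E where E: "\<And>j. j \<in> B \<Longrightarrow> E j \<in> span S" "\<And>j k. j \<in> B \<Longrightarrow> k \<in> B \<Longrightarrow> E j $ k = (if k = j then 1 else 0)"
    by metis
  have inj: "inj_on E B"
  proof (rule inj_onI)
    fix j k assume "j \<in> B" "k \<in> B" "E j = E k"
    then show "j = k" using E(2)[of j j] E(2)[of k j] by (auto split: if_splits)
  qed
  have exp: "w = (\<Sum>j\<in>B. w $ j *\<^sub>R E j)" if w: "w \<in> span S" for w
  proof -
    have "w - (\<Sum>j\<in>B. w $ j *\<^sub>R E j) \<in> span S" by (intro span_diff w span_sum span_scale E(1))
    moreover have "(w - (\<Sum>j\<in>B. w $ j *\<^sub>R E j)) $ k = 0" if k: "k \<in> B" for k
    proof -
      have "(\<Sum>j\<in>B. w $ j * E j $ k) = (\<Sum>j\<in>B. if j = k then w $ j else 0)"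
        by (rule sum.cong) (use E(2) k in auto)
      then show ?thesis using k by simp
    qed
    ultimately have "w - (\<Sum>j\<in>B. w $ j *\<^sub>R E j) = 0" using B(1) by blast
    then show ?thesis by simp
  qed
  have "independent (E ` B)"
  proof (rule independent_if_scalars_zero)
    fix f x assume z: "(\<Sum>x\<in>E ` B. f x *\<^sub>R x) = 0" and x: "x \<in> E ` B"
    obtain k where k: "k \<in> B" "x = E k" using x by blast
    have "(\<Sum>j\<in>B. f (E j) *\<^sub>R E j) = 0" using z inj by (simp add: sum.reindex)
    then have "(\<Sum>j\<in>B. f (E j) *\<^sub>R E j) $ k = 0" by simp
    moreover have "(\<Sum>j\<in>B. f (E j) * E j $ k) = (\<Sum>j\<in>B. if j = k then f (E j) else 0)"
      by (rule sum.cong) (use E(2) k in auto)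
    ultimately show "f x = 0" using k by simp
  qed simp
  moreover have "span S \<subseteq> span (E ` B)"
  proof
    fix w assume "w \<in> span S"
    from exp[OF this] show "w \<in> span (E ` B)" by (metis (no_types, lifting) imageI span_base span_scale span_sum)
  qed
  moreover have "E ` B \<subseteq> span S" using E(1) by blast
  ultimately have "card (E ` B) = dim (span S)" by (intro basis_card_eq_dim) auto
  then have "card B = card S" using card_image[OF inj] S by (simp add: dim_eq_card_independent)
  then show thesis using that B(1) dual by blast
qed

lemma range_lc_span: "finite S \<Longrightarrow> range (\<lambda>x. lc S x (\<lambda>a. a)) = span S"
  by (auto simp: lc_def span_finite)

lemma separating_minor_nonzero:
  fixes rs :: "(real^'n) list"
  assumes rs: "distinct rs" "set rs = S" and S: "independent S" and cs: "length cs = length rs"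
    and sep: "\<And>w. w \<in> span S \<Longrightarrow> (\<forall>j\<in>set cs. w $ j = 0) \<Longrightarrow> w = 0"
  shows "minor rs cs \<noteq> 0"
proof (rule minor_nonzero[OF refl])
  fix x assume z: "\<And>j. j < length rs \<Longrightarrow> (\<Sum>i<length rs. x i * rs ! i $ cs ! j) = 0"
  let ?w = "\<Sum>i<length rs. x i *\<^sub>R rs ! i"
  have "?w \<in> span S" by (intro span_sum span_scale span_base) (use rs in auto)
  moreover have "?w $ c = 0" if "c \<in> set cs" for c
  proof -
    obtain j where "j < length rs" "c = cs ! j" using \<open>c \<in> set cs\<close> cs by (auto simp: in_set_conv_nth)
    then show ?thesis using z by simp
  qed
  ultimately have "?w = 0" using sep by blast
  have bij: "bij_betw (\<lambda>i. rs ! i) {..<length rs} S" using bij_betw_nth[OF rs(1)] rs(2) by blast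
  let ?y = "\<lambda>a. x (the_inv_into {..<length rs} (\<lambda>i. rs ! i) a)"
  have inv: "?y (rs ! i) = x i" if "i < length rs" for i
    using the_inv_into_f_f[OF bij_betw_imp_inj_on[OF bij], of i] that by simp
  have "(\<Sum>a\<in>S. ?y a *\<^sub>R a) = (\<Sum>i<length rs. ?y (rs ! i) *\<^sub>R rs ! i)"
    by (rule sum.reindex_bij_betw[OF bij, symmetric])
  also have "\<dots> = ?w" by (rule sum.cong) (simp_all add: inv)
  finally have z0: "(\<Sum>a\<in>S. ?y a *\<^sub>R a) = 0" using \<open>?w = 0\<close> by simp
  have "finite S" using rs by auto
  note y0 = independentD[OF S this order_refl z0]
  show "\<forall>i<length rs. x i = 0"
  proof (intro allI impI)
    fix i assume i: "i < length rs"
    then have "rs ! i \<in> S" using rs(2) nth_mem by blast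
    from y0[OF this] show "x i = 0" by (simp only: inv[OF i])
  qed
qed

text \<open>For an elementary \<open>w\<close>, the columns off its support together with one column
  \<open>a\<close> of the support separate the span. A column basis chosen there contains
  \<open>a\<close>, and \<open>a\<close> may be exchanged for any other \<open>b\<close> in the
  support. Both minors are nonzero, hence of equal size, and \<open>minor_exchange\<close> carries
  this over to the entries of \<open>w\<close>.\<close>

lemma te_set_regular:
  fixes A :: "(real^'n) set"
  assumes te: "te_set A" and S: "S \<subseteq> A"
  shows "regular_space (span S)"
  unfolding regular_space_def
proof (intro ballI impI)
  fix w assume w: "w \<in> span S" "w \<noteq> 0" and el: "\<forall>w'\<in>span S. w' \<noteq> 0 \<longrightarrow> supp w' \<subseteq> supp w \<longrightarrow> supp w' = supp w"
  have A: "finite A" "independent A" using te by (auto simp: te_set_def pm1_indep_def)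
  have fS: "finite S" and iS: "independent S" using A S finite_subset independent_mono by blast+
  have eq: "\<bar>w $ a\<bar> = \<bar>w $ b\<bar>" if a: "w $ a \<noteq> 0" and b: "w $ b \<noteq> 0" for a b
  proof (cases "a = b")
    case ab: False
    have sepN: "w' = 0" if w': "w' \<in> span S" "\<forall>j\<in>insert a (- supp w). w' $ j = 0" for w'
    proof (rule ccontr)
      assume "w' \<noteq> 0"
      moreover have "supp w' \<subseteq> supp w" using w'(2) by (auto simp: supp_def)
      ultimately have "supp w' = supp w" using el w'(1) by blast
      then show False using w'(2) a by (auto simp: supp_def)
    qed
    obtain B where B: "B \<subseteq> insert a (- supp w)" "card B = card S"
      "\<And>w. w \<in> span S \<Longrightarrow> (\<forall>j\<in>B. w $ j = 0) \<Longrightarrow> w = 0"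
    proof (rule separating_columns[OF fS iS])
      show "w' = 0" if "w' \<in> span S" "\<forall>j\<in>insert a (- supp w). w' $ j = 0" for w' by (rule sepN[OF that])
    qed (rule that)
    have aB: "a \<in> B"
    proof (rule ccontr)
      assume "a \<notin> B"
      then have "\<forall>j\<in>B. w $ j = 0" using B(1) by (auto simp: supp_def)
      then show False using B(3) w by blast
    qed
    define B0 where "B0 = B - {a}"
    have w0: "w $ j = 0" if "j \<in> B0" for j using that B(1) by (auto simp: B0_def supp_def)
    \<comment> \<open>Subtracting the multiple of \<open>w\<close> that cancels entry
      \<open>a\<close> gives a vector vanishing on \<open>B\<close>, so \<open>w'\<close> is a
      multiple of \<open>w\<close>, and the entry at \<open>b\<close> makes it 0.\<close>
    have sepb: "w' = 0" if w': "w' \<in> span S" "\<forall>j\<in>insert b B0. w' $ j = 0" for w'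
    proof -
      let ?v = "w' - (w' $ a / w $ a) *\<^sub>R w"
      have "?v \<in> span S" by (intro span_diff span_scale w w')
      moreover have "\<forall>j\<in>B. ?v $ j = 0"
      proof
        fix j assume "j \<in> B"
        then show "?v $ j = 0" using w'(2) w0[of j] a by (cases "j = a") (auto simp: B0_def)
      qed
      ultimately have "?v = 0" by (rule B(3))
      then have e: "w' = (w' $ a / w $ a) *\<^sub>R w" by simp
      have "(w' $ a / w $ a) * w $ b = 0" using arg_cong[OF e, of "\<lambda>v. v $ b"] w'(2) by simp
      then have "w' $ a / w $ a = 0" using b by simp
      then show ?thesis using e by (metis scaleR_zero_left)
    qed
    obtain cs where cs: "set cs = B0" "distinct cs" using finite_distinct_list[of B0] by auto
    obtain rs where rs: "set rs = S" "distinct rs" using finite_distinct_list[OF fS] by auto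
    have len: "length rs = Suc (length cs)"
    proof -
      have "card B = Suc (card B0)" using card_Suc_Diff1[OF _ aB] by (simp add: B0_def)
      then show ?thesis using B(2) distinct_card[OF cs(2)] distinct_card[OF rs(2)] cs rs by simp
    qed
    have anB: "a \<notin> B0" and bnB: "b \<notin> B0" using w0 b by (auto simp: B0_def)
    have "set (cs @ [a]) = B" using cs aB by (auto simp: B0_def)
    then have nza: "minor rs (cs @ [a]) \<noteq> 0"
      using B(3) len by (intro separating_minor_nonzero[OF rs(2,1) iS]) auto
    have nzb: "minor rs (cs @ [b]) \<noteq> 0"
      using sepb len cs by (intro separating_minor_nonzero[OF rs(2,1) iS]) auto
    have "length (cs @ [c]) = card S" for c using distinct_card[OF rs(2)] rs(1) len by simp
    then have "\<bar>minor rs (cs @ [a])\<bar> \<in> max_minors S" "\<bar>minor rs (cs @ [b])\<bar> \<in> max_minors S"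
      unfolding max_minors_def using rs cs anB bnB by (auto intro!: exI[of _ rs] exI[of _ "cs @ [_]"])
    then have meq: "\<bar>minor rs (cs @ [a])\<bar> = \<bar>minor rs (cs @ [b])\<bar>"
      using te S nza nzb unfolding te_set_def by auto
    have "w \<in> range (\<lambda>x. lc S x (\<lambda>a. a))" using w(1) range_lc_span[OF fS] by simp
    then obtain y where y: "w = (\<Sum>a\<in>S. y a *\<^sub>R a)" by (auto simp: lc_def)
    have bij: "bij_betw (\<lambda>i. rs ! i) {..<length rs} S" using bij_betw_nth[OF rs(2)] rs(1) by blast
    have "w = (\<Sum>i<length rs. y (rs ! i) *\<^sub>R rs ! i)"
      unfolding y by (rule sum.reindex_bij_betw[OF bij, symmetric])
    then have wc: "w $ c = (\<Sum>i<Suc (length cs). y (rs ! i) * rs ! i $ c)" for c by (simp add: len)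
    have "w $ a * minor rs (cs @ [b]) = w $ b * minor rs (cs @ [a])"
      by (rule minor_exchange[OF len refl wc _ nza]) (use w0 cs in simp)
    then have "\<bar>w $ a\<bar> * \<bar>minor rs (cs @ [b])\<bar> = \<bar>w $ b\<bar> * \<bar>minor rs (cs @ [a])\<bar>" by (simp flip: abs_mult)
    then show ?thesis using meq nzb by simp
  qed simp
  obtain a where a: "w $ a \<noteq> 0" using w(2) by (auto simp: vec_eq_iff)
  have "w $ j \<in> {0, w $ a, - (w $ a)}" for j using eq[OF a, of j] by (cases "w $ j = 0") (auto simp: abs_eq_iff)
  then show "\<exists>r. \<forall>j. w $ j \<in> {0, r, -r}" by blast
qed

section \<open>From te-sets to lattice points, unimodularity and the Hilbert basis\<close>

lemma te_set_TE:
  fixes A :: "(real^'n) set"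
  assumes te: "te_set A"
  shows "TE A (\<lambda>a. a)"
proof -
  have A: "finite A" "independent A" and pm: "\<forall>a\<in>A. pm1_vec a" using te by (auto simp: te_set_def pm1_indep_def)
  have ind: "x i = 0" if "lc A x (\<lambda>a. a) = 0" "i \<in> A" for x i
    using independentD[OF A(2,1) order_refl _ that(2), of x] that(1) by (simp add: lc_def)
  have "regular_space (range (\<lambda>x. lc S x (\<lambda>a. a)))" if "S \<subseteq> A" for S
    using te_set_regular[OF te that] range_lc_span[OF finite_subset[OF that A(1)]] by simp
  then show ?thesis unfolding TE_def using A(1) pm ind by blast
qed

lemma te_set_quarter_lattice:
  fixes A :: "(real^'n) set"
  assumes te: "te_set A"
  shows "\<exists>M. quarter_lattice A {x \<in> span A. int_vec x} M"
proof -
  let ?L = "{x \<in> span A. int_vec x}"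
  note TE = te_set_TE[OF te]
  have A: "finite A" "independent A" and pm: "\<And>a. a \<in> A \<Longrightarrow> pm1_vec a" using te by (auto simp: te_set_def pm1_indep_def)
  have lcr: "int_vec (lc A (coord A x) (\<lambda>a. a))" if "x \<in> ?L" for x
    using that sum_representation[OF A] by (simp add: lc_def)
  obtain M where M: "\<And>m. m \<in> M \<Longrightarrow> \<exists>a\<in>A. \<exists>b\<in>A. a \<noteq> b \<and> m = {a, b} \<and> supp a = supp b"
    "\<And>m m'. m \<in> M \<Longrightarrow> m' \<in> M \<Longrightarrow> m \<noteq> m' \<Longrightarrow> m \<inter> m' = {}"
    "\<And>x m. int_vec (lc A x (\<lambda>a. a)) \<Longrightarrow> m \<in> M \<Longrightarrow> m \<subseteq> {i. qodd (x i)} \<or> m \<inter> {i. qodd (x i)} = {}"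
    "\<And>x i. int_vec (lc A x (\<lambda>a. a)) \<Longrightarrow> i \<in> A \<Longrightarrow> qodd (x i) \<Longrightarrow> i \<in> \<Union>M"
    by (rule TE_qodd_matching[OF TE]) (rule that)
  have "quarter_lattice A ?L M"
  proof
    show "finite A" "independent A" by (rule A)+
    show "?L \<subseteq> span A" by auto
    show "A \<subseteq> ?L" using pm pm1_int_vec span_base by auto
    show "0 \<in> ?L" by (simp add: span_zero int_vec_0)
    show "x + y \<in> ?L" if "x \<in> ?L" "y \<in> ?L" for x y
      using that by (simp add: span_add int_vec_add)
    show "- x \<in> ?L" if "x \<in> ?L" for x
      using that int_vec_diff[OF int_vec_0, of x] by (simp add: span_neg)
    show "4 * coord A x a \<in> \<int>" if "x \<in> ?L" "a \<in> A" for x a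
      by (rule TE_quarter[OF TE lcr[OF that(1)] that(2)])
    show "t \<in> \<int>" if "a \<in> A" "t *\<^sub>R a \<in> ?L" for a t
      by (rule pm1_integral_multiple[OF TE that(1)]) (use that(2) in simp)
    show "m \<inter> m' = {}" if "m \<in> M" "m' \<in> M" "m \<noteq> m'" for m m' by (rule M(2)[OF that])
    show "m \<subseteq> {a. qodd (coord A x a)} \<or> m \<inter> {a. qodd (coord A x a)} = {}"
      if "x \<in> ?L" "m \<in> M" for x m by (rule M(3)[OF lcr[OF that(1)] that(2)])
    show "a \<in> \<Union>M" if "x \<in> ?L" "a \<in> A" "qodd (coord A x a)" for x a
      by (rule M(4)[OF lcr[OF that(1)] that(2,3)])
    show "\<exists>a\<in>A. \<exists>b\<in>A. a \<noteq> b \<and> m = {a, b} \<and> (1/2) *\<^sub>R a + (1/2) *\<^sub>R b \<in> ?L \<and>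
        (\<forall>s t. s *\<^sub>R a + t *\<^sub>R b \<in> ?L \<longrightarrow> s + t \<in> \<int> \<and> s - t \<in> \<int>)" if "m \<in> M" for m
    proof -
      from M(1)[OF that] obtain a b where ab: "a \<in> A" "b \<in> A" "a \<noteq> b" "m = {a, b}" "supp a = supp b" by blast
      have "(1/2) *\<^sub>R a + (1/2) *\<^sub>R b \<in> span A" using ab by (intro span_add span_scale span_base)
      moreover have "int_vec ((1/2) *\<^sub>R a + (1/2) *\<^sub>R b)" by (rule same_supp_half_sum[OF pm pm]) (use ab in auto)
      moreover have "s + t \<in> \<int> \<and> s - t \<in> \<int>" if "s *\<^sub>R a + t *\<^sub>R b \<in> ?L" for s t
        using same_supp_pair[OF TE ab(1,2,3,5), of s t] that by simp
      ultimately show ?thesis using ab by blast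
    qed
  qed
  then show ?thesis ..
qed

text \<open>The vectors dual to a column basis are integral by \<open>regular_integral\<close>.
  Their coordinates over the lattice basis \<open>G\<close> therefore form an integral inverse of
  the corresponding submatrix.\<close>

lemma lattice_basis_minor:
  fixes G :: "(real^'n) set"
  assumes reg: "regular_space (span G)" and G: "finite G" "independent G" "\<And>g. g \<in> G \<Longrightarrow> int_vec g"
    and basis: "\<And>x g. x \<in> span G \<Longrightarrow> int_vec x \<Longrightarrow> g \<in> G \<Longrightarrow> coord G x g \<in> \<int>"
  shows "1 \<in> max_minors G"
proof -
  obtain B where B: "card B = card G" "\<And>w. w \<in> span G \<Longrightarrow> (\<forall>j\<in>B. w $ j = 0) \<Longrightarrow> w = 0"
    "\<And>j. j \<in> B \<Longrightarrow> \<exists>w\<in>span G. \<forall>k\<in>B. w $ k = (if k = j then 1 else 0)"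
  proof (rule separating_columns[OF G(1,2), of UNIV])
    show "w = 0" if "\<forall>j\<in>UNIV. w $ j = 0" for w :: "real^'n" using that by (simp add: vec_eq_iff)
  qed (rule that)
  obtain E where E: "\<And>j. j \<in> B \<Longrightarrow> E j \<in> span G" "\<And>j k. j \<in> B \<Longrightarrow> k \<in> B \<Longrightarrow> E j $ k = (if k = j then 1 else 0)"
    using B(3) by metis
  have Eint: "int_vec (E j)" if "j \<in> B" for j
    by (rule regular_integral[OF reg subspace_span B(2) E(1)[OF that]]) (use E(2)[OF that] in auto)
  obtain cs where cs: "set cs = B" "distinct cs" using finite_distinct_list[of B] by auto
  obtain rs where rs: "set rs = G" "distinct rs" using finite_distinct_list[OF G(1)] by auto
  have len: "length cs = length rs" using distinct_card[OF cs(2)] distinct_card[OF rs(2)] cs(1) rs(1) B(1) by simp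
  have bij: "bij_betw (\<lambda>i. rs ! i) {..<length rs} G" using bij_betw_nth[OF rs(2)] rs(1) by blast
  have "\<bar>minor rs cs\<bar> = 1"
  proof (rule minor_integral_inverse[OF refl, of _ _ "\<lambda>l i. coord G (E (cs ! l)) (rs ! i)"])
    fix i j assume "i < length rs" "j < length rs"
    then show "rs ! i $ cs ! j \<in> \<int>" using G(3) rs(1) nth_mem[of i rs] by (auto simp: int_vec_def)
  next
    fix l i assume l: "l < length rs" "i < length rs"
    have "cs ! l \<in> B" "rs ! i \<in> G" using l len cs(1) rs(1) nth_mem by metis+
    then show "coord G (E (cs ! l)) (rs ! i) \<in> \<int>" by (intro basis E(1) Eint)
  next
    fix l j assume lj: "l < length rs" "j < length rs"
    have cB: "cs ! l \<in> B" "cs ! j \<in> B" using lj len cs(1) nth_mem by metis+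
    have "(\<Sum>i<length rs. coord G (E (cs ! l)) (rs ! i) * rs ! i $ cs ! j)
        = (\<Sum>g\<in>G. coord G (E (cs ! l)) g * g $ cs ! j)"
      by (rule sum.reindex_bij_betw[OF bij])
    also have "\<dots> = (\<Sum>g\<in>G. coord G (E (cs ! l)) g *\<^sub>R g) $ cs ! j" by simp
    also have "\<dots> = E (cs ! l) $ cs ! j" by (simp only: sum_representation[OF G(1,2) E(1)[OF cB(1)]])
    also have "\<dots> = (if j = l then 1 else 0)"
      using E(2)[OF cB] nth_eq_iff_index_eq[OF cs(2), of j l] lj len by simp
    finally show "(\<Sum>i<length rs. coord G (E (cs ! l)) (rs ! i) * rs ! i $ cs ! j) = (if j = l then 1 else 0)" .
  qed
  then show ?thesis unfolding max_minors_def using rs cs len distinct_card[OF rs(2)] by force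
qed

text \<open>One copy of a nonzero term is split off; irreducibility forces the rest to vanish, so
  \<open>u\<close> is that term.\<close>

lemma (in quarter_lattice) Irr_in_generating_set:
  assumes u: "u \<in> Irr" and F: "finite F" "F \<subseteq> \<Lambda> \<inter> C" and e: "u = (\<Sum>h\<in>F. real (c h) *\<^sub>R h)"
  shows "u \<in> F"
proof -
  obtain h where h: "h \<in> F" "real (c h) *\<^sub>R h \<noteq> 0"
    using Irr_nz[OF u] e sum.neutral[of F "\<lambda>h. real (c h) *\<^sub>R h"] by metis
  let ?r = "real (c h - 1) *\<^sub>R h + (\<Sum>k\<in>F - {h}. real (c k) *\<^sub>R k)"
  have c1: "real (c h) = 1 + real (c h - 1)" using h by (cases "c h") auto
  have "u = real (c h) *\<^sub>R h + (\<Sum>k\<in>F - {h}. real (c k) *\<^sub>R k)"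
    unfolding e by (rule sum.remove[OF F(1) h(1)])
  also have "real (c h) *\<^sub>R h = h + real (c h - 1) *\<^sub>R h" by (subst c1) (simp add: scaleR_left_distrib)
  finally have eq: "u = h + ?r" by (simp add: add.assoc)
  have "?r \<in> \<Lambda>" by (intro Ladd Lsum Lint) (use F h in auto)
  moreover have "?r \<in> C" by (intro gen_cone_add gen_cone_sum gen_cone_scale) (use F h in auto)
  ultimately have "h = 0 \<or> ?r = 0" using IrrD[OF u _ _ _ _ eq] F h by auto
  then have "?r = 0" using h by auto
  then show ?thesis using eq h by simp
qed

theorem mainTheorem19:
  fixes A :: "(real^'n) set"
  assumes "te_set A"
    and "\<forall>B. B \<subseteq> A \<and> thick_te_interlace B \<longrightarrow> card B \<le> 6"
  shows "\<exists>T. cone_triangulation (gen_cone A) T \<and> regular_triangulation (gen_cone A) T \<and>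
             unimodular_triangulation (gen_cone A) T \<and> hilbert_triangulation (gen_cone A) T"
proof -
  let ?L = "{x \<in> span A. int_vec x}"
  obtain M where "quarter_lattice A ?L M" using te_set_quarter_lattice[OF assms(1)] by blast
  then interpret quarter_lattice A ?L M .
  obtain T where T: "triang A T" "\<And>G. G \<in> T \<Longrightarrow> G \<subseteq> Irr"
    "\<And>G x g. G \<in> T \<Longrightarrow> x \<in> ?L \<Longrightarrow> g \<in> G \<Longrightarrow> coord G x g \<in> \<int>"
    using unimodular_Irr_triangulation by blast
  have G: "finite G" "independent G" "span G = span A" if "G \<in> T" for G
    using T(1) that by (auto simp: triang_def)
  have cone: "cone_triangulation (gen_cone A) T" by (rule triang_cone_triangulation[OF T(1)])
  have reg: "regular_space (span A)" by (rule te_set_regular[OF assms(1) order_refl])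
  have "unimodular_triangulation (gen_cone A) T"
    unfolding unimodular_triangulation_def
  proof (intro conjI ballI cone)
    show int: "int_vec g" if "G \<in> T" "g \<in> G" for G g
      using Irr_L[OF subsetD[OF T(2)[OF that(1)] that(2)]] by simp
    fix G assume GT: "G \<in> T"
    have "1 \<in> max_minors G"
      proof (rule lattice_basis_minor)
      show "regular_space (span G)" using reg G(3)[OF GT] by simp
      show "finite G" "independent G" using G[OF GT] by auto
      show "int_vec g" if "g \<in> G" for g by (rule int[OF GT that])
      show "coord G x g \<in> \<int>" if "x \<in> span G" "int_vec x" "g \<in> G" for x g
        by (rule T(3)[OF GT _ that(3)]) (use that G(3)[OF GT] in simp)
    qed
    \<comment> \<open>One maximal minor of absolute value 1 already settles the gcd.\<close>
    then have "(1::int) \<in> (\<lambda>m. \<lfloor>m\<rfloor>) ` max_minors G" by (rule rev_image_eqI) simp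
    then show "Gcd ((\<lambda>m. \<lfloor>m\<rfloor>) ` max_minors G) = 1" by (intro Gcd_eq_1_I[of 1]) auto
  qed
  moreover have "hilbert_triangulation (gen_cone A) T"
    unfolding hilbert_triangulation_def hilbert_basis_def
  proof (intro conjI cone exI[of _ Irr] ballI allI impI)
    show "G \<subseteq> Irr" if "G \<in> T" for G by (rule T(2)[OF that])
    show "int_generating (gen_cone A) Irr"
      unfolding int_generating_def
    proof (intro conjI ballI impI)
      show "Irr \<subseteq> gen_cone A \<inter> {x. int_vec x}"
      proof
        fix x assume "x \<in> Irr"
        from Irr_L[OF this] Irr_C[OF this] show "x \<in> gen_cone A \<inter> {x. int_vec x}" by simp
      qed
      fix x assume x: "x \<in> gen_cone A" "int_vec x"
      obtain G where GT: "G \<in> T" and xG: "x \<in> gen_cone G" using T(1) x(1) by (auto simp: triang_def)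
      note GG = G[OF GT]
      have xs: "x \<in> span G" and pos: "\<And>g. g \<in> G \<Longrightarrow> coord G x g \<ge> 0" using xG gen_cone_iff[OF GG(1,2)] by auto
      \<comment> \<open>Coordinates in a cell containing \<open>x\<close> are nonnegative integers
        and serve as the multiplicities.\<close>
      have "real (nat \<lfloor>coord G x g\<rfloor>) = coord G x g" if "g \<in> G" for g
      proof -
        have "coord G x g \<in> \<int>" using T(3)[OF GT _ that] xs x(2) GG(3) by simp
        then show ?thesis using pos[OF that] by (elim Ints_cases) simp
      qed
      then have "x = (\<Sum>g\<in>G. real (nat \<lfloor>coord G x g\<rfloor>) *\<^sub>R g)"
        using sum_representation[OF GG(1,2) xs] by simp
      then show "\<exists>F c. finite F \<and> F \<subseteq> Irr \<and> x = (\<Sum>h\<in>F. real (c h :: nat) *\<^sub>R h)"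
        using GG(1) T(2)[OF GT] by (intro exI[of _ G] exI[of _ "\<lambda>g. nat \<lfloor>coord G x g\<rfloor>"]) simp
    qed
    fix H assume H: "H \<subset> Irr"
    then obtain u where u: "u \<in> Irr" "u \<notin> H" by blast
    show "\<not> int_generating (gen_cone A) H"
    proof
      assume "int_generating (gen_cone A) H"
      obtain F and c :: "real^'n \<Rightarrow> nat" where F: "finite F" "F \<subseteq> H" "u = (\<Sum>h\<in>F. real (c h) *\<^sub>R h)"
      proof -
        have "u \<in> gen_cone A" "int_vec u" using Irr_C[OF u(1)] Irr_L[OF u(1)] by simp_all
        with \<open>int_generating (gen_cone A) H\<close> have "\<exists>F c. finite F \<and> F \<subseteq> H \<and> u = (\<Sum>h\<in>F. real (c h :: nat) *\<^sub>R h)"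
          unfolding int_generating_def by simp
        then show thesis using that by auto
      qed
      have "F \<subseteq> ?L \<inter> gen_cone A"
      proof
        fix x assume "x \<in> F"
        then have "x \<in> Irr" using F(2) H by auto
        from Irr_L[OF this] Irr_C[OF this] show "x \<in> ?L \<inter> gen_cone A" by simp
      qed
      then have "u \<in> F" by (rule Irr_in_generating_set[OF u(1) F(1) _ F(3)])
      then show False using u F by auto
    qed
  qed
  ultimately show ?thesis using cone triang_regular[OF T(1)] by blast
qed

end
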